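(* Let $d\in\{1,2\}$, $\mu\in\{1,-1\}$, and let $T,r>0$ be arbitrarily small positive constants. Consider the initial value problem $$i\partial_t u+\Delta u=\mu|u|^{4/d}u,\qquad u(0,x)=u_0(x),\qquad x\in\mathbb{T}^d.$$ Assume that the data-to-solution map $S:u_0\mapsto u(\cdot)$ associated with this problem on smooth data extends continuously to a map from the closed ball $\{u_0\in L^2(\mathbb{T}^d):\|u_0\|_{L^2(\mathbb{T}^d)}\le r\}$ into $C([0,T];L^2(\mathbb{T}^d))$. Then this (extended) map is not $C^5$ at the origin when $d=1$, and is not $C^3$ at the origin when $d=2$.
   Context: $\mathbb{T}^d:=\mathbb{R}^d/(2\pi\mathbb{Z})^d$; functions are complex-valued. The data-to-solution map on smooth data sends $u_0\in C^\infty(\mathbb{T}^d)$ with $\|u_0\|_{L^2}\le r$ to the corresponding smooth solution $u$ of the initial value problem on $[0,T]\times\mathbb{T}^d$. $L^2(\mathbb{T}^d)$ and $C([0,T];L^2(\mathbb{T}^d))$ (with the norm $\sup_{t\in[0,T]}\|u(t)\|_{L^2}$) are regarded as real Banach spaces, and "$C^k$ at the origin" refers to $k$-times continuous Fréchet differentiability of the map near the origin $u_0=0$. *)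

theory Defs
  imports "HOL-Analysis.Analysis"
begin

section \<open>The torus and its $L^2$ space\<close>

text \<open>
  Functions on $\mathbb{T}^d = \mathbb{R}^d/(2\pi\mathbb{Z})^d$ are functions on \<^typ>\<open>real ^ 'd\<close>
  (with $d$ = \<open>CARD('d)\<close>) that are $2\pi$-periodic in every coordinate; integration over the torus
  is Lebesgue integration over the fundamental cell $[0,2\pi]^d$.
\<close>

definition torus_periodic :: "(real ^ 'd \<Rightarrow> 'b) \<Rightarrow> bool" where
  "torus_periodic f \<longleftrightarrow> (\<forall>x i. f (x + (2 * pi) *\<^sub>R axis i 1) = f x)"

definition torus_measure :: "(real ^ 'd) measure" where
  "torus_measure = restrict_space lborel (cbox 0 (\<chi> i. 2 * pi))"

definition torus_square_integrable :: "(real ^ 'd \<Rightarrow> complex) \<Rightarrow> bool" where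
  "torus_square_integrable f \<longleftrightarrow>
     torus_periodic f \<and> f \<in> borel_measurable borel \<and> integrable torus_measure (\<lambda>x. (norm (f x))\<^sup>2)"

definition torus_ae_eq :: "(real ^ 'd \<Rightarrow> complex) \<Rightarrow> (real ^ 'd \<Rightarrow> complex) \<Rightarrow> bool" where
  "torus_ae_eq f g \<longleftrightarrow>
     torus_square_integrable f \<and> torus_square_integrable g \<and> (AE x in torus_measure. f x = g x)"

lemma torus_square_integrable_0 [simp]: "torus_square_integrable (\<lambda>_. 0)"
  by (simp add: torus_square_integrable_def torus_periodic_def)

lemma part_equivp_torus_ae_eq: "part_equivp torus_ae_eq"
proof (rule part_equivpI)
  show "\<exists>x. torus_ae_eq x x"
    by (rule exI[of _ "\<lambda>_. 0"]) (simp add: torus_ae_eq_def)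
  show "symp torus_ae_eq"
    by (rule sympI) (auto simp: torus_ae_eq_def eq_commute)
  show "transp torus_ae_eq"
    by (rule transpI) (auto simp: torus_ae_eq_def elim: AE_mp)
qed

text \<open>
  The type \<open>'d torus_L2\<close> is $L^2(\mathbb{T}^d;\mathbb{C})$, as a real vector space.  For functions
  \<open>f\<close> that are square integrable, \<open>abs_torus_L2 f\<close> is the class of \<open>f\<close>.
\<close>

quotient_type (overloaded) 'd torus_L2 = "real ^ ('d::finite) \<Rightarrow> complex" / partial: torus_ae_eq
  by (rule part_equivp_torus_ae_eq)

lemma borel_measurable_torus_measure: "f \<in> borel_measurable borel \<Longrightarrow> f \<in> borel_measurable torus_measure"
  unfolding torus_measure_def by (intro measurable_restrict_space1) simp

lemma torus_square_integrable_scaleR: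
  assumes "torus_square_integrable f"
  shows "torus_square_integrable (\<lambda>x. c *\<^sub>R f x)"
  using assms by (auto simp: torus_square_integrable_def torus_periodic_def power_mult_distrib)

lemma torus_square_integrable_add:
  assumes f: "torus_square_integrable f" and g: "torus_square_integrable g"
  shows "torus_square_integrable (\<lambda>x. f x + g x)"
proof -
  have meas: "f \<in> borel_measurable borel" "g \<in> borel_measurable borel"
    using f g by (auto simp: torus_square_integrable_def)
  have "integrable torus_measure (\<lambda>x. (norm (f x + g x))\<^sup>2)"
  proof (rule Bochner_Integration.integrable_bound)
    show "integrable torus_measure (\<lambda>x. 2 * (norm (f x))\<^sup>2 + 2 * (norm (g x))\<^sup>2)"
      using f g by (auto simp: torus_square_integrable_def)
    show "(\<lambda>x. (norm (f x + g x))\<^sup>2) \<in> borel_measurable torus_measure"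
      using meas by (intro borel_measurable_torus_measure) measurable
    have "(norm (f x + g x))\<^sup>2 \<le> 2 * (norm (f x))\<^sup>2 + 2 * (norm (g x))\<^sup>2" for x
    proof -
      have "(norm (f x + g x))\<^sup>2 \<le> (norm (f x) + norm (g x))\<^sup>2"
        by (intro power_mono norm_triangle_ineq) auto
      also have "\<dots> \<le> 2 * (norm (f x))\<^sup>2 + 2 * (norm (g x))\<^sup>2"
        using zero_le_power2[of "norm (f x) - norm (g x)"]
        by (simp add: power2_sum power2_diff)
      finally show ?thesis .
    qed
    then show "AE x in torus_measure. norm ((norm (f x + g x))\<^sup>2)
        \<le> norm (2 * (norm (f x))\<^sup>2 + 2 * (norm (g x))\<^sup>2)"
      by (intro AE_I2) (auto simp: abs_of_nonneg)
  qed
  then show ?thesis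
    using f g by (auto simp: torus_square_integrable_def torus_periodic_def)
qed

lemma torus_integrable_inner:
  assumes f: "torus_square_integrable f" and g: "torus_square_integrable g"
  shows "integrable torus_measure (\<lambda>x. f x \<bullet> g x)"
proof (rule Bochner_Integration.integrable_bound)
  show "integrable torus_measure (\<lambda>x. (norm (f x))\<^sup>2 + (norm (g x))\<^sup>2)"
    using f g by (auto simp: torus_square_integrable_def)
  show "(\<lambda>x. f x \<bullet> g x) \<in> borel_measurable torus_measure"
    using f g by (intro borel_measurable_torus_measure) (auto simp: torus_square_integrable_def)
  have "\<bar>f x \<bullet> g x\<bar> \<le> (norm (f x))\<^sup>2 + (norm (g x))\<^sup>2" for x
  proof -
    have "\<bar>f x \<bullet> g x\<bar> \<le> norm (f x) * norm (g x)"
      by (rule Cauchy_Schwarz_ineq2)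
    also have "\<dots> \<le> (norm (f x))\<^sup>2 + (norm (g x))\<^sup>2"
      using zero_le_power2[of "norm (f x) - norm (g x)"]
        mult_nonneg_nonneg[OF norm_ge_zero[of "f x"] norm_ge_zero[of "g x"]]
      unfolding power2_diff by linarith
    finally show ?thesis .
  qed
  then show "AE x in torus_measure. norm (f x \<bullet> g x) \<le> norm ((norm (f x))\<^sup>2 + (norm (g x))\<^sup>2)"
    by (intro AE_I2) (auto simp: abs_of_nonneg)
qed

instantiation torus_L2 :: (finite) real_inner
begin

lift_definition zero_torus_L2 :: "'a torus_L2" is "\<lambda>_. 0"
  by (simp add: torus_ae_eq_def)

lift_definition plus_torus_L2 :: "'a torus_L2 \<Rightarrow> 'a torus_L2 \<Rightarrow> 'a torus_L2" is "\<lambda>f g x. f x + g x"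
  by (auto simp: torus_ae_eq_def torus_square_integrable_add)

lift_definition scaleR_torus_L2 :: "real \<Rightarrow> 'a torus_L2 \<Rightarrow> 'a torus_L2" is "\<lambda>c f x. c *\<^sub>R f x"
  by (auto simp: torus_ae_eq_def torus_square_integrable_scaleR)

lift_definition uminus_torus_L2 :: "'a torus_L2 \<Rightarrow> 'a torus_L2" is "\<lambda>f x. - f x"
  by (auto simp: torus_ae_eq_def dest: torus_square_integrable_scaleR[where c = "-1"])

definition minus_torus_L2 :: "'a torus_L2 \<Rightarrow> 'a torus_L2 \<Rightarrow> 'a torus_L2" where
  "minus_torus_L2 f g = f + - g"

text \<open>On complex numbers, \<open>z \<bullet> w\<close> is the real part of \<open>z * cnj w\<close>.\<close>

lift_definition inner_torus_L2 :: "'a torus_L2 \<Rightarrow> 'a torus_L2 \<Rightarrow> real"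
  is "\<lambda>f g. LINT x|torus_measure. f x \<bullet> g x"
  by (rule integral_cong_AE)
    (auto simp: torus_ae_eq_def torus_square_integrable_def intro!: borel_measurable_torus_measure elim: AE_mp)

lift_definition norm_torus_L2 :: "'a torus_L2 \<Rightarrow> real"
  is "\<lambda>f. sqrt (LINT x|torus_measure. (norm (f x))\<^sup>2)"
  by (rule arg_cong[where f = sqrt], rule integral_cong_AE)
    (auto simp: torus_ae_eq_def torus_square_integrable_def intro!: borel_measurable_torus_measure elim: AE_mp)

definition sgn_torus_L2 :: "'a torus_L2 \<Rightarrow> 'a torus_L2" where
  "sgn_torus_L2 f = inverse (norm f) *\<^sub>R f"

definition dist_torus_L2 :: "'a torus_L2 \<Rightarrow> 'a torus_L2 \<Rightarrow> real" where
  "dist_torus_L2 f g = norm (f - g)"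

definition uniformity_torus_L2 :: "('a torus_L2 \<times> 'a torus_L2) filter" where
  "uniformity_torus_L2 = (INF e\<in>{0<..}. principal {(x, y). dist x y < e})"

definition open_torus_L2 :: "'a torus_L2 set \<Rightarrow> bool" where
  "open_torus_L2 U \<longleftrightarrow> (\<forall>x\<in>U. eventually (\<lambda>(x', y). x' = x \<longrightarrow> y \<in> U) uniformity)"

instance
proof
  fix f g h :: "'a torus_L2" and a b :: real
  show "f + g + h = f + (g + h)"
    by transfer (auto simp: torus_ae_eq_def add.assoc intro!: torus_square_integrable_add)
  show "f + g = g + f"
    by transfer (auto simp: torus_ae_eq_def add.commute intro!: torus_square_integrable_add)
  show "0 + f = f"
    by transfer (auto simp: torus_ae_eq_def)
  show "- f + f = 0"
    by transfer (auto simp: torus_ae_eq_def)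
  show "f - g = f + - g"
    by (simp add: minus_torus_L2_def)
  show "a *\<^sub>R (f + g) = a *\<^sub>R f + a *\<^sub>R g"
    by transfer (auto simp: torus_ae_eq_def scaleR_add_right
        intro!: torus_square_integrable_add torus_square_integrable_scaleR)
  show "(a + b) *\<^sub>R f = a *\<^sub>R f + b *\<^sub>R f"
    by transfer (auto simp: torus_ae_eq_def scaleR_add_left
        intro!: torus_square_integrable_add torus_square_integrable_scaleR)
  show "a *\<^sub>R b *\<^sub>R f = (a * b) *\<^sub>R f"
    by transfer (auto simp: torus_ae_eq_def intro: torus_square_integrable_scaleR)
  show "1 *\<^sub>R f = f"
    by transfer (auto simp: torus_ae_eq_def)
  show "sgn f = inverse (norm f) *\<^sub>R f"
    by (simp add: sgn_torus_L2_def)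
  show "dist f g = norm (f - g)"
    by (simp add: dist_torus_L2_def)
  show "(uniformity :: ('a torus_L2 \<times> 'a torus_L2) filter)
      = (INF e\<in>{0<..}. principal {(x, y). dist x y < e})"
    by (rule uniformity_torus_L2_def)
  show "open U = (\<forall>x\<in>U. \<forall>\<^sub>F (x', y) in uniformity. x' = x \<longrightarrow> y \<in> U)" for U :: "'a torus_L2 set"
    by (rule open_torus_L2_def)
  show "f \<bullet> g = g \<bullet> f"
    by transfer (simp add: inner_commute)
  show "(f + g) \<bullet> h = f \<bullet> h + g \<bullet> h"
    by transfer (simp add: torus_ae_eq_def inner_add_left torus_integrable_inner)
  show "(a *\<^sub>R f) \<bullet> g = a * (f \<bullet> g)"
    by transfer simp
  show "0 \<le> f \<bullet> f"
    by transfer simp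
  show "f \<bullet> f = 0 \<longleftrightarrow> f = 0"
  proof transfer
    fix f :: "real ^ 'a \<Rightarrow> complex"
    assume "torus_ae_eq f f"
    then have f: "torus_square_integrable f"
      by (simp add: torus_ae_eq_def)
    have "(LINT x|torus_measure. f x \<bullet> f x) = 0 \<longleftrightarrow> (AE x in torus_measure. f x \<bullet> f x = 0)"
      by (rule integral_nonneg_eq_0_iff_AE[OF torus_integrable_inner[OF f f]]) simp
    then show "(LINT x|torus_measure. f x \<bullet> f x) = 0 \<longleftrightarrow> torus_ae_eq f (\<lambda>_. 0)"
      using f by (simp add: torus_ae_eq_def)
  qed
  show "norm f = sqrt (f \<bullet> f)"
    by transfer (simp add: power2_norm_eq_inner)
qed

end

lemma continuous_imp_torus_square_integrable:
  assumes "torus_periodic f" "continuous_on UNIV f"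
  shows "torus_square_integrable f"
proof -
  have "continuous_on (cbox 0 (\<chi> i. 2 * pi)) (\<lambda>x. (norm (f x))\<^sup>2)"
    by (intro continuous_intros continuous_on_subset[OF assms(2)]) auto
  then have "set_integrable lborel (cbox 0 (\<chi> i. 2 * pi)) (\<lambda>x. (norm (f x))\<^sup>2)"
    unfolding set_integrable_def by (rule borel_integrable_compact[OF compact_cbox])
  then have "integrable torus_measure (\<lambda>x. (norm (f x))\<^sup>2)"
    unfolding torus_measure_def set_integrable_def by (subst integrable_restrict_space) auto
  then show ?thesis
    using assms by (simp add: torus_square_integrable_def borel_measurable_continuous_onI)
qed

lemma norm_abs_torus_L2:
  assumes "torus_square_integrable f"
  shows "norm (abs_torus_L2 f) = sqrt (LINT x|torus_measure. (norm (f x))\<^sup>2)"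
  using assms by (intro norm_torus_L2.abs_eq) (simp add: torus_ae_eq_def)

section \<open>Smooth functions\<close>

text \<open>
  \<open>smooth_on S f\<close>: $f$ is $C^\infty$ on \<open>S\<close>, with derivatives at boundary points taken relative
  to \<open>S\<close>; meaningful when derivatives within \<open>S\<close> are unique, as for open sets and
  for $[0,T]\times\mathbb{R}^d$.  In finite dimensions, continuity of a derivative \<open>f'\<close>
  amounts to continuity of \<open>\<lambda>x. f' x v\<close> for every \<open>v\<close>.
\<close>

primrec Ck_on :: "'a::euclidean_space set \<Rightarrow> nat \<Rightarrow> ('a \<Rightarrow> 'b::real_normed_vector) \<Rightarrow> bool" where
  "Ck_on S 0 f \<longleftrightarrow> continuous_on S f"
| "Ck_on S (Suc k) f \<longleftrightarrow>
     (\<exists>f'. (\<forall>x\<in>S. (f has_derivative f' x) (at x within S)) \<and> (\<forall>v. Ck_on S k (\<lambda>x. f' x v)))"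

definition smooth_on :: "'a::euclidean_space set \<Rightarrow> ('a \<Rightarrow> 'b::real_normed_vector) \<Rightarrow> bool" where
  "smooth_on S f \<longleftrightarrow> (\<forall>k. Ck_on S k f)"

definition torus_smooth :: "(real ^ 'd \<Rightarrow> complex) \<Rightarrow> bool" where
  "torus_smooth f \<longleftrightarrow> torus_periodic f \<and> smooth_on UNIV f"

section \<open>The initial value problem\<close>

definition partial_deriv :: "'d \<Rightarrow> (real ^ 'd \<Rightarrow> complex) \<Rightarrow> real ^ 'd \<Rightarrow> complex" where
  "partial_deriv j f x = vector_derivative (\<lambda>s. f (x + s *\<^sub>R axis j 1)) (at 0)"

definition laplacian :: "(real ^ 'd \<Rightarrow> complex) \<Rightarrow> real ^ 'd \<Rightarrow> complex" where
  "laplacian f x = (\<Sum>j\<in>UNIV. partial_deriv j (partial_deriv j f) x)"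

definition smooth_nls_solution :: "real \<Rightarrow> real \<Rightarrow> (real \<Rightarrow> real ^ 'd \<Rightarrow> complex) \<Rightarrow> bool" where
  "smooth_nls_solution \<mu> T u \<longleftrightarrow>
     smooth_on ({0..T} \<times> UNIV) (\<lambda>(t, x). u t x) \<and>
     (\<forall>t\<in>{0..T}. torus_periodic (u t)) \<and>
     (\<forall>t\<in>{0..T}. \<forall>x.
        \<i> * vector_derivative (\<lambda>s. u s x) (at t within {0..T}) + laplacian (u t) x
          = of_real \<mu> * of_real (norm (u t x) powr (4 / real CARD('d))) * u t x)"

definition smooth_data_ball :: "real \<Rightarrow> (real ^ 'd \<Rightarrow> complex) set" where
  "smooth_data_ball r = {u\<^sub>0. torus_smooth u\<^sub>0 \<and> norm (abs_torus_L2 u\<^sub>0) \<le> r}"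

definition data_to_solution_map ::
    "real \<Rightarrow> real \<Rightarrow> real \<Rightarrow> ((real ^ 'd \<Rightarrow> complex) \<Rightarrow> real \<Rightarrow> real ^ 'd \<Rightarrow> complex) \<Rightarrow> bool" where
  "data_to_solution_map \<mu> T r S \<longleftrightarrow>
     (\<forall>u\<^sub>0\<in>smooth_data_ball r. smooth_nls_solution \<mu> T (S u\<^sub>0) \<and> S u\<^sub>0 0 = u\<^sub>0)"

section \<open>Continuous extension to $L^2$\<close>

text \<open>
  A type cannot depend on \<open>T\<close>, so $C([0,T];E)$ is represented by the closed subspace
  of the bounded continuous functions \<open>real \<Rightarrow>\<^sub>C E\<close> that are constant on $(-\infty,0]$ and
  on $[T,\infty)$.  Restriction to $[0,T]$ is an isometric isomorphism of this subspace onto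
  $C([0,T];E)$ with the supremum norm.  For maps with values in the subspace, Frechet
  derivatives in the ambient space again take values in the subspace, so
  being $C^k$ means the same for both target spaces.
\<close>

definition time_curves :: "real \<Rightarrow> (real \<Rightarrow>\<^sub>C 'a::real_normed_vector) set" where
  "time_curves T = {v. \<forall>t. apply_bcontfun v t = apply_bcontfun v (clamp 0 T t)}"

definition continuous_L2_extension ::
    "real \<Rightarrow> real \<Rightarrow> ((real ^ 'd \<Rightarrow> complex) \<Rightarrow> real \<Rightarrow> real ^ 'd \<Rightarrow> complex)
      \<Rightarrow> ('d torus_L2 \<Rightarrow> (real \<Rightarrow>\<^sub>C 'd torus_L2)) \<Rightarrow> bool" where
  "continuous_L2_extension T r S F \<longleftrightarrow>
     continuous_on (cball 0 r) F \<and> F ` cball 0 r \<subseteq> time_curves T \<and>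
     (\<forall>u\<^sub>0\<in>smooth_data_ball r. \<forall>t\<in>{0..T}.
        apply_bcontfun (F (abs_torus_L2 u\<^sub>0)) t = abs_torus_L2 (S u\<^sub>0 t))"

section \<open>Continuous Frechet differentiability\<close>

text \<open>
  \<open>C1_with P U f\<close>: on the open set \<open>U\<close>, \<open>f\<close> has a Frechet derivative, which as a map from
  \<open>U\<close> into the bounded linear operators satisfies \<open>P\<close>.  The derivative of a map
  \<open>'a \<Rightarrow> 'b\<close> has type \<open>'a \<Rightarrow> ('a \<Rightarrow>\<^sub>L 'b)\<close>, so $C^k$ for norm continuous derivatives cannot be
  defined by recursion on \<open>k\<close>; it is obtained for fixed \<open>k\<close> by iterating \<open>C1_with\<close>.
\<close>

definition C1_with ::
    "(('a \<Rightarrow> 'a \<Rightarrow>\<^sub>L 'b) \<Rightarrow> bool) \<Rightarrow> 'a set \<Rightarrow> ('a::real_normed_vector \<Rightarrow> 'b::real_normed_vector) \<Rightarrow> bool" where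
  "C1_with P U f \<longleftrightarrow> (\<exists>f'. (\<forall>x\<in>U. (f has_derivative blinfun_apply (f' x)) (at x)) \<and> P f')"

definition C3_on :: "'a set \<Rightarrow> ('a::real_normed_vector \<Rightarrow> 'b::real_normed_vector) \<Rightarrow> bool" where
  "C3_on U = C1_with (C1_with (C1_with (continuous_on U) U) U) U"

definition C5_on :: "'a set \<Rightarrow> ('a::real_normed_vector \<Rightarrow> 'b::real_normed_vector) \<Rightarrow> bool" where
  "C5_on U = C1_with (C1_with (C1_with (C1_with (C1_with (continuous_on U) U) U) U) U) U"

definition C3_at :: "'a \<Rightarrow> ('a::real_normed_vector \<Rightarrow> 'b::real_normed_vector) \<Rightarrow> bool" where
  "C3_at a f \<longleftrightarrow> (\<exists>U. open U \<and> a \<in> U \<and> C3_on U f)"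

definition C5_at :: "'a \<Rightarrow> ('a::real_normed_vector \<Rightarrow> 'b::real_normed_vector) \<Rightarrow> bool" where
  "C5_at a f \<longleftrightarrow> (\<exists>U. open U \<and> a \<in> U \<and> C5_on U f)"

end

theory Submission
  imports Defs "HOL-Number_Theory.Totient"
begin

text \<open>
Write $p = 2 + 4/d$, so that $p = 6$ for $d = 1$ and $p = 4$ for $d = 2$; the order of
differentiability in question is $p - 1$.  If the data-to-solution map is $C^{p-1}$ at the origin,
then its leading nonlinear Taylor coefficient is a bounded homogeneous map of degree $p - 1$ on $L^2$.
Paired with the free evolution $v(t) = e^{it\Delta}\varphi$ at time $T$, its value at $\varphi$ gives
$-i\mu \int_0^T \|v(t)\|_{L^p}^p\,dt$.  Boundedness therefore amounts to the Strichartz estimate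
$\|v\|_{L^p([0,T] \times \mathbb{T}^d)} \le C \|\varphi\|_{L^2}$, which is false on the torus by
Bourgain's counterexample.

The coefficient is identified without any well-posedness theory, by conservation laws of the given
smooth solutions $u$ with data $\delta\varphi$, where $\varphi$ is a trigonometric polynomial.
Conservation of mass and energy together with the Gagliardo-Nirenberg inequality, which is critical
and hence usable for both signs of $\mu$ when the mass is small, gives
$\|u(t)\|_{H^1} = O(\delta)$ on $[0,T]$ (\<open>small_data_H1_bound\<close>).  The function
$\langle u(t), v(t) \rangle$ changes only through the nonlinearity, hence equals
$\delta \|\varphi\|^2 + O(\delta^{p-1})$; since $u(t)$ and $\delta v(t)$ have the same mass, this
already forces $\|u(t) - \delta v(t)\|_{L^2} = O(\delta^{p/2})$.  Inserting this in the nonlinearity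
yields $\mathrm{Im} \langle u(T), v(T) \rangle = -\mu \delta^{p-1} \int_0^T \|v\|_{L^p}^p + O(\delta^p)$
(\<open>small_data_expansion\<close>).  Comparison with Taylor's theorem along the ray
$\delta \mapsto \delta\varphi$ gives the Strichartz estimate on $[0,T]$
(\<open>strichartz_of_differentiability\<close>).  Because $e^{i\tau\Delta}$ is an isometry, the estimate
passes to all translates of $[0,T]$ with the same constant, so it extends to the full period $[0,2\pi]$,
however small $T$ is.

On the full period the $L^p$ norm of $\sum_{n \in E} e^{i(n \cdot x - |n|^2 t)}$ counts the coincidences
$\sum n_k = \sum n'_k$, $\sum |n_k|^2 = \sum |n'_k|^2$.  In both dimensions these are parametrized by
the solutions of the equation $xy = zw$, of which there are at least
$\frac{1}{8} M^2 \sum_{m \le M} 1/m$ in $\{1,\dots,M\}^4$ (\<open>card_equal_products_ge\<close>).  The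
divergence of the harmonic series refutes the estimate (\<open>no_periodic_strichartz_estimate\<close>).
\<close>

section \<open>Integration over the torus\<close>

abbreviation torus_integral :: "(real ^ 'd \<Rightarrow> 'b::banach) \<Rightarrow> 'b" where
  "torus_integral f \<equiv> integral (cbox 0 (\<chi> i. 2 * pi)) f"

text \<open>
  A relation rather than a function, since differentiability has to be tracked along with the value.
\<close>

definition has_partial ::
    "'d \<Rightarrow> (real ^ 'd \<Rightarrow> 'b::real_normed_vector) \<Rightarrow> (real ^ 'd \<Rightarrow> 'b) \<Rightarrow> bool" where
  "has_partial j f f' \<longleftrightarrow> (\<forall>x. ((\<lambda>s. f (x + s *\<^sub>R axis j 1)) has_vector_derivative f' x) (at 0))"

lemma torus_periodicD: "torus_periodic f \<Longrightarrow> f (x + (2 * pi) *\<^sub>R axis i 1) = f x"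
  by (simp add: torus_periodic_def)

lemma continuous_on_shift:
  fixes g :: "'a::real_normed_vector \<Rightarrow> 'b::topological_space"
  assumes "continuous_on UNIV g"
  shows "continuous_on S (\<lambda>x. g (x + c))"
  by (rule continuous_on_compose2[OF assms]) (auto intro!: continuous_intros)

lemma integrable_torus_cell:
  fixes g :: "real ^ 'd \<Rightarrow> 'b::banach"
  shows "continuous_on UNIV g \<Longrightarrow> g integrable_on cbox a b"
  by (rule integrable_continuous) (rule continuous_on_subset, auto)

text \<open>
  The translated cell and the original cell differ by two slabs that are translates of each other by a
  full period.
\<close>

lemma torus_integral_translate:
  fixes g :: "real ^ 'd \<Rightarrow> 'b::banach"
  assumes per: "torus_periodic g" and cont: "continuous_on UNIV g" and s: "0 \<le> s" "s \<le> 2 * pi"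
  shows "torus_integral (\<lambda>x. g (x + s *\<^sub>R axis j 1)) = torus_integral g"
proof -
  define e :: "real ^ 'd" where "e = axis j 1"
  define b :: "real ^ 'd" where "b = (\<chi> i. 2 * pi)"
  define c :: "real ^ 'd" where "c = (\<chi> i. if i = j then s else 2 * pi)"
  have e: "e \<in> Basis" by (simp add: e_def)
  have e_nth: "e $ i = (if i = j then 1 else 0)" for i by (simp add: e_def axis_def)
  have all_split: "(\<forall>i. P i) \<longleftrightarrow> P j \<and> (\<forall>i\<in>-{j}. P i)" for P
    by auto
  have inner_e: "x \<bullet> e = x $ j" for x by (simp add: e_def inner_axis)
  have "torus_integral (\<lambda>x. g (x + s *\<^sub>R e)) = integral (cbox (s *\<^sub>R e) (b + s *\<^sub>R e)) g"
    using integral_shift_cbox[of "s *\<^sub>R e" "s *\<^sub>R e" "b + s *\<^sub>R e" g] by (simp add: b_def)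
  also have "\<dots> = integral (cbox (s *\<^sub>R e) (b + s *\<^sub>R e) \<inter> {x. x \<bullet> e \<le> 2 * pi}) g
                + integral (cbox (s *\<^sub>R e) (b + s *\<^sub>R e) \<inter> {x. x \<bullet> e \<ge> 2 * pi}) g"
    by (rule integral_split[OF integrable_torus_cell[OF cont] e])
  also have "cbox (s *\<^sub>R e) (b + s *\<^sub>R e) \<inter> {x. x \<bullet> e \<le> 2 * pi} = cbox 0 b \<inter> {x. x \<bullet> e \<ge> s}"
    using s by (auto simp: set_eq_iff mem_box_cart all_split e_nth inner_e b_def)
  also have "cbox (s *\<^sub>R e) (b + s *\<^sub>R e) \<inter> {x. x \<bullet> e \<ge> 2 * pi}
      = cbox ((2 * pi) *\<^sub>R e) (c + (2 * pi) *\<^sub>R e)"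
    using s by (auto simp: set_eq_iff mem_box_cart all_split e_nth inner_e b_def c_def)
  also have "integral (cbox ((2 * pi) *\<^sub>R e) (c + (2 * pi) *\<^sub>R e)) g = integral (cbox 0 c) g"
    using integral_shift_cbox[of "(2 * pi) *\<^sub>R e" "(2 * pi) *\<^sub>R e" "c + (2 * pi) *\<^sub>R e" g] per
    by (simp add: e_def torus_periodicD)
  also have "cbox 0 c = cbox 0 b \<inter> {x. x \<bullet> e \<le> s}"
    using s by (auto simp: set_eq_iff mem_box_cart all_split e_nth inner_e b_def c_def)
  also have "integral (cbox 0 b \<inter> {x. x \<bullet> e \<ge> s}) g + integral (cbox 0 b \<inter> {x. x \<bullet> e \<le> s}) g
      = torus_integral g"
    using integral_split[OF integrable_torus_cell[OF cont] e, of 0 b s] by (simp add: b_def)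
  finally show ?thesis by (simp add: e_def)
qed

lemma has_partial_shift:
  assumes "has_partial j g g'"
  shows "((\<lambda>s. g (x + s *\<^sub>R axis j 1)) has_vector_derivative g' (x + s *\<^sub>R axis j 1)) (at s)"
proof -
  have "((\<lambda>r. g ((x + s *\<^sub>R axis j 1) + r *\<^sub>R axis j 1)) has_vector_derivative g' (x + s *\<^sub>R axis j 1)) (at 0)"
    using assms by (simp add: has_partial_def)
  then have "((\<lambda>r. g (x + s *\<^sub>R axis j 1 + r *\<^sub>R axis j 1)) has_vector_derivative
      g' (x + s *\<^sub>R axis j 1)) (at (s - s))"
    by simp
  moreover have "((\<lambda>r. r - s) has_vector_derivative 1) (at s)"
    by (auto intro!: derivative_eq_intros)
  ultimately have "((\<lambda>r. g (x + s *\<^sub>R axis j 1 + r *\<^sub>R axis j 1)) \<circ> (\<lambda>r. r - s)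
      has_vector_derivative 1 *\<^sub>R g' (x + s *\<^sub>R axis j 1)) (at s)"
    by (intro vector_diff_chain_at)
  then show ?thesis by (simp add: o_def algebra_simps)
qed

text \<open>
  Integration by parts on the torus: the integral of $g(\cdot + s e_j)$ is independent of $s$;
  differentiate at $s = 0$.
\<close>

lemma torus_integral_partial_eq_0:
  fixes g :: "real ^ 'd \<Rightarrow> 'b::banach"
  assumes per: "torus_periodic g" and cont: "continuous_on UNIV g" "continuous_on UNIV g'"
    and der: "has_partial j g g'"
  shows "torus_integral g' = 0"
proof -
  define e :: "real ^ 'd" where "e = axis j 1"
  have "((\<lambda>s. torus_integral (\<lambda>x. g (x + s *\<^sub>R e))) has_vector_derivative
          torus_integral (\<lambda>x. g' (x + 0 *\<^sub>R e))) (at 0 within {0..1})"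
  proof (rule leibniz_rule_vector_derivative)
    show "((\<lambda>s. g (x + s *\<^sub>R e)) has_vector_derivative g' (x + s *\<^sub>R e)) (at s within {0..1})" for s x
      unfolding e_def by (rule has_vector_derivative_at_within[OF has_partial_shift[OF der]])
    show "(\<lambda>x. g (x + s *\<^sub>R e)) integrable_on cbox 0 (\<chi> i. 2 * pi)" for s
      by (intro integrable_torus_cell continuous_on_shift cont)
    show "continuous_on ({0..1} \<times> cbox 0 (\<chi> i. 2 * pi)) (\<lambda>(s, x). g' (x + s *\<^sub>R e))"
      unfolding split_def by (rule continuous_on_compose2[OF cont(2)]) (auto intro!: continuous_intros)
  qed auto
  then have 1: "((\<lambda>s. torus_integral (\<lambda>x. g (x + s *\<^sub>R e))) has_vector_derivative torus_integral g')
      (at 0 within {0..1})"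
    by simp
  have "((\<lambda>s::real. torus_integral g) has_vector_derivative torus_integral g') (at 0 within {0..1})"
  proof (rule has_vector_derivative_transform[OF _ _ 1])
    show "torus_integral g = torus_integral (\<lambda>x. g (x + s *\<^sub>R e))" if "s \<in> {0..1}" for s
      using torus_integral_translate[OF per cont(1), of s j] that pi_gt3 by (simp add: e_def)
  qed simp
  moreover have "((\<lambda>s::real. torus_integral g) has_vector_derivative 0) (at 0 within {0..1})"
    by (rule has_vector_derivative_const)
  ultimately show ?thesis
    by (intro vector_derivative_unique_within[of 0 "{0..1::real}"])
      (auto simp: trivial_limit_within islimpt_Icc)
qed

text \<open>
  Integration over the circle through $x$ in direction $e_j$.  It depends on $x$ only through the other
  coordinates, and it replaces iterated integration in coordinates of \<^typ>\<open>real ^ 'd\<close>.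
\<close>

definition line_integral :: "'d \<Rightarrow> (real ^ 'd \<Rightarrow> 'b::banach) \<Rightarrow> real ^ 'd \<Rightarrow> 'b" where
  "line_integral j g x = integral {0..2 * pi} (\<lambda>s. g (x + s *\<^sub>R axis j 1))"

lemma continuous_line_integral:
  assumes "continuous_on UNIV g"
  shows "continuous_on UNIV (line_integral j g)"
proof -
  have "continuous_on UNIV (\<lambda>x. integral (cbox 0 (2 * pi)) (\<lambda>s. g (x + s *\<^sub>R axis j 1)))"
    by (rule integral_continuous_on_param)
      (auto simp: split_def intro!: continuous_intros continuous_on_compose2[OF assms])
  then show ?thesis by (simp add: line_integral_def[abs_def])
qed

lemma line_integral_translate:
  assumes per: "torus_periodic g" and cont: "continuous_on UNIV g" and r: "0 \<le> r" "r \<le> 2 * pi"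
  shows "line_integral j g (x + r *\<^sub>R axis j 1) = line_integral j g x"
proof -
  define h where "h s = g (x + s *\<^sub>R axis j 1)" for s
  have h: "continuous_on A h" for A
    unfolding h_def by (rule continuous_on_compose2[OF cont]) (auto intro!: continuous_intros)
  have h_per: "h (s + 2 * pi) = h s" for s
    using torus_periodicD[OF per, of "x + s *\<^sub>R axis j 1" j] by (simp add: h_def algebra_simps)
  have "line_integral j g (x + r *\<^sub>R axis j 1) = integral {0..2 * pi} (\<lambda>s. h (s + r))"
    by (simp add: line_integral_def h_def algebra_simps)
  also have "\<dots> = integral {r..r + 2 * pi} h"
    using integral_shift_cbox[of r r "r + 2 * pi" h] by simp
  also have "\<dots> = integral {r..2 * pi} h + integral {2 * pi..r + 2 * pi} h"
    by (rule Henstock_Kurzweil_Integration.integral_combine[symmetric])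
      (use r in \<open>auto intro!: integrable_continuous_real h\<close>)
  also have "integral {2 * pi..r + 2 * pi} h = integral {0..r} h"
    using integral_shift_cbox[of "2 * pi" "2 * pi" "r + 2 * pi" h] by (simp add: h_per)
  also have "integral {r..2 * pi} h + integral {0..r} h = integral {0..2 * pi} h"
    using Henstock_Kurzweil_Integration.integral_combine[of 0 r "2 * pi" h] r
    by (simp add: integrable_continuous_real h add.commute)
  finally show ?thesis by (simp add: line_integral_def h_def[abs_def])
qed

lemma torus_integral_line_integral:
  fixes g :: "real ^ 'd \<Rightarrow> 'b::banach"
  assumes per: "torus_periodic g" and cont: "continuous_on UNIV g"
  shows "torus_integral (line_integral j g) = (2 * pi) *\<^sub>R torus_integral g"
proof -
  have "torus_integral (\<lambda>x. integral (cbox 0 (2 * pi)) (\<lambda>s. g (x + s *\<^sub>R axis j 1)))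
      = integral (cbox 0 (2 * pi)) (\<lambda>s. torus_integral (\<lambda>x. g (x + s *\<^sub>R axis j 1)))"
    by (rule integral_swap_continuous)
      (auto simp: split_def intro!: continuous_intros continuous_on_compose2[OF cont])
  also have "\<dots> = integral (cbox 0 (2 * pi)) (\<lambda>s. torus_integral g)"
    by (rule integral_cong) (use torus_integral_translate[OF per cont] in auto)
  finally show ?thesis by (simp add: line_integral_def[abs_def])
qed

lemma torus_periodic_compose2:
  "torus_periodic f \<Longrightarrow> torus_periodic g \<Longrightarrow> torus_periodic (\<lambda>x. h (f x) (g x))"
  by (simp add: torus_periodic_def)

lemma torus_periodic_compose:
  "torus_periodic f \<Longrightarrow> torus_periodic (\<lambda>x. h (f x))"
  by (simp add: torus_periodic_def)

lemma torus_periodic_line_integral: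
  assumes "torus_periodic g"
  shows "torus_periodic (line_integral j g)"
proof -
  have "g (x + (2 * pi) *\<^sub>R axis i 1 + s *\<^sub>R axis j 1) = g (x + s *\<^sub>R axis j 1)" for x i s
    using torus_periodicD[OF assms, of "x + s *\<^sub>R axis j 1" i] by (simp add: algebra_simps)
  then show ?thesis by (simp add: torus_periodic_def line_integral_def)
qed

lemma has_partial_unique: "has_partial j f f' \<Longrightarrow> has_partial j f f'' \<Longrightarrow> f' = f''"
  by (auto simp: has_partial_def fun_eq_iff intro: vector_derivative_unique_at)

lemma torus_periodic_partial:
  assumes "torus_periodic f" "has_partial j f f'"
  shows "torus_periodic f'"
proof -
  have "f' (x + (2 * pi) *\<^sub>R axis i 1) = f' x" for x i
  proof -
    have "((\<lambda>s. f (x + (2 * pi) *\<^sub>R axis i 1 + s *\<^sub>R axis j 1)) has_vector_derivative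
        f' (x + (2 * pi) *\<^sub>R axis i 1)) (at 0)"
      using assms(2) by (simp add: has_partial_def)
    moreover have "f (x + (2 * pi) *\<^sub>R axis i 1 + s *\<^sub>R axis j 1) = f (x + s *\<^sub>R axis j 1)" for s
      using torus_periodicD[OF assms(1), of "x + s *\<^sub>R axis j 1" i] by (simp add: algebra_simps)
    ultimately show ?thesis
      using assms(2) by (auto simp: has_partial_def intro: vector_derivative_unique_at)
  qed
  then show ?thesis by (simp add: torus_periodic_def)
qed

lemma torus_integral_mono:
  fixes f g :: "real ^ 'd \<Rightarrow> real"
  assumes "continuous_on UNIV f" "continuous_on UNIV g"
    "\<And>x. x \<in> cbox 0 (\<chi> i. 2 * pi) \<Longrightarrow> f x \<le> g x"
  shows "torus_integral f \<le> torus_integral g"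
  by (intro integral_le integrable_torus_cell assms)

lemma torus_integral_nonneg:
  fixes f :: "real ^ 'd \<Rightarrow> real"
  assumes "continuous_on UNIV f" "\<And>x. 0 \<le> f x"
  shows "0 \<le> torus_integral f"
  by (intro integral_nonneg integrable_torus_cell assms)

lemma norm_torus_integral_le:
  fixes f :: "real ^ 'd \<Rightarrow> 'b::banach"
  assumes "continuous_on UNIV f" "continuous_on UNIV g" "\<And>x. norm (f x) \<le> g x"
  shows "norm (torus_integral f) \<le> torus_integral g"
  by (intro integral_norm_bound_integral integrable_torus_cell assms)

text \<open>
  The quadratic polynomial $l \mapsto \int (l f - g)^2$ is nonnegative.
\<close>

lemma torus_integral_Cauchy_Schwarz:
  fixes f g :: "real ^ 'd \<Rightarrow> real"
  assumes f: "continuous_on UNIV f" and g: "continuous_on UNIV g"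
  shows "torus_integral (\<lambda>x. f x * g x)
    \<le> sqrt (torus_integral (\<lambda>x. (f x)\<^sup>2)) * sqrt (torus_integral (\<lambda>x. (g x)\<^sup>2))"
proof -
  define A B X where "A = torus_integral (\<lambda>x. (f x)\<^sup>2)" and "B = torus_integral (\<lambda>x. (g x)\<^sup>2)"
    and "X = torus_integral (\<lambda>x. f x * g x)"
  have A: "0 \<le> A" and B: "0 \<le> B"
    unfolding A_def B_def by (intro torus_integral_nonneg continuous_intros f g zero_le_power2)+
  have quad: "0 \<le> l\<^sup>2 * A - 2 * l * X + B" for l
  proof -
    have "0 \<le> torus_integral (\<lambda>x. (l * f x - g x)\<^sup>2)"
      by (intro torus_integral_nonneg continuous_intros f g) simp
    also have "(\<lambda>x. (l * f x - g x)\<^sup>2) = (\<lambda>x. l\<^sup>2 * (f x)\<^sup>2 - 2 * l * (f x * g x) + (g x)\<^sup>2)"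
      by (simp add: power2_eq_square algebra_simps)
    also have "torus_integral \<dots> = l\<^sup>2 * A - 2 * l * X + B"
      unfolding A_def B_def X_def
      by (simp add: integral_add integral_diff integrable_torus_cell continuous_on_mult
          continuous_on_diff continuous_on_power continuous_on_const f g)
    finally show ?thesis .
  qed
  have "X\<^sup>2 \<le> A * B"
  proof (cases "A = 0")
    case True
    have "X = 0"
    proof (rule ccontr)
      assume "X \<noteq> 0"
      then have "(2 * ((B + 1) / (2 * X)) * X) = B + 1" by simp
      then show False using quad[of "(B + 1) / (2 * X)"] True by simp
    qed
    then show ?thesis using True by simp
  next
    case False
    then have "0 < A" using A by simp
    then show ?thesis using quad[of "X / A"] by (simp add: field_simps power2_eq_square)
  qed
  then have "X \<le> sqrt (A * B)" by (rule real_le_rsqrt)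
  then show ?thesis unfolding A_def B_def X_def by (simp add: real_sqrt_mult)
qed

section \<open>Gagliardo-Nirenberg inequalities\<close>

text \<open>
  Along the circle, $|f|^2$ at the starting point exceeds its value at any other point by at most the
  integral of $|\partial_j |f|^2| \le 2 |f| |\partial_j f|$; average over the other point.
\<close>

lemma norm_sq_le_line_integral:
  fixes f f' :: "real ^ 'd \<Rightarrow> complex"
  assumes cf: "continuous_on UNIV f" and cf': "continuous_on UNIV f'" and der: "has_partial j f f'"
  shows "(norm (f x))\<^sup>2
    \<le> line_integral j (\<lambda>y. (norm (f y))\<^sup>2 / (2 * pi) + 2 * norm (f y) * norm (f' y)) x"
proof -
  define p where "p s = x + s *\<^sub>R axis j 1" for s
  define h where "h s = (norm (f (p s)))\<^sup>2" for s
  define h' where "h' s = 2 * (f (p s) \<bullet> f' (p s))" for s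
  define k where "k s = 2 * norm (f (p s)) * norm (f' (p s))" for s
  have p: "continuous_on A p" for A unfolding p_def by (intro continuous_intros)
  have fp: "continuous_on A (\<lambda>s. f (p s))" and f'p: "continuous_on A (\<lambda>s. f' (p s))" for A
    by (rule continuous_on_compose2[OF cf p] continuous_on_compose2[OF cf' p], simp)+
  have ch: "continuous_on A h" and ck: "continuous_on A k" and ch': "continuous_on A h'" for A
    unfolding h_def k_def h'_def by (intro continuous_intros fp f'p)+
  have h_der: "(h has_vector_derivative h' s) (at s within A)" for s A
  proof -
    have "((\<lambda>s. f (p s)) has_vector_derivative f' (p s)) (at s within A)"
      unfolding p_def by (rule has_vector_derivative_at_within[OF has_partial_shift[OF der]])
    from bounded_bilinear.has_vector_derivative[OF bounded_bilinear_inner this this]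
    show ?thesis
      by (simp add: h_def[abs_def] h'_def power2_norm_eq_inner inner_commute)
  qed
  have bound: "h 0 \<le> h s + integral {0..2 * pi} k" if s: "s \<in> {0..2 * pi}" for s
  proof -
    have "(h' has_integral (h s - h 0)) {0..s}"
      using s by (intro fundamental_theorem_of_calculus h_der) auto
    then have "h s - h 0 = integral {0..s} h'" by (simp add: integral_unique)
    also have "norm \<dots> \<le> integral {0..s} k"
    proof (rule integral_norm_bound_integral)
      fix r
      show "norm (h' r) \<le> k r"
        using Cauchy_Schwarz_ineq2[of "f (p r)" "f' (p r)"] by (simp add: h'_def k_def abs_mult)
    qed (auto intro!: integrable_continuous_real ch' ck)
    also have "\<dots> \<le> integral {0..2 * pi} k"
      using s by (intro integral_subset_le) (auto intro!: integrable_continuous_real ck simp: k_def)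
    finally show ?thesis by simp
  qed
  have "integral {0..2 * pi} (\<lambda>s. h 0) \<le> integral {0..2 * pi} (\<lambda>s. h s + integral {0..2 * pi} k)"
    by (rule integral_le) (auto intro!: integrable_continuous_real continuous_intros ch bound)
  also have "\<dots> = integral {0..2 * pi} h + 2 * pi * integral {0..2 * pi} k"
    by (subst integral_add) (auto intro!: integrable_continuous_real ch)
  finally have "h 0 \<le> integral {0..2 * pi} h / (2 * pi) + integral {0..2 * pi} k"
    by (simp add: field_simps)
  also have "\<dots> = integral {0..2 * pi} (\<lambda>s. h s / (2 * pi) + k s)"
    by (subst integral_add) (auto intro!: integrable_continuous_real continuous_intros ch ck)
  finally show ?thesis
    by (simp add: line_integral_def h_def k_def p_def)
qed

lemma content_torus_cell: "measure lborel (cbox 0 (\<chi> i::'d::finite. 2 * pi)) = (2 * pi) ^ CARD('d)"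
  by (subst content_cbox_cart) (auto simp: interval_eq_empty_cart)

lemma torus_integral_const: "torus_integral (\<lambda>x::real^'d. c::real) = (2 * pi) ^ CARD('d) * c"
  by (simp add: content_torus_cell)

lemma torus_cell_nth: "y \<in> cbox 0 (\<chi> i. 2 * pi) \<Longrightarrow> 0 \<le> y $ i \<and> y $ i \<le> 2 * pi"
  by (auto simp: mem_box_cart)

text \<open>
  The line integral is constant on the cell, and its own integral is known.
\<close>

lemma line_integral_dim1:
  fixes g :: "real ^ 'd \<Rightarrow> real"
  assumes per: "torus_periodic g" and cont: "continuous_on UNIV g"
    and d: "(UNIV :: 'd set) = {j}" and y: "y \<in> cbox 0 (\<chi> i. 2 * pi)"
  shows "line_integral j g y = torus_integral g"
proof -
  have const: "line_integral j g y = line_integral j g 0" if y: "y \<in> cbox 0 (\<chi> i. 2 * pi)" for y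
  proof -
    have "y $ i = y $ j" for i using d by (metis (full_types) UNIV_I singletonD)
    then have "y = 0 + (y $ j) *\<^sub>R axis j 1"
      using d by (auto simp: vec_eq_iff axis_def)
    then show ?thesis
      using line_integral_translate[OF per cont, of "y $ j" j 0] torus_cell_nth[OF y, of j] by simp
  qed
  have "2 * pi * torus_integral g = torus_integral (line_integral j g)"
    by (simp add: torus_integral_line_integral[OF per cont])
  also have "\<dots> = torus_integral (\<lambda>x::real^'d. line_integral j g 0)"
    by (rule integral_cong) (rule const)
  also have "\<dots> = 2 * pi * line_integral j g 0"
    by (subst torus_integral_const) (simp add: d)
  finally show ?thesis using const[OF y] by simp
qed

lemma line_integral_dim2:
  fixes g :: "real ^ 'd \<Rightarrow> real"
  assumes per: "torus_periodic g" and cont: "continuous_on UNIV g"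
    and d: "(UNIV :: 'd set) = {i, j}" "i \<noteq> j" and y: "y \<in> cbox 0 (\<chi> i. 2 * pi)"
  shows "line_integral i (line_integral j g) y = torus_integral g"
proof -
  note per' = torus_periodic_line_integral[OF per] and cont' = continuous_line_integral[OF cont]
  have swap: "line_integral i (line_integral j g) (x + s *\<^sub>R axis j 1)
      = line_integral i (line_integral j g) x" if s: "0 \<le> s" "s \<le> 2 * pi" for x s
  proof -
    have "line_integral j g (x + s *\<^sub>R axis j 1 + r *\<^sub>R axis i 1)
        = line_integral j g (x + r *\<^sub>R axis i 1)" for r
      using line_integral_translate[OF per cont s, of j "x + r *\<^sub>R axis i 1"]
      by (simp add: algebra_simps)
    then show ?thesis by (simp add: line_integral_def[of i])
  qed
  have const: "line_integral i (line_integral j g) y = line_integral i (line_integral j g) 0"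
    if y: "y \<in> cbox 0 (\<chi> i. 2 * pi)" for y
  proof -
    have "y $ k = (0 + (y $ i) *\<^sub>R axis i 1 + (y $ j) *\<^sub>R axis j 1) $ k" for k
      using d UNIV_I[of k] unfolding d(1) by (auto simp: axis_def)
    then have "y = 0 + (y $ i) *\<^sub>R axis i 1 + (y $ j) *\<^sub>R axis j 1"
      by (intro iffD2[OF vec_eq_iff] allI)
    then have "line_integral i (line_integral j g) y
        = line_integral i (line_integral j g) (0 + (y $ i) *\<^sub>R axis i 1 + (y $ j) *\<^sub>R axis j 1)"
      by (rule arg_cong)
    also have "\<dots> = line_integral i (line_integral j g) (0 + (y $ i) *\<^sub>R axis i 1)"
      by (rule swap) (use torus_cell_nth[OF y] in auto)
    also have "\<dots> = line_integral i (line_integral j g) 0"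
      by (rule line_integral_translate[OF per' cont']) (use torus_cell_nth[OF y] in auto)
    finally show ?thesis .
  qed
  have "(2 * pi)\<^sup>2 * torus_integral g = torus_integral (line_integral i (line_integral j g))"
    by (simp add: torus_integral_line_integral[OF per' cont'] torus_integral_line_integral[OF per cont]
        power2_eq_square)
  also have "\<dots> = torus_integral (\<lambda>x::real^'d. line_integral i (line_integral j g) 0)"
    by (rule integral_cong) (rule const)
  also have "\<dots> = (2 * pi)\<^sup>2 * line_integral i (line_integral j g) 0"
    by (subst torus_integral_const) (simp add: d power2_eq_square)
  finally show ?thesis using const[OF y] by simp
qed

text \<open>
  In dimension two the first factor depends only on $x_j$ and the second only on $x_i$, so the
  integral factorizes.  This is the Fubini step in Ladyzhenskaya's inequality.
\<close>

lemma torus_integral_line_integral_mult: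
  fixes g h :: "real ^ 'd \<Rightarrow> real"
  assumes per: "torus_periodic g" "torus_periodic h"
    and cont: "continuous_on UNIV g" "continuous_on UNIV h"
    and d: "(UNIV :: 'd set) = {i, j}" "i \<noteq> j"
  shows "torus_integral (\<lambda>x. line_integral i g x * line_integral j h x)
    = torus_integral g * torus_integral h"
proof -
  let ?P = "\<lambda>x. line_integral i g x * line_integral j h x"
  note per' = torus_periodic_line_integral and cont' = continuous_line_integral
  have P: "torus_periodic ?P" "continuous_on UNIV ?P"
    using torus_periodic_compose2[OF per'[OF per(1)] per'[OF per(2)], where h = "(*)"]
    by (auto intro!: continuous_intros cont' cont)
  have "2 * pi * torus_integral ?P = torus_integral (line_integral i ?P)"
    by (simp add: torus_integral_line_integral[OF P])
  also have "\<dots> = torus_integral (\<lambda>x. line_integral i g x * torus_integral h)"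
  proof (rule integral_cong)
    fix x :: "real ^ 'd" assume x: "x \<in> cbox 0 (\<chi> i. 2 * pi)"
    have "line_integral i ?P x
        = integral {0..2 * pi} (\<lambda>s. line_integral i g x * line_integral j h (x + s *\<^sub>R axis i 1))"
      unfolding line_integral_def[of i ?P]
      by (rule integral_cong) (use line_integral_translate[OF per(1) cont(1)] in auto)
    also have "\<dots> = line_integral i g x * line_integral i (line_integral j h) x"
      by (simp add: line_integral_def[of i "line_integral j h"])
    also have "line_integral i (line_integral j h) x = torus_integral h"
      by (rule line_integral_dim2[OF per(2) cont(2) d x])
    finally show "line_integral i ?P x = line_integral i g x * torus_integral h" .
  qed
  also have "\<dots> = 2 * pi * (torus_integral g * torus_integral h)"
    by (simp add: torus_integral_line_integral[OF per(1) cont(1)])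
  finally show ?thesis by simp
qed

text \<open>
  The weight that bounds $|f|^2$ in \<open>norm_sq_le_line_integral\<close> has an integral controlled by
  mass and kinetic energy, with the geometric mean that makes the inequalities below scale correctly.
\<close>

lemma torus_integral_sobolev_weight:
  fixes f f' :: "real ^ 'd \<Rightarrow> complex"
  assumes cf: "continuous_on UNIV f" and cf': "continuous_on UNIV f'"
  defines "m \<equiv> torus_integral (\<lambda>x. (norm (f x))\<^sup>2)" and "K \<equiv> torus_integral (\<lambda>x. (norm (f' x))\<^sup>2)"
  shows "torus_integral (\<lambda>x. (norm (f x))\<^sup>2 / (2 * pi) + 2 * norm (f x) * norm (f' x))
    \<le> m + 2 * (sqrt m * sqrt K)"
proof -
  have "torus_integral (\<lambda>x. (norm (f x))\<^sup>2 / (2 * pi) + 2 * (norm (f x) * norm (f' x)))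
      = m / (2 * pi) + 2 * torus_integral (\<lambda>x. norm (f x) * norm (f' x))"
    unfolding m_def
    by (subst integral_add) (auto intro!: integrable_torus_cell continuous_intros cf cf')
  also have "\<dots> \<le> m + 2 * (sqrt m * sqrt K)"
  proof (rule add_mono)
    have "0 \<le> m" unfolding m_def by (intro torus_integral_nonneg continuous_intros cf) auto
    then show "m / (2 * pi) \<le> m" using pi_gt3 mult_left_mono[of 1 "2 * pi" m] by (simp add: field_simps)
    show "2 * torus_integral (\<lambda>x. norm (f x) * norm (f' x)) \<le> 2 * (sqrt m * sqrt K)"
      unfolding m_def K_def
      by (intro mult_left_mono torus_integral_Cauchy_Schwarz continuous_intros cf cf') auto
  qed
  finally show ?thesis by (simp add: mult.assoc)
qed

lemma sobolev_weight_bounds: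
  fixes m K :: real
  assumes "0 \<le> m" "0 \<le> K"
  shows "0 \<le> m + 2 * (sqrt m * sqrt K)" "m + 2 * (sqrt m * sqrt K) \<le> 2 * (m + K)"
    "(m + 2 * (sqrt m * sqrt K))\<^sup>2 \<le> 8 * m * (m + K)"
proof -
  show "0 \<le> m + 2 * (sqrt m * sqrt K)" using assms by simp
  have "0 \<le> (sqrt m - sqrt K)\<^sup>2" by simp
  then have "2 * (sqrt m * sqrt K) \<le> m + K" using assms by (simp add: power2_diff)
  then show "m + 2 * (sqrt m * sqrt K) \<le> 2 * (m + K)" using assms by simp
  have "(m + 2 * (sqrt m * sqrt K))\<^sup>2 \<le> 2 * m\<^sup>2 + 2 * (2 * (sqrt m * sqrt K))\<^sup>2"
    using zero_le_power2[of "m - 2 * (sqrt m * sqrt K)"] unfolding power2_sum power2_diff by linarith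
  also have "\<dots> = 2 * m\<^sup>2 + 8 * (m * K)" using assms by (simp add: power_mult_distrib)
  also have "\<dots> \<le> 8 * m * (m + K)" using assms by (simp add: power2_eq_square algebra_simps)
  finally show "(m + 2 * (sqrt m * sqrt K))\<^sup>2 \<le> 8 * m * (m + K)" .
qed

lemma torus_periodic_sobolev_weight:
  assumes "torus_periodic f" "has_partial j f f'"
  shows "torus_periodic (\<lambda>x. (norm (f x))\<^sup>2 / (2 * pi) + 2 * norm (f x) * norm (f' x))"
  using assms torus_periodic_partial[OF assms] by (auto simp: torus_periodic_def)

text \<open>
  In dimension one the weight bounds $\sup |f|^2$; in dimension two $|f|^4$ is bounded by a product of two
  line integrals.  The first estimate has the critical form, linear in the kinetic energy and with a
  positive power of the mass in front, so that for small mass the potential energy is dominated by the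
  kinetic energy.  The second one provides the integrability for the $L^2$ norm of $|f|^e$.
\<close>

lemma gagliardo_nirenberg:
  fixes f :: "real ^ 'd \<Rightarrow> complex"
  assumes d: "CARD('d) \<in> {1, 2}"
    and per: "torus_periodic f" and cf: "continuous_on UNIV f"
    and cf': "\<And>j. continuous_on UNIV (f' j)" and der: "\<And>j. has_partial j f (f' j)"
  defines "m \<equiv> torus_integral (\<lambda>x. (norm (f x))\<^sup>2)"
    and "K \<equiv> (\<Sum>j\<in>UNIV. torus_integral (\<lambda>x. (norm (f' j x))\<^sup>2))"
    and "e \<equiv> 4 div CARD('d)"
  shows "torus_integral (\<lambda>x. norm (f x) ^ (e + 2)) \<le> 8 * m ^ (e div 2) * (m + K)"
    and "torus_integral (\<lambda>x. norm (f x) ^ (2 * e)) \<le> 112 * (m + K) ^ e"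
proof -
  define w where "w j x = (norm (f x))\<^sup>2 / (2 * pi) + 2 * norm (f x) * norm (f' j x)" for j x
  define k where "k j = torus_integral (\<lambda>x. (norm (f' j x))\<^sup>2)" for j
  define b where "b = m + 2 * (sqrt m * sqrt K)"
  have m: "0 \<le> m" unfolding m_def by (intro torus_integral_nonneg continuous_intros cf) auto
  have k: "0 \<le> k j" for j unfolding k_def by (intro torus_integral_nonneg continuous_intros cf') auto
  have kK: "k j \<le> K" for j
    unfolding K_def k_def[symmetric] by (rule member_le_sum) (auto intro: k)
  have K: "0 \<le> K" using k kK order_trans by blast
  have w_per: "torus_periodic (w j)" for j
    unfolding w_def[abs_def] by (rule torus_periodic_sobolev_weight[OF per der])
  have w_cont: "continuous_on UNIV (w j)" for j
    unfolding w_def[abs_def] by (intro continuous_intros cf cf') auto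
  have w_nonneg: "0 \<le> w j x" for j x by (simp add: w_def)
  have w_int: "torus_integral (w j) \<le> b" for j
  proof -
    have "torus_integral (w j) \<le> m + 2 * (sqrt m * sqrt (k j))"
      unfolding w_def[abs_def] m_def k_def by (rule torus_integral_sobolev_weight[OF cf cf'])
    also have "\<dots> \<le> b" unfolding b_def
      using m kK[of j] by (intro add_left_mono mult_left_mono real_sqrt_le_mono) auto
    finally show ?thesis .
  qed
  have w_int0: "0 \<le> torus_integral (w j)" for j by (intro torus_integral_nonneg w_cont w_nonneg)
  have pw: "(norm (f x))\<^sup>2 \<le> line_integral j (w j) x" for j x
    unfolding w_def[abs_def] by (rule norm_sq_le_line_integral[OF cf cf' der])
  note b = sobolev_weight_bounds[OF m K, folded b_def]
  consider (1) "CARD('d) = 1" | (2) "CARD('d) = 2" using d by auto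
  then have "torus_integral (\<lambda>x. norm (f x) ^ (e + 2)) \<le> 8 * m ^ (e div 2) * (m + K) \<and>
    torus_integral (\<lambda>x. norm (f x) ^ (2 * e)) \<le> 112 * (m + K) ^ e"
  proof cases
    case 1
    then obtain j :: 'd where j: "(UNIV :: 'd set) = {j}" by (auto simp: card_1_singleton_iff)
    have sup: "(norm (f x))\<^sup>2 \<le> b" if "x \<in> cbox 0 (\<chi> i. 2 * pi)" for x
      using pw[of x j] w_int[of j] line_integral_dim1[OF w_per w_cont j that] by simp
    have "torus_integral (\<lambda>x. norm (f x) ^ 6) \<le> torus_integral (\<lambda>x. b\<^sup>2 * (norm (f x))\<^sup>2)"
    proof (intro torus_integral_mono continuous_intros cf)
      fix x :: "real ^ 'd" assume "x \<in> cbox 0 (\<chi> i. 2 * pi)"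
      then have "((norm (f x))\<^sup>2)\<^sup>2 * (norm (f x))\<^sup>2 \<le> b\<^sup>2 * (norm (f x))\<^sup>2"
        by (intro mult_right_mono power_mono sup) auto
      then show "norm (f x) ^ 6 \<le> b\<^sup>2 * (norm (f x))\<^sup>2" by (simp flip: power_mult power_add)
    qed
    also have "\<dots> = b\<^sup>2 * m" by (simp add: m_def)
    also have "\<dots> \<le> 8 * m * (m + K) * m" by (intro mult_right_mono b m)
    finally have 6: "torus_integral (\<lambda>x. norm (f x) ^ 6) \<le> 8 * m\<^sup>2 * (m + K)"
      by (simp add: power2_eq_square mult_ac)
    have "torus_integral (\<lambda>x. norm (f x) ^ 8) \<le> torus_integral (\<lambda>x::real^'d. (2 * (m + K)) ^ 4)"
    proof (intro torus_integral_mono continuous_intros cf)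
      fix x :: "real ^ 'd" assume "x \<in> cbox 0 (\<chi> i. 2 * pi)"
      then have "((norm (f x))\<^sup>2) ^ 4 \<le> (2 * (m + K)) ^ 4"
        by (intro power_mono order_trans[OF sup b(2)]) auto
      then show "norm (f x) ^ 8 \<le> (2 * (m + K)) ^ 4" by (simp flip: power_mult)
    qed
    also have "\<dots> = 2 * pi * 16 * (m + K) ^ 4"
      by (subst torus_integral_const) (simp only: 1 power_mult_distrib, simp)
    also have "\<dots> \<le> 112 * (m + K) ^ 4"
      using pi_less_4 pi_approx m K by (intro mult_right_mono) auto
    finally show ?thesis using 6 by (simp add: e_def 1)
  next
    case 2
    then obtain i j :: 'd where ij: "(UNIV :: 'd set) = {i, j}" "i \<noteq> j"
      by (auto simp: card_2_iff)
    have "torus_integral (\<lambda>x. norm (f x) ^ 4)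
        \<le> torus_integral (\<lambda>x. line_integral i (w i) x * line_integral j (w j) x)"
    proof (intro torus_integral_mono continuous_intros cf continuous_line_integral w_cont)
      fix x
      have "(norm (f x))\<^sup>2 * (norm (f x))\<^sup>2 \<le> line_integral i (w i) x * line_integral j (w j) x"
        by (intro mult_mono pw order_trans[OF zero_le_power2 pw]) auto
      then show "norm (f x) ^ 4 \<le> line_integral i (w i) x * line_integral j (w j) x"
        by (simp flip: power_add)
    qed
    also have "\<dots> = torus_integral (w i) * torus_integral (w j)"
      by (rule torus_integral_line_integral_mult[OF w_per w_per w_cont w_cont ij])
    also have "\<dots> \<le> b * b" by (intro mult_mono w_int w_int0 b)
    also have "\<dots> \<le> 8 * m * (m + K)" using b(3) by (simp add: power2_eq_square)
    finally have 4: "torus_integral (\<lambda>x. norm (f x) ^ 4) \<le> 8 * m * (m + K)" .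
    also have "\<dots> \<le> 112 * (m + K)\<^sup>2"
      unfolding power2_eq_square mult.assoc[symmetric] using m K by (intro mult_right_mono) auto
    finally show ?thesis using 4 by (simp add: e_def 2)
  qed
  then show "torus_integral (\<lambda>x. norm (f x) ^ (e + 2)) \<le> 8 * m ^ (e div 2) * (m + K)"
    and "torus_integral (\<lambda>x. norm (f x) ^ (2 * e)) \<le> 112 * (m + K) ^ e" by auto
qed

section \<open>Conservation laws\<close>

lemma torus_integral_has_time_derivative:
  fixes f :: "real \<Rightarrow> real ^ 'd \<Rightarrow> 'b::banach"
  assumes der: "\<And>t x. t \<in> {0..T} \<Longrightarrow> ((\<lambda>s. f s x) has_vector_derivative f' t x) (at t within {0..T})"
    and cont: "continuous_on ({0..T} \<times> UNIV) (\<lambda>p. f (fst p) (snd p))"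
      "continuous_on ({0..T} \<times> UNIV) (\<lambda>p. f' (fst p) (snd p))"
    and t: "t \<in> {0..T}"
  shows "((\<lambda>s. torus_integral (f s)) has_vector_derivative torus_integral (f' t)) (at t within {0..T})"
proof (rule leibniz_rule_vector_derivative)
  show "f s integrable_on cbox 0 (\<chi> i. 2 * pi)" if s: "s \<in> {0..T}" for s
    by (rule integrable_torus_cell, rule continuous_on_compose2[OF cont(1), of _ "\<lambda>x. (s, x)", simplified])
      (use s in \<open>auto intro!: continuous_intros\<close>)
  show "continuous_on ({0..T} \<times> cbox 0 (\<chi> i. 2 * pi)) (\<lambda>(t, x). f' t x)"
    unfolding split_def by (rule continuous_on_subset[OF cont(2)]) auto
qed (use der t in auto)

lemma has_partial_mult:
  fixes f g :: "real ^ 'd \<Rightarrow> complex"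
  assumes "has_partial j f f'" "has_partial j g g'"
  shows "has_partial j (\<lambda>x. f x * g x) (\<lambda>x. f x * g' x + f' x * g x)"
  unfolding has_partial_def
proof
  fix x
  have "((\<lambda>s. f (x + s *\<^sub>R axis j 1)) has_vector_derivative f' x) (at 0)"
    "((\<lambda>s. g (x + s *\<^sub>R axis j 1)) has_vector_derivative g' x) (at 0)"
    using assms by (auto simp: has_partial_def)
  from has_vector_derivative_mult[OF this]
  show "((\<lambda>s. f (x + s *\<^sub>R axis j 1) * g (x + s *\<^sub>R axis j 1)) has_vector_derivative
      f x * g' x + f' x * g x) (at 0)"
    by simp
qed

lemma has_partial_diff:
  "has_partial j f f' \<Longrightarrow> has_partial j g g' \<Longrightarrow> has_partial j (\<lambda>x. f x - g x) (\<lambda>x. f' x - g' x)"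
  by (auto simp: has_partial_def intro: has_vector_derivative_diff)

lemma has_partial_cnj:
  "has_partial j f f' \<Longrightarrow> has_partial j (\<lambda>x. cnj (f x)) (\<lambda>x. cnj (f' x))"
  by (auto simp: has_partial_def intro!: bounded_linear.has_vector_derivative[OF bounded_linear_cnj])

text \<open>
  The regularity that the conservation laws use, with all derivatives named.  The mixed derivative
  \<open>utx\<close> is the time derivative of $\partial_j u$; its agreement with the space derivative of
  $\partial_t u$ enters in the weak form of \<open>gradient_derivative\<close>.
\<close>

locale C2_flow =
  fixes T :: real and u ut :: "real \<Rightarrow> real ^ 'd \<Rightarrow> complex"
    and ux uxx utx :: "'d \<Rightarrow> real \<Rightarrow> real ^ 'd \<Rightarrow> complex"
  assumes T: "0 < T"
    and per: "\<And>t. t \<in> {0..T} \<Longrightarrow> torus_periodic (u t)"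
    and cont_u: "continuous_on ({0..T} \<times> UNIV) (\<lambda>p. u (fst p) (snd p))"
    and cont_ut: "continuous_on ({0..T} \<times> UNIV) (\<lambda>p. ut (fst p) (snd p))"
    and cont_ux: "\<And>j. continuous_on ({0..T} \<times> UNIV) (\<lambda>p. ux j (fst p) (snd p))"
    and cont_uxx: "\<And>j. continuous_on ({0..T} \<times> UNIV) (\<lambda>p. uxx j (fst p) (snd p))"
    and cont_utx: "\<And>j. continuous_on ({0..T} \<times> UNIV) (\<lambda>p. utx j (fst p) (snd p))"
    and der_t: "\<And>t x. t \<in> {0..T} \<Longrightarrow>
      ((\<lambda>s. u s x) has_vector_derivative ut t x) (at t within {0..T})"
    and der_x: "\<And>j t. t \<in> {0..T} \<Longrightarrow> has_partial j (u t) (ux j t)"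
    and der_xx: "\<And>j t. t \<in> {0..T} \<Longrightarrow> has_partial j (ux j t) (uxx j t)"
    and der_tx: "\<And>j t x. t \<in> {0..T} \<Longrightarrow>
      ((\<lambda>s. ux j s x) has_vector_derivative utx j t x) (at t within {0..T})"
begin

definition lap :: "real \<Rightarrow> real ^ 'd \<Rightarrow> complex" where
  "lap t x = (\<Sum>j\<in>UNIV. uxx j t x)"

text \<open>
  The defect in the free equation $\partial_t u = i \Delta u$.
\<close>

definition residual :: "real \<Rightarrow> real ^ 'd \<Rightarrow> complex" where
  "residual t x = ut t x - \<i> * lap t x"

lemma slice:
  fixes f :: "real \<Rightarrow> real ^ 'd \<Rightarrow> 'b::topological_space"
  assumes "continuous_on ({0..T} \<times> UNIV) (\<lambda>p. f (fst p) (snd p))" "t \<in> {0..T}"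
  shows "continuous_on UNIV (f t)"
proof -
  have "continuous_on UNIV (\<lambda>x::real^'d. (t, x))" by (intro continuous_intros)
  moreover have "range (\<lambda>x::real^'d. (t, x)) \<subseteq> {0..T} \<times> UNIV" using assms(2) by auto
  ultimately have "continuous_on UNIV (\<lambda>x. f (fst (t, x)) (snd (t, x)))"
    by (rule continuous_on_compose2[OF assms(1), where f = "\<lambda>x. (t, x)"])
  then show ?thesis by simp
qed

lemma cont_lap: "continuous_on ({0..T} \<times> UNIV) (\<lambda>p. lap (fst p) (snd p))"
  unfolding lap_def by (intro continuous_intros cont_uxx)

lemmas cont_slices = slice[OF cont_u] slice[OF cont_ut] slice[OF cont_ux] slice[OF cont_uxx]
  slice[OF cont_utx] slice[OF cont_lap]

lemma per_ux: "t \<in> {0..T} \<Longrightarrow> torus_periodic (ux j t)"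
  using torus_periodic_partial[OF per der_x] .

end

text \<open>
  The integrand is the divergence of $\bar g \nabla f - f \nabla \bar g$.
\<close>

lemma green_identity:
  fixes f g :: "real ^ 'd \<Rightarrow> complex"
  assumes per: "torus_periodic f" "torus_periodic g"
    and cont: "continuous_on UNIV f" "continuous_on UNIV g" "\<And>j. continuous_on UNIV (f' j)"
      "\<And>j. continuous_on UNIV (g' j)" "\<And>j. continuous_on UNIV (f'' j)" "\<And>j. continuous_on UNIV (g'' j)"
    and der: "\<And>j. has_partial j f (f' j)" "\<And>j. has_partial j g (g' j)"
      "\<And>j. has_partial j (f' j) (f'' j)" "\<And>j. has_partial j (g' j) (g'' j)"
  shows "torus_integral (\<lambda>x. (\<Sum>j\<in>UNIV. f'' j x) * cnj (g x) - f x * cnj (\<Sum>j\<in>UNIV. g'' j x)) = 0"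
proof -
  have "torus_integral (\<lambda>x. f'' j x * cnj (g x) - f x * cnj (g'' j x)) = 0" for j
  proof (rule torus_integral_partial_eq_0)
    have per': "torus_periodic (f' j)" "torus_periodic (g' j)"
      using torus_periodic_partial per der by blast+
    show "torus_periodic (\<lambda>x. f' j x * cnj (g x) - f x * cnj (g' j x))"
      using per per' by (simp add: torus_periodic_def)
    have "has_partial j (\<lambda>x. f' j x * cnj (g x) - f x * cnj (g' j x))
      (\<lambda>x. (f' j x * cnj (g' j x) + f'' j x * cnj (g x)) - (f x * cnj (g'' j x) + f' j x * cnj (g' j x)))"
      by (intro has_partial_diff has_partial_mult has_partial_cnj der)
    then show "has_partial j (\<lambda>x. f' j x * cnj (g x) - f x * cnj (g' j x))
      (\<lambda>x. f'' j x * cnj (g x) - f x * cnj (g'' j x))"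
      by (simp add: algebra_simps)
  qed (intro continuous_intros cont)+
  then have "(\<Sum>j\<in>UNIV. torus_integral (\<lambda>x. f'' j x * cnj (g x) - f x * cnj (g'' j x))) = 0"
    by simp
  also have "(\<Sum>j\<in>UNIV. torus_integral (\<lambda>x. f'' j x * cnj (g x) - f x * cnj (g'' j x)))
      = torus_integral (\<lambda>x. \<Sum>j\<in>UNIV. f'' j x * cnj (g x) - f x * cnj (g'' j x))"
    by (rule integral_sum[symmetric]) (auto intro!: integrable_torus_cell continuous_intros cont)
  finally show ?thesis
    by (simp add: sum_subtractf sum_distrib_left sum_distrib_right)
qed

text \<open>
  The Laplacians cancel by Green's identity, so the Hermitian pairing of two flows changes only through
  their residuals.  With both flows equal this is conservation of mass; with one of them free it
  isolates the effect of the nonlinearity.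
\<close>

lemma pairing_derivative:
  fixes u v :: "real \<Rightarrow> real ^ 'd \<Rightarrow> complex"
  assumes "C2_flow T u ut ux uxx utx" "C2_flow T v vt vx vxx vtx" and t: "t \<in> {0..T}"
  shows "((\<lambda>t. torus_integral (\<lambda>x. u t x * cnj (v t x))) has_vector_derivative
    torus_integral (\<lambda>x. C2_flow.residual ut uxx t x * cnj (v t x)
      + u t x * cnj (C2_flow.residual vt vxx t x))) (at t within {0..T})"
proof -
  interpret u: C2_flow T u ut ux uxx utx by fact
  interpret v: C2_flow T v vt vx vxx vtx by fact
  have green: "torus_integral (\<lambda>x. u.lap t x * cnj (v t x) - u t x * cnj (v.lap t x)) = 0"
    unfolding u.lap_def v.lap_def
    by (rule green_identity) (rule u.per v.per u.cont_slices v.cont_slices u.der_x v.der_x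
        u.der_xx v.der_xx t)+
  have "((\<lambda>t. torus_integral (\<lambda>x. u t x * cnj (v t x))) has_vector_derivative
      torus_integral (\<lambda>x. u t x * cnj (vt t x) + ut t x * cnj (v t x))) (at t within {0..T})"
  proof (rule torus_integral_has_time_derivative[OF _ _ _ t])
    fix s x assume s: "s \<in> {0..T}"
    show "((\<lambda>t. u t x * cnj (v t x)) has_vector_derivative u s x * cnj (vt s x) + ut s x * cnj (v s x))
      (at s within {0..T})"
      by (intro has_vector_derivative_mult u.der_t s
          bounded_linear.has_vector_derivative[OF bounded_linear_cnj] v.der_t)
  qed (intro continuous_intros u.cont_u v.cont_u u.cont_ut v.cont_ut)+
  also have "torus_integral (\<lambda>x. u t x * cnj (vt t x) + ut t x * cnj (v t x))
      = torus_integral (\<lambda>x. (u.residual t x * cnj (v t x) + u t x * cnj (v.residual t x))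
          + \<i> * (u.lap t x * cnj (v t x) - u t x * cnj (v.lap t x)))"
    by (simp add: u.residual_def v.residual_def algebra_simps)
  also have "\<dots> = torus_integral (\<lambda>x. u.residual t x * cnj (v t x) + u t x * cnj (v.residual t x))
      + \<i> * torus_integral (\<lambda>x. u.lap t x * cnj (v t x) - u t x * cnj (v.lap t x))"
    unfolding u.residual_def v.residual_def
    by (subst integral_add)
      (auto intro!: integrable_torus_cell continuous_intros u.cont_slices v.cont_slices t)
  finally show ?thesis by (simp add: green)
qed

lemma torus_integral_Re:
  fixes f :: "real ^ 'd \<Rightarrow> complex"
  assumes "continuous_on UNIV f"
  shows "torus_integral (\<lambda>x. Re (f x)) = Re (torus_integral f)"
  using integral_linear[OF integrable_torus_cell[OF assms] bounded_linear_Re] by (simp add: o_def)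

lemma torus_integral_Im:
  fixes f :: "real ^ 'd \<Rightarrow> complex"
  assumes "continuous_on UNIV f"
  shows "torus_integral (\<lambda>x. Im (f x)) = Im (torus_integral f)"
  using integral_linear[OF integrable_torus_cell[OF assms] bounded_linear_Im] by (simp add: o_def)

lemma torus_integral_of_real:
  fixes f :: "real ^ 'd \<Rightarrow> real"
  assumes "continuous_on UNIV f"
  shows "torus_integral (\<lambda>x. complex_of_real (f x)) = of_real (torus_integral f)"
  using integral_linear[OF integrable_torus_cell[OF assms] bounded_linear_of_real] by (simp add: o_def)

lemma constant_on_interval:
  fixes f :: "real \<Rightarrow> 'b::real_normed_vector"
  assumes "\<And>t. t \<in> {0..T} \<Longrightarrow> (f has_vector_derivative 0) (at t within {0..T})" "t \<in> {0..T}"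
  shows "f t = f 0"
proof -
  have "\<exists>c. \<forall>t\<in>{0..T}. f t = c"
    by (rule has_derivative_zero_constant) (use assms(1) in \<open>auto simp: has_vector_derivative_def\<close>)
  then show ?thesis using assms(2) by fastforce
qed

context C2_flow
begin

text \<open>
  Differentiation in time would call for $\partial_t \partial_j u = \partial_j \partial_t u$.  It is
  enough to know this against the test function $\overline{\partial_j u(t)}$ frozen at the time $t$ of
  differentiation: integrate by parts in $x$ before differentiating in time.
\<close>

lemma gradient_derivative:
  assumes t: "t \<in> {0..T}"
  shows "((\<lambda>t. torus_integral (\<lambda>x. (norm (ux j t x))\<^sup>2)) has_vector_derivative
    - 2 * Re (torus_integral (\<lambda>x. ut t x * cnj (uxx j t x)))) (at t within {0..T})"
proof -
  define g where "g x = cnj (ux j t x)" for x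
  define g' where "g' x = cnj (uxx j t x)" for x
  have g: "torus_periodic g" "continuous_on UNIV g" "continuous_on UNIV g'" "has_partial j g g'"
    unfolding g_def[abs_def] g'_def[abs_def]
    using per_ux[OF t, of j] der_xx[OF t, of j]
    by (auto intro!: continuous_intros cont_slices t has_partial_cnj simp: torus_periodic_def)
  have cg: "continuous_on A (\<lambda>p. g (snd p))" "continuous_on A (\<lambda>p. g' (snd p))"
    for A :: "(real \<times> (real ^ 'd)) set"
    by (rule continuous_on_compose2[OF g(2)] continuous_on_compose2[OF g(3)];
        auto intro!: continuous_intros)+
  have parts: "torus_integral (\<lambda>x. ux j s x * g x) = - torus_integral (\<lambda>x. u s x * g' x)"
    if s: "s \<in> {0..T}" for s
  proof -
    have "0 = torus_integral (\<lambda>x. u s x * g' x + ux j s x * g x)"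
    proof (rule torus_integral_partial_eq_0[symmetric])
      show "torus_periodic (\<lambda>x. u s x * g x)" using per[OF s] g(1) by (simp add: torus_periodic_def)
      show "has_partial j (\<lambda>x. u s x * g x) (\<lambda>x. u s x * g' x + ux j s x * g x)"
        by (intro has_partial_mult der_x s g)
    qed (intro continuous_intros cont_slices s g)+
    also have "\<dots> = torus_integral (\<lambda>x. u s x * g' x) + torus_integral (\<lambda>x. ux j s x * g x)"
      by (intro integral_add integrable_torus_cell continuous_intros cont_slices s g)
    finally show ?thesis by (simp add: eq_neg_iff_add_eq_0 add.commute)
  qed
  have d1: "((\<lambda>s. torus_integral (\<lambda>x. ux j s x * g x)) has_vector_derivative
      torus_integral (\<lambda>x. utx j t x * g x)) (at t within {0..T})"
    by (rule torus_integral_has_time_derivative[OF _ _ _ t])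
      (auto intro!: continuous_intros cont_ux cont_utx cg has_vector_derivative_mult_left der_tx)
  have "((\<lambda>s. torus_integral (\<lambda>x. u s x * g' x)) has_vector_derivative
      torus_integral (\<lambda>x. ut t x * g' x)) (at t within {0..T})"
    by (rule torus_integral_has_time_derivative[OF _ _ _ t])
      (auto intro!: continuous_intros cont_u cont_ut cg has_vector_derivative_mult_left der_t)
  then have "((\<lambda>s. - torus_integral (\<lambda>x. u s x * g' x)) has_vector_derivative
      - torus_integral (\<lambda>x. ut t x * g' x)) (at t within {0..T})"
    by (rule has_vector_derivative_minus)
  then have d2: "((\<lambda>s. torus_integral (\<lambda>x. ux j s x * g x)) has_vector_derivative
      - torus_integral (\<lambda>x. ut t x * g' x)) (at t within {0..T})"
    by (rule has_vector_derivative_transform[OF t parts, rotated])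
  have swap: "torus_integral (\<lambda>x. utx j t x * g x) = - torus_integral (\<lambda>x. ut t x * g' x)"
    using vector_derivative_within_closed_interval[OF _ _ d1]
      vector_derivative_within_closed_interval[OF _ _ d2] T t by simp
  have "((\<lambda>t. torus_integral (\<lambda>x. ux j t x \<bullet> ux j t x)) has_vector_derivative
      torus_integral (\<lambda>x. ux j t x \<bullet> utx j t x + utx j t x \<bullet> ux j t x)) (at t within {0..T})"
    by (rule torus_integral_has_time_derivative[OF _ _ _ t])
      (auto intro!: continuous_intros cont_ux cont_utx der_tx
        bounded_bilinear.has_vector_derivative[OF bounded_bilinear_inner])
  also have "torus_integral (\<lambda>x. ux j t x \<bullet> utx j t x + utx j t x \<bullet> ux j t x)
      = torus_integral (\<lambda>x. 2 * Re (utx j t x * g x))"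
    by (simp add: g_def inner_complex_def algebra_simps)
  also have "\<dots> = 2 * Re (torus_integral (\<lambda>x. utx j t x * g x))"
    by (subst torus_integral_Re[symmetric])
      (auto simp del: times_complex.sel intro!: continuous_intros cont_slices t g)
  finally show ?thesis
    by (simp add: swap g'_def power2_norm_eq_inner)
qed

end

text \<open>
  An even exponent makes $|u|^e$ a polynomial in $u$ and $\bar u$, differentiable everywhere; the critical
  exponents $e = 4/d$ for $d = 1, 2$ are of this kind.
\<close>

locale nls_flow = C2_flow T u ut ux uxx utx
  for T :: real and u ut :: "real \<Rightarrow> real ^ 'd \<Rightarrow> complex"
    and ux uxx utx :: "'d \<Rightarrow> real \<Rightarrow> real ^ 'd \<Rightarrow> complex" +
  fixes \<mu> :: real and e :: nat
  assumes e: "even e"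
    and nls: "\<And>t x. t \<in> {0..T} \<Longrightarrow>
      \<i> * ut t x + lap t x = of_real \<mu> * of_real (norm (u t x) ^ e) * u t x"
begin

lemma residual_eq: "t \<in> {0..T} \<Longrightarrow> residual t x = - \<i> * of_real \<mu> * of_real (norm (u t x) ^ e) * u t x"
proof -
  assume "t \<in> {0..T}"
  then have "- \<i> * (\<i> * ut t x + lap t x) = - \<i> * (of_real \<mu> * of_real (norm (u t x) ^ e) * u t x)"
    by (simp only: nls)
  then show ?thesis by (simp add: residual_def algebra_simps)
qed

lemma mass_conserved:
  assumes t: "t \<in> {0..T}"
  shows "torus_integral (\<lambda>x. (norm (u t x))\<^sup>2) = torus_integral (\<lambda>x. (norm (u 0 x))\<^sup>2)"
proof -
  have eq: "torus_integral (\<lambda>x. u s x * cnj (u s x)) = of_real (torus_integral (\<lambda>x. (norm (u s x))\<^sup>2))"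
    if "s \<in> {0..T}" for s
    unfolding complex_norm_square[symmetric]
    by (rule torus_integral_of_real) (intro continuous_intros cont_slices that)
  have "torus_integral (\<lambda>x. u t x * cnj (u t x)) = torus_integral (\<lambda>x. u 0 x * cnj (u 0 x))"
  proof (rule constant_on_interval[OF _ t])
    fix s assume s: "s \<in> {0..T}"
    have "residual s x * cnj (u s x) + u s x * cnj (residual s x) = 0" for x
      by (simp add: residual_eq[OF s])
    then show "((\<lambda>t. torus_integral (\<lambda>x. u t x * cnj (u t x))) has_vector_derivative 0) (at s within {0..T})"
      using pairing_derivative[OF C2_flow_axioms C2_flow_axioms s] by simp
  qed
  then show ?thesis using T t by (simp add: eq)
qed

definition energy :: "real \<Rightarrow> real" where
  "energy t = (\<Sum>j\<in>UNIV. torus_integral (\<lambda>x. (norm (ux j t x))\<^sup>2))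
    + 2 * \<mu> / real (e + 2) * torus_integral (\<lambda>x. norm (u t x) ^ (e + 2))"

lemma potential_derivative:
  assumes t: "t \<in> {0..T}"
  shows "((\<lambda>t. torus_integral (\<lambda>x. norm (u t x) ^ (e + 2))) has_vector_derivative
    real (e + 2) * torus_integral (\<lambda>x. norm (u t x) ^ e * (ut t x \<bullet> u t x))) (at t within {0..T})"
proof -
  obtain q where q: "e = 2 * q" using e by (elim evenE)
  have pow: "norm z ^ (e + 2) = (z \<bullet> z) ^ (q + 1)" "norm z ^ e = (z \<bullet> z) ^ q" for z :: complex
  proof -
    have "e + 2 = 2 * (q + 1)" by (simp add: q)
    then show "norm z ^ (e + 2) = (z \<bullet> z) ^ (q + 1)" "norm z ^ e = (z \<bullet> z) ^ q"
      by (simp_all only: q power_mult power2_norm_eq_inner)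
  qed
  have "((\<lambda>t. torus_integral (\<lambda>x. norm (u t x) ^ (e + 2))) has_vector_derivative
    torus_integral (\<lambda>x. real (e + 2) * (norm (u t x) ^ e * (ut t x \<bullet> u t x)))) (at t within {0..T})"
  proof (rule torus_integral_has_time_derivative[OF _ _ _ t])
    fix s x assume s: "s \<in> {0..T}"
    have "((\<lambda>t. u t x \<bullet> u t x) has_vector_derivative u s x \<bullet> ut s x + ut s x \<bullet> u s x) (at s within {0..T})"
      by (intro bounded_bilinear.has_vector_derivative[OF bounded_bilinear_inner] der_t s)
    then have "((\<lambda>t. u t x \<bullet> u t x) has_real_derivative 2 * (ut s x \<bullet> u s x)) (at s within {0..T})"
      by (simp add: has_real_derivative_iff_has_vector_derivative inner_commute)
    from DERIV_power[OF this, of "q + 1"]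
    show "((\<lambda>t. norm (u t x) ^ (e + 2)) has_vector_derivative
        real (e + 2) * (norm (u s x) ^ e * (ut s x \<bullet> u s x))) (at s within {0..T})"
      unfolding pow has_real_derivative_iff_has_vector_derivative[symmetric]
      by (simp add: q algebra_simps)
  qed (intro continuous_intros cont_u cont_ut)+
  then show ?thesis by simp
qed

text \<open>
  The derivative is $2\,\mathrm{Re} \int \overline{\partial_t u} (-\Delta u + \mu |u|^e u)
  = 2\,\mathrm{Re} \int i |\partial_t u|^2 = 0$.
\<close>

lemma energy_conserved:
  assumes t: "t \<in> {0..T}"
  shows "energy t = energy 0"
proof (rule constant_on_interval[OF _ t])
  fix s assume s: "s \<in> {0..T}"
  have sum: "(\<Sum>j\<in>UNIV. - 2 * Re (torus_integral (\<lambda>x. ut s x * cnj (uxx j s x))))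
      = - 2 * torus_integral (\<lambda>x. Re (ut s x * cnj (lap s x)))"
  proof -
    have "torus_integral (\<lambda>x. Re (ut s x * cnj (lap s x))) = Re (torus_integral (\<lambda>x. ut s x * cnj (lap s x)))"
      by (intro torus_integral_Re continuous_intros cont_slices s)
    also have "torus_integral (\<lambda>x. ut s x * cnj (lap s x))
        = torus_integral (\<lambda>x. \<Sum>j\<in>UNIV. ut s x * cnj (uxx j s x))"
      by (simp add: lap_def sum_distrib_left)
    also have "\<dots> = (\<Sum>j\<in>UNIV. torus_integral (\<lambda>x. ut s x * cnj (uxx j s x)))"
      by (rule integral_sum) (auto intro!: integrable_torus_cell continuous_intros cont_slices s)
    finally show ?thesis by (simp add: sum_distrib_left)
  qed
  have "(energy has_vector_derivative
      (\<Sum>j\<in>UNIV. - 2 * Re (torus_integral (\<lambda>x. ut s x * cnj (uxx j s x))))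
      + 2 * \<mu> / real (e + 2) * (real (e + 2) * torus_integral (\<lambda>x. norm (u s x) ^ e * (ut s x \<bullet> u s x))))
      (at s within {0..T})"
    unfolding energy_def[abs_def]
    by (intro has_vector_derivative_add has_vector_derivative_sum gradient_derivative s
        has_vector_derivative_mult_right potential_derivative)
  also have "(\<Sum>j\<in>UNIV. - 2 * Re (torus_integral (\<lambda>x. ut s x * cnj (uxx j s x))))
      + 2 * \<mu> / real (e + 2) * (real (e + 2) * torus_integral (\<lambda>x. norm (u s x) ^ e * (ut s x \<bullet> u s x)))
     = torus_integral (\<lambda>x. - 2 * Re (ut s x * cnj (lap s x)) + 2 * \<mu> * (norm (u s x) ^ e * (ut s x \<bullet> u s x)))"
    unfolding sum
    by (subst integral_add) (auto simp del: times_complex.sel intro!: integrable_torus_cell continuous_intros cont_slices s)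
  also have "\<dots> = torus_integral (\<lambda>x::real^'d. 0)"
  proof (rule arg_cong[where f = torus_integral], rule ext)
    fix x
    define c where "c = \<mu> * norm (u s x) ^ e"
    have "lap s x = of_real c * u s x - \<i> * ut s x"
      using nls[OF s, of x] by (simp add: c_def algebra_simps)
    then have Re_Im_lap: "Re (lap s x) = c * Re (u s x) + Im (ut s x)" "Im (lap s x) = c * Im (u s x) - Re (ut s x)"
      by simp_all
    show "- 2 * Re (ut s x * cnj (lap s x)) + 2 * \<mu> * (norm (u s x) ^ e * (ut s x \<bullet> u s x)) = 0"
      by (simp add: Re_Im_lap inner_complex_def c_def algebra_simps)
  qed
  finally show "(energy has_vector_derivative 0) (at s within {0..T})" by simp
qed

end

section \<open>Small data\<close>

text \<open>
  The factor \<open>M\<close> on the left avoids the exponent $n - 1$ on the right and keeps the induction uniform.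
\<close>

lemma power_diff_le:
  fixes x y M :: real
  assumes "0 \<le> x" "x \<le> M" "0 \<le> y" "y \<le> M"
  shows "\<bar>x ^ n - y ^ n\<bar> * M \<le> real n * \<bar>x - y\<bar> * M ^ n"
proof (induction n)
  case (Suc n)
  have "x ^ Suc n - y ^ Suc n = x * (x ^ n - y ^ n) + (x - y) * y ^ n"
    by (simp add: algebra_simps)
  then have "\<bar>x ^ Suc n - y ^ Suc n\<bar> \<le> \<bar>x * (x ^ n - y ^ n)\<bar> + \<bar>(x - y) * y ^ n\<bar>"
    by (simp only: abs_triangle_ineq)
  also have "\<dots> = x * \<bar>x ^ n - y ^ n\<bar> + \<bar>x - y\<bar> * y ^ n"
    using assms by (simp add: abs_mult)
  finally have "\<bar>x ^ Suc n - y ^ Suc n\<bar> * M \<le> (x * \<bar>x ^ n - y ^ n\<bar> + \<bar>x - y\<bar> * y ^ n) * M"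
    using assms by (intro mult_right_mono) auto
  also have "\<dots> = x * (\<bar>x ^ n - y ^ n\<bar> * M) + \<bar>x - y\<bar> * y ^ n * M"
    by (simp add: algebra_simps)
  also have "\<dots> \<le> M * (real n * \<bar>x - y\<bar> * M ^ n) + \<bar>x - y\<bar> * M ^ n * M"
  proof (rule add_mono)
    show "x * (\<bar>x ^ n - y ^ n\<bar> * M) \<le> M * (real n * \<bar>x - y\<bar> * M ^ n)"
      using assms by (intro mult_mono[OF _ Suc]) auto
    show "\<bar>x - y\<bar> * y ^ n * M \<le> \<bar>x - y\<bar> * M ^ n * M"
      using assms by (intro mult_mono power_mono) auto
  qed
  also have "\<dots> = real (Suc n) * \<bar>x - y\<bar> * M ^ Suc n" by (simp add: algebra_simps)
  finally show ?case .
qed simp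

text \<open>
  Split $|a|^e a - |b|^e b = |a|^e (a - b) + (|a|^e - |b|^e) b$.
\<close>

lemma nonlinearity_lipschitz:
  fixes a b :: complex
  shows "norm (of_real (norm a ^ e) * a - of_real (norm b ^ e) * b)
    \<le> real (e + 1) * (norm (a - b) * (norm a ^ e + norm b ^ e))"
proof -
  define M where "M = max (norm a) (norm b)"
  have M: "M ^ e \<le> norm a ^ e + norm b ^ e" by (auto simp: M_def max_def)
  have "of_real (norm a ^ e) * a - of_real (norm b ^ e) * b
      = of_real (norm a ^ e) * (a - b) + of_real (norm a ^ e - norm b ^ e) * b"
    by (simp add: algebra_simps)
  also have "norm \<dots> \<le> norm (of_real (norm a ^ e) * (a - b)) + norm (of_real (norm a ^ e - norm b ^ e) * b)"
    by (rule norm_triangle_ineq)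
  also have "\<dots> = norm a ^ e * norm (a - b) + \<bar>norm a ^ e - norm b ^ e\<bar> * norm b"
    unfolding norm_mult norm_of_real by simp
  also have "\<dots> \<le> (norm a ^ e + norm b ^ e) * norm (a - b)
      + real e * norm (a - b) * (norm a ^ e + norm b ^ e)"
  proof (intro add_mono mult_right_mono)
    have "\<bar>norm a ^ e - norm b ^ e\<bar> * norm b \<le> \<bar>norm a ^ e - norm b ^ e\<bar> * M"
      by (intro mult_left_mono) (auto simp: M_def)
    also have "\<dots> \<le> real e * \<bar>norm a - norm b\<bar> * M ^ e"
      by (rule power_diff_le) (auto simp: M_def)
    also have "\<dots> \<le> real e * norm (a - b) * (norm a ^ e + norm b ^ e)"
      using norm_triangle_ineq3[of a b] M
      by (intro mult_mono) (auto simp: M_def le_max_iff_disj intro!: zero_le_power)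
    finally show "\<bar>norm a ^ e - norm b ^ e\<bar> * norm b
        \<le> real e * norm (a - b) * (norm a ^ e + norm b ^ e)" .
  qed auto
  also have "\<dots> = real (e + 1) * (norm (a - b) * (norm a ^ e + norm b ^ e))"
    by (simp add: algebra_simps)
  finally show ?thesis .
qed

context C2_flow
begin

definition mass where "mass t = torus_integral (\<lambda>x. (norm (u t x))\<^sup>2)"
definition kinetic where "kinetic t = (\<Sum>j\<in>UNIV. torus_integral (\<lambda>x. (norm (ux j t x))\<^sup>2))"
definition power_integral where "power_integral p t = torus_integral (\<lambda>x. norm (u t x) ^ p)"

lemma nonneg:
  assumes "t \<in> {0..T}"
  shows "0 \<le> mass t" "0 \<le> kinetic t" "0 \<le> power_integral p t"
  unfolding mass_def kinetic_def power_integral_def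
  by (intro torus_integral_nonneg sum_nonneg continuous_intros cont_slices assms; simp)+

lemma flow_gagliardo_nirenberg:
  assumes "CARD('d) \<in> {1, 2}" "t \<in> {0..T}" "e = 4 div CARD('d)"
  shows "power_integral (e + 2) t \<le> 8 * mass t ^ (e div 2) * (mass t + kinetic t)"
    and "power_integral (2 * e) t \<le> 112 * (mass t + kinetic t) ^ e"
  unfolding power_integral_def mass_def kinetic_def assms(3)
  by (rule gagliardo_nirenberg; (intro assms(1,2) per cont_slices der_x))+

lemma continuous_power_integral: "continuous_on {0..T} (power_integral p)"
proof -
  have "continuous_on ({0..T} \<times> cbox 0 (\<chi> i. 2 * pi)) (\<lambda>q. norm (u (fst q) (snd q)) ^ p)"
    by (intro continuous_intros continuous_on_subset[OF cont_u]) auto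
  then show ?thesis
    unfolding power_integral_def[abs_def] by (intro integral_continuous_on_param) (simp add: split_def)
qed

end

text \<open>
  Energy conservation bounds the kinetic energy by its initial value plus potential terms; by the
  critical Gagliardo-Nirenberg inequality the potential energy at time $t$ is at most a fraction of mass
  plus kinetic energy once the mass is small, and is absorbed.  This works for a focusing nonlinearity as
  well, where the energy has no sign.
\<close>

lemma (in nls_flow) small_data_H1_bound:
  assumes d: "CARD('d) \<in> {1, 2}" and ed: "e = 4 div CARD('d)" and mu: "\<bar>\<mu>\<bar> = 1"
    and \<delta>: "0 < \<delta>" "\<delta> \<le> 1" and small: "16 * \<delta> * m ^ (e div 2) \<le> 1"
    and init: "mass 0 = \<delta>\<^sup>2 * m" "kinetic 0 = \<delta>\<^sup>2 * k" "power_integral (e + 2) 0 = \<delta> ^ (e + 2) * p"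
    and pos: "0 \<le> m" "0 \<le> k" "0 \<le> p"
    and t: "t \<in> {0..T}"
  shows "mass t = \<delta>\<^sup>2 * m" and "mass t + kinetic t \<le> (2 * m + 2 * k + 2 * p) * \<delta>\<^sup>2"
proof -
  have e2: "2 \<le> e" using d ed by auto
  show mass: "mass t = \<delta>\<^sup>2 * m" using mass_conserved[OF t] init(1) by (simp add: mass_def)
  have 0: "0 \<in> {0..T}" using T by simp
  have en: "energy s = kinetic s + 2 * \<mu> / real (e + 2) * power_integral (e + 2) s" for s
    by (simp add: energy_def kinetic_def power_integral_def)
  have pot: "\<bar>2 * \<mu> / real (e + 2) * power_integral (e + 2) s\<bar> \<le> power_integral (e + 2) s / 2" if s: "s \<in> {0..T}" for s
  proof -
    have "\<bar>2 * \<mu> / real (e + 2) * power_integral (e + 2) s\<bar> = 2 / real (e + 2) * power_integral (e + 2) s"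
      using mu nonneg(3)[OF s] by (simp add: abs_mult)
    also have "\<dots> \<le> 1 / 2 * power_integral (e + 2) s"
      using nonneg(3)[OF s] e2 by (intro mult_right_mono) (auto simp: field_simps)
    finally show ?thesis by simp
  qed
  have "kinetic t \<le> kinetic 0 + power_integral (e + 2) 0 / 2 + power_integral (e + 2) t / 2"
    using energy_conserved[OF t] pot[OF 0] pot[OF t] unfolding en by linarith
  moreover have "power_integral (e + 2) 0 \<le> \<delta>\<^sup>2 * p"
    unfolding init using \<delta> pos by (intro mult_right_mono power_decreasing) auto
  moreover have "power_integral (e + 2) t \<le> 1 / 2 * (mass t + kinetic t)"
  proof -
    have "mass t ^ (e div 2) = \<delta> ^ e * m ^ (e div 2)"
      using e by (simp add: mass power_mult_distrib flip: power_mult)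
    also have "\<dots> \<le> \<delta> ^ 1 * m ^ (e div 2)"
      using \<delta> pos e2 by (intro mult_right_mono power_decreasing) auto
    finally have "8 * mass t ^ (e div 2) \<le> 1 / 2" using small by simp
    then have "8 * mass t ^ (e div 2) * (mass t + kinetic t) \<le> 1 / 2 * (mass t + kinetic t)"
      using nonneg[OF t] by (intro mult_right_mono) auto
    then show ?thesis using flow_gagliardo_nirenberg(1)[OF d t ed] by linarith
  qed
  ultimately have "kinetic t \<le> \<delta>\<^sup>2 * k + \<delta>\<^sup>2 * p / 2 + (\<delta>\<^sup>2 * m + kinetic t) / 4"
    unfolding mass init by linarith
  moreover have "0 \<le> \<delta>\<^sup>2 * k" "0 \<le> \<delta>\<^sup>2 * p" "0 \<le> \<delta>\<^sup>2 * m" using pos by auto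
  moreover have "a + K \<le> 2 * a + 2 * b + 2 * c"
    if "K \<le> b + c / 2 + (a + K) / 4" "0 \<le> b" "0 \<le> c" "0 \<le> a" for a b c K :: real
    using that by argo
  ultimately have "mass t + kinetic t \<le> 2 * (\<delta>\<^sup>2 * m) + 2 * (\<delta>\<^sup>2 * k) + 2 * (\<delta>\<^sup>2 * p)"
    unfolding mass by blast
  then show "mass t + kinetic t \<le> (2 * m + 2 * k + 2 * p) * \<delta>\<^sup>2"
    by (simp add: algebra_simps)
qed

locale free_flow = C2_flow T v vt vx vxx vtx
  for T :: real and v vt :: "real \<Rightarrow> real ^ 'd \<Rightarrow> complex"
    and vx vxx vtx :: "'d \<Rightarrow> real \<Rightarrow> real ^ 'd \<Rightarrow> complex" +
  fixes B :: real
  assumes free: "\<And>t x. t \<in> {0..T} \<Longrightarrow> residual t x = 0"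
    and bounded: "\<And>t x. t \<in> {0..T} \<Longrightarrow> norm (v t x) \<le> B"
begin

lemma B_nonneg: "0 \<le> B"
  using bounded[of 0 0] T norm_ge_zero[of "v 0 0"] by (simp del: norm_ge_zero)

text \<open>
  Both residuals in \<open>pairing_derivative\<close> vanish.
\<close>

lemma free_mass_conserved:
  assumes "t \<in> {0..T}" shows "mass t = mass 0"
proof -
  have eq: "torus_integral (\<lambda>x. v s x * cnj (v s x)) = of_real (mass s)" if "s \<in> {0..T}" for s
    unfolding complex_norm_square[symmetric] mass_def
    by (rule torus_integral_of_real) (intro continuous_intros cont_slices that)
  have "torus_integral (\<lambda>x. v t x * cnj (v t x)) = torus_integral (\<lambda>x. v 0 x * cnj (v 0 x))"
  proof (rule constant_on_interval[OF _ assms])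
    fix s assume s: "s \<in> {0..T}"
    show "((\<lambda>t. torus_integral (\<lambda>x. v t x * cnj (v t x))) has_vector_derivative 0) (at s within {0..T})"
      using pairing_derivative[OF C2_flow_axioms C2_flow_axioms s] by (simp add: free[OF s])
  qed
  then show ?thesis using T assms by (simp add: eq)
qed

end

text \<open>
  The first nontrivial Picard iterate, tested against the free flow, with an error one power of $\delta$
  smaller.  In the proof \<open>P t\<close> is the pairing of the solution with the free flow and \<open>D t\<close> its
  time derivative.  A first crude bound on \<open>D\<close> shows that $u$ is close to $\delta v$ in $L^2$, and
  this closeness is then used to compute \<open>D\<close> to leading order.
\<close>

lemma small_data_expansion:
  fixes v vt :: "real \<Rightarrow> real ^ 'd \<Rightarrow> complex"
  assumes d: "CARD('d) \<in> {1, 2}" and ed: "e = 4 div CARD('d)" and mu: "\<bar>\<mu>\<bar> = 1"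
    and v: "free_flow T v vt vx vxx vtx B"
  obtains C \<delta>\<^sub>0 where "0 < \<delta>\<^sub>0"
    and "\<And>\<delta> u ut ux uxx utx. 0 < \<delta> \<Longrightarrow> \<delta> < \<delta>\<^sub>0 \<Longrightarrow> nls_flow T u ut ux uxx utx \<mu> e \<Longrightarrow>
        (\<And>x. u 0 x = of_real \<delta> * v 0 x) \<Longrightarrow>
      \<bar>Im (torus_integral (\<lambda>x. u T x * cnj (v T x)))
        + \<mu> * \<delta> ^ (e + 1) * integral {0..T} (\<lambda>t. torus_integral (\<lambda>x. norm (v t x) ^ (e + 2)))\<bar>
      \<le> C * \<delta> ^ (e + 2)"
proof -
  interpret v: free_flow T v vt vx vxx vtx B by fact
  have T: "0 < T" by (rule v.T)
  then have 0: "0 \<in> {0..T}" by simp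
  have e2: "2 \<le> e" using d ed by auto
  have B: "0 \<le> B" by (rule v.B_nonneg)
  define m k p where "m = v.mass 0" and "k = v.kinetic 0" and "p = v.power_integral (e + 2) 0"
  have pos: "0 \<le> m" "0 \<le> k" "0 \<le> p" unfolding m_def k_def p_def by (rule v.nonneg[OF 0])+
  define A where "A = 2 * m + 2 * k + 2 * p"
  have A: "0 \<le> A" using pos by (simp add: A_def)
  define R where "R = sqrt (112 * A ^ e)"
  define Q where "Q = sqrt ((2 * pi) ^ CARD('d) * B ^ (2 * e))"
  define C1 where "C1 = B * (R * sqrt m)"
  define C2 where "C2 = B * (real (e + 1) * (sqrt (2 * (T * C1)) * (R + Q)))"
  have R: "0 \<le> R" and Q: "0 \<le> Q" using A B by (auto simp: R_def Q_def)
  have C1: "0 \<le> C1" and C2: "0 \<le> C2" using B R Q pos T by (auto simp: C1_def C2_def)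
  \<comment> \<open>The smallness of the mass that absorbs the potential energy; the summand 1 prevents division by zero.\<close>
  define \<delta>\<^sub>0 where "\<delta>\<^sub>0 = min 1 (1 / (16 * m ^ (e div 2) + 1))"
  have pm: "0 \<le> 16 * m ^ (e div 2)" using pos by simp
  then have \<delta>\<^sub>0: "0 < \<delta>\<^sub>0" by (simp add: \<delta>\<^sub>0_def)
  show thesis
  proof (rule that[OF \<delta>\<^sub>0])
    fix \<delta> u ut ux uxx utx
    assume \<delta>: "0 < \<delta>" "\<delta> < \<delta>\<^sub>0" and u: "nls_flow T u ut ux uxx utx \<mu> e"
      and init: "\<And>x. u 0 x = of_real \<delta> * v 0 x"
    interpret u: nls_flow T u ut ux uxx utx \<mu> e by fact
    have \<delta>1: "\<delta> \<le> 1" using \<delta> by (simp add: \<delta>\<^sub>0_def)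
    have "\<delta> \<le> 1 / (16 * m ^ (e div 2) + 1)" using \<delta> by (simp add: \<delta>\<^sub>0_def)
    then have "\<delta> * (16 * m ^ (e div 2) + 1) \<le> 1" using pm by (simp add: field_simps)
    then have small: "16 * \<delta> * m ^ (e div 2) \<le> 1" using \<delta> by (simp add: algebra_simps)
    have ux0: "ux j 0 = (\<lambda>x. of_real \<delta> * vx j 0 x)" for j
    proof (rule has_partial_unique[OF u.der_x[OF 0]])
      have "has_partial j (\<lambda>x. of_real \<delta> * v 0 x) (\<lambda>x. of_real \<delta> * vx j 0 x)"
        using v.der_x[OF 0, of j] by (auto simp: has_partial_def intro: has_vector_derivative_mult_right)
      then show "has_partial j (u 0) (\<lambda>x. of_real \<delta> * vx j 0 x)" by (simp add: init[abs_def])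
    qed
    have "u.power_integral n 0 = \<delta> ^ n * v.power_integral n 0" for n
      using \<delta> by (simp add: u.power_integral_def v.power_integral_def init norm_mult power_mult_distrib)
    then have init': "u.mass 0 = \<delta>\<^sup>2 * m" "u.kinetic 0 = \<delta>\<^sup>2 * k" "u.power_integral (e + 2) 0 = \<delta> ^ (e + 2) * p"
      using \<delta> by (simp_all only: p_def) (simp_all add: u.mass_def v.mass_def m_def u.kinetic_def
          v.kinetic_def k_def init ux0 norm_mult power_mult_distrib sum_distrib_left)
    note H1 = u.small_data_H1_bound[OF d ed mu \<delta>(1) \<delta>1 small init' pos, folded A_def]
    have Lu: "sqrt (u.power_integral (2 * e) t) \<le> R * \<delta> ^ e" if t: "t \<in> {0..T}" for t
    proof -
      have "u.power_integral (2 * e) t \<le> 112 * (u.mass t + u.kinetic t) ^ e"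
        by (rule u.flow_gagliardo_nirenberg(2)[OF d t ed])
      also have "\<dots> \<le> 112 * (A * \<delta>\<^sup>2) ^ e"
        using H1(2)[OF t] u.nonneg[OF t] by (intro mult_left_mono power_mono) auto
      finally have "sqrt (u.power_integral (2 * e) t) \<le> sqrt (112 * A ^ e * (\<delta> ^ e)\<^sup>2)"
        by (simp add: power_mult_distrib mult_ac flip: power_mult)
      also have "\<dots> = R * \<delta> ^ e" using \<delta> by (simp add: real_sqrt_mult R_def)
      finally show ?thesis .
    qed
    define P where "P t = torus_integral (\<lambda>x. u t x * cnj (v t x))" for t
    define D where "D t = torus_integral (\<lambda>x. u.residual t x * cnj (v t x))" for t
    have P_der: "(P has_vector_derivative D t) (at t within {0..T})" if t: "t \<in> {0..T}" for t
      using pairing_derivative[OF u.C2_flow_axioms v.C2_flow_axioms t] v.free[OF t]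
      by (simp add: P_def[abs_def] D_def)
    have P0: "P 0 = of_real (\<delta> * m)"
    proof -
      have "P 0 = torus_integral (\<lambda>x. of_real (\<delta> * (norm (v 0 x))\<^sup>2))"
        unfolding P_def init by (simp add: complex_norm_square mult.assoc del: of_real_power)
      also have "\<dots> = of_real (\<delta> * m)"
        by (subst torus_integral_of_real)
          (auto intro!: continuous_intros v.cont_slices 0 simp: m_def v.mass_def)
      finally show ?thesis .
    qed
    have P_int: "(D has_integral (P t - P 0)) {0..t}" if t: "t \<in> {0..T}" for t
      using t by (intro fundamental_theorem_of_calculus has_vector_derivative_within_subset[OF P_der]) auto
    have D_bound: "norm (D t) \<le> C1 * \<delta> ^ (e + 1)" if t: "t \<in> {0..T}" for t
    proof -
      have "norm (D t) \<le> torus_integral (\<lambda>x. B * (norm (u t x) ^ e * norm (u t x)))"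
        unfolding D_def
      proof (rule norm_torus_integral_le)
        fix x
        have "norm (u.residual t x * cnj (v t x)) = norm (u t x) ^ e * norm (u t x) * norm (v t x)"
          using mu by (simp add: u.residual_eq[OF t] norm_mult norm_power)
        also have "\<dots> \<le> norm (u t x) ^ e * norm (u t x) * B"
          by (intro mult_left_mono v.bounded t) auto
        finally show "norm (u.residual t x * cnj (v t x)) \<le> B * (norm (u t x) ^ e * norm (u t x))"
          by (simp add: mult_ac)
      qed (auto simp: u.residual_def intro!: continuous_intros u.cont_slices v.cont_slices t)
      also have "\<dots> = B * torus_integral (\<lambda>x. norm (u t x) ^ e * norm (u t x))" by simp
      also have "\<dots> \<le> B * ((R * \<delta> ^ e) * (\<delta> * sqrt m))"
      proof (rule mult_left_mono[OF _ B])
        have "torus_integral (\<lambda>x. norm (u t x) ^ e * norm (u t x))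
            \<le> sqrt (torus_integral (\<lambda>x. (norm (u t x) ^ e)\<^sup>2)) * sqrt (torus_integral (\<lambda>x. (norm (u t x))\<^sup>2))"
          by (intro torus_integral_Cauchy_Schwarz continuous_intros u.cont_slices t)
        also have "\<dots> = sqrt (u.power_integral (2 * e) t) * sqrt (u.mass t)"
          by (simp add: u.power_integral_def u.mass_def mult.commute flip: power_mult)
        also have "\<dots> \<le> (R * \<delta> ^ e) * (\<delta> * sqrt m)"
          using Lu[OF t] H1(1)[OF t] \<delta> R by (intro mult_mono) (auto simp: real_sqrt_mult pos)
        finally show "torus_integral (\<lambda>x. norm (u t x) ^ e * norm (u t x))
            \<le> (R * \<delta> ^ e) * (\<delta> * sqrt m)" .
      qed
      finally show ?thesis by (simp add: C1_def mult_ac)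
    qed
    have P_bound: "norm (P t - P 0) \<le> T * C1 * \<delta> ^ (e + 1)" if t: "t \<in> {0..T}" for t
    proof -
      have "norm (P t - P 0) \<le> C1 * \<delta> ^ (e + 1) * measure lborel {0..t}"
        using P_int[OF t] D_bound t \<delta> C1 by (intro has_integral_bound_real) auto
      also have "\<dots> \<le> C1 * \<delta> ^ (e + 1) * T"
        using t C1 \<delta> by (intro mult_left_mono) auto
      finally show ?thesis by (simp add: mult_ac)
    qed
    \<comment> \<open>Expand the square: both masses equal $\delta^2 m$, and the cross term is given by the pairing.\<close>
    have close: "sqrt (torus_integral (\<lambda>x. (norm (u t x - of_real \<delta> * v t x))\<^sup>2))
        \<le> sqrt (2 * (T * C1)) * \<delta>\<^sup>2" if t: "t \<in> {0..T}" for t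
    proof -
      have "(norm (u t x - of_real \<delta> * v t x))\<^sup>2
          = (norm (u t x))\<^sup>2 + \<delta>\<^sup>2 * (norm (v t x))\<^sup>2 - 2 * \<delta> * Re (u t x * cnj (v t x))" for x
        unfolding cmod_power2 by (simp add: power2_eq_square algebra_simps)
      then have "torus_integral (\<lambda>x. (norm (u t x - of_real \<delta> * v t x))\<^sup>2)
          = torus_integral (\<lambda>x. (norm (u t x))\<^sup>2 + \<delta>\<^sup>2 * (norm (v t x))\<^sup>2 - 2 * \<delta> * Re (u t x * cnj (v t x)))"
        by (simp only:)
      also have "\<dots> = u.mass t + \<delta>\<^sup>2 * v.mass t - 2 * \<delta> * torus_integral (\<lambda>x. Re (u t x * cnj (v t x)))"
        unfolding u.mass_def v.mass_def
        by (subst integral_diff integral_add;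
            auto intro!: integrable_torus_cell continuous_intros u.cont_slices v.cont_slices t
              simp del: times_complex.sel)+
      also have "torus_integral (\<lambda>x. Re (u t x * cnj (v t x))) = Re (P t)"
        unfolding P_def by (intro torus_integral_Re continuous_intros u.cont_slices v.cont_slices t)
      also have "u.mass t + \<delta>\<^sup>2 * v.mass t - 2 * \<delta> * Re (P t) = 2 * \<delta> * (\<delta> * m - Re (P t))"
        unfolding H1(1)[OF t] v.free_mass_conserved[OF t] m_def by (simp add: power2_eq_square algebra_simps)
      also have "\<dots> \<le> 2 * \<delta> * (T * C1 * \<delta> ^ (e + 1))"
        using P_bound[OF t] abs_Re_le_cmod[of "P t - P 0"] \<delta> unfolding P0
        by (intro mult_left_mono) auto
      also have "\<dots> = 2 * (T * C1) * \<delta> ^ (e + 2)" by (simp add: mult_ac)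
      also have "\<dots> \<le> 2 * (T * C1) * \<delta> ^ 4"
        using e2 \<delta> \<delta>1 T C1 by (intro mult_left_mono power_decreasing) auto
      also have "\<delta> ^ 4 = (\<delta>\<^sup>2)\<^sup>2" by simp
      finally have "sqrt (torus_integral (\<lambda>x. (norm (u t x - of_real \<delta> * v t x))\<^sup>2))
          \<le> sqrt (2 * (T * C1) * (\<delta>\<^sup>2)\<^sup>2)"
        by (rule real_sqrt_le_mono)
      then show ?thesis by (simp only: real_sqrt_mult real_sqrt_abs abs_power2)
    qed
    have Lv: "sqrt (v.power_integral (2 * e) t) \<le> Q" if t: "t \<in> {0..T}" for t
    proof -
      have "v.power_integral (2 * e) t \<le> torus_integral (\<lambda>x::real^'d. B ^ (2 * e))"
        unfolding v.power_integral_def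
        by (intro torus_integral_mono continuous_intros v.cont_slices t power_mono v.bounded) auto
      then show ?thesis unfolding Q_def torus_integral_const by simp
    qed
    define G where "G t = v.power_integral (e + 2) t" for t
    \<comment> \<open>The error in the nonlinearity is a factor $O(\delta^e)$ times $u - \delta v$, which is $O(\delta^2)$ in $L^2$.\<close>
    have D_close: "norm (D t + of_real (G t) * (\<i> * of_real (\<mu> * \<delta> ^ (e + 1)))) \<le> C2 * \<delta> ^ (e + 2)"
      if t: "t \<in> {0..T}" for t
    proof -
      define w where "w x = of_real \<delta> * v t x" for x
      have cw: "continuous_on UNIV w"
        unfolding w_def[abs_def] by (intro continuous_intros v.cont_slices t)
      have "of_real (G t) * (\<i> * of_real (\<mu> * \<delta> ^ (e + 1)))
          = torus_integral (\<lambda>x. of_real (norm (v t x) ^ (e + 2)) * (\<i> * of_real (\<mu> * \<delta> ^ (e + 1))))"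
        unfolding G_def v.power_integral_def
        by (subst torus_integral_of_real[symmetric])
          (auto intro!: continuous_intros v.cont_slices t simp del: of_real_power)
      then have "D t + of_real (G t) * (\<i> * of_real (\<mu> * \<delta> ^ (e + 1)))
          = torus_integral (\<lambda>x. u.residual t x * cnj (v t x)
              + of_real (norm (v t x) ^ (e + 2)) * (\<i> * of_real (\<mu> * \<delta> ^ (e + 1))))"
        unfolding D_def u.residual_def
        by (subst integral_add) (auto intro!: integrable_torus_cell continuous_intros u.cont_slices v.cont_slices t)
      also have "\<dots> = torus_integral (\<lambda>x. - \<i> * of_real \<mu> *
          (of_real (norm (u t x) ^ e) * u t x - of_real (norm (w x) ^ e) * w x) * cnj (v t x))"
      proof (rule arg_cong[where f = torus_integral], rule ext)
        fix x
        have "of_real (norm (w x) ^ e) * w x * cnj (v t x) = of_real (\<delta> ^ (e + 1) * norm (v t x) ^ (e + 2))"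
          using \<delta> by (simp add: w_def norm_mult power_mult_distrib complex_norm_square[symmetric]
              mult.assoc power_add power2_eq_square)
        then show "u.residual t x * cnj (v t x)
              + of_real (norm (v t x) ^ (e + 2)) * (\<i> * of_real (\<mu> * \<delta> ^ (e + 1)))
          = - \<i> * of_real \<mu> *
          (of_real (norm (u t x) ^ e) * u t x - of_real (norm (w x) ^ e) * w x) * cnj (v t x)"
          unfolding u.residual_eq[OF t] by (simp add: algebra_simps)
      qed
      finally have "norm (D t + of_real (G t) * (\<i> * of_real (\<mu> * \<delta> ^ (e + 1))))
          = norm (torus_integral (\<lambda>x. - \<i> * of_real \<mu> *
          (of_real (norm (u t x) ^ e) * u t x - of_real (norm (w x) ^ e) * w x) * cnj (v t x)))"
        by (rule arg_cong)
      also have "\<dots> \<le> torus_integral (\<lambda>x. B * (real (e + 1) *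
          (norm (u t x - w x) * (norm (u t x) ^ e) + norm (u t x - w x) * (norm (w x) ^ e))))"
      proof (rule norm_torus_integral_le)
        fix x
        have "norm (- \<i> * of_real \<mu> * (of_real (norm (u t x) ^ e) * u t x - of_real (norm (w x) ^ e) * w x)
            * cnj (v t x))
          = norm (v t x) * norm (of_real (norm (u t x) ^ e) * u t x - of_real (norm (w x) ^ e) * w x)"
          using mu by (simp add: norm_mult)
        also have "\<dots> \<le> B * (real (e + 1) * (norm (u t x - w x) * (norm (u t x) ^ e + norm (w x) ^ e)))"
          by (intro mult_mono nonlinearity_lipschitz v.bounded t B) auto
        finally show "norm (- \<i> * of_real \<mu> *
          (of_real (norm (u t x) ^ e) * u t x - of_real (norm (w x) ^ e) * w x) * cnj (v t x))
          \<le> B * (real (e + 1) *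
          (norm (u t x - w x) * (norm (u t x) ^ e) + norm (u t x - w x) * (norm (w x) ^ e)))"
          by (simp add: distrib_left)
      qed (auto intro!: continuous_intros u.cont_slices v.cont_slices cw t)
      also have "\<dots> = B * (real (e + 1) * (torus_integral (\<lambda>x. norm (u t x - w x) * (norm (u t x) ^ e))
          + torus_integral (\<lambda>x. norm (u t x - w x) * (norm (w x) ^ e))))"
      proof -
        have "torus_integral (\<lambda>x. norm (u t x - w x) * (norm (u t x) ^ e) + norm (u t x - w x) * (norm (w x) ^ e))
          = torus_integral (\<lambda>x. norm (u t x - w x) * (norm (u t x) ^ e))
          + torus_integral (\<lambda>x. norm (u t x - w x) * (norm (w x) ^ e))"
          by (intro integral_add integrable_torus_cell continuous_intros u.cont_slices cw t)
        then show ?thesis by simp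
      qed
      also have "\<dots> \<le> B * (real (e + 1) *
          ((sqrt (2 * (T * C1)) * \<delta>\<^sup>2) * (R * \<delta> ^ e) + (sqrt (2 * (T * C1)) * \<delta>\<^sup>2) * (Q * \<delta> ^ e)))"
      proof (intro mult_left_mono add_mono B)
        have "torus_integral (\<lambda>x. norm (u t x - w x) * (norm (u t x) ^ e))
          \<le> sqrt (torus_integral (\<lambda>x. (norm (u t x - w x))\<^sup>2)) * sqrt (torus_integral (\<lambda>x. (norm (u t x) ^ e)\<^sup>2))"
          by (intro torus_integral_Cauchy_Schwarz continuous_intros u.cont_slices cw t)
        also have "torus_integral (\<lambda>x. (norm (u t x) ^ e)\<^sup>2) = u.power_integral (2 * e) t"
          by (simp add: u.power_integral_def mult.commute flip: power_mult)
        also have "sqrt (torus_integral (\<lambda>x. (norm (u t x - w x))\<^sup>2)) * sqrt (u.power_integral (2 * e) t)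
            \<le> (sqrt (2 * (T * C1)) * \<delta>\<^sup>2) * (R * \<delta> ^ e)"
          using u.nonneg[OF t] C1 T close[OF t] unfolding w_def
          by (intro mult_mono Lu t) auto
        finally show "torus_integral (\<lambda>x. norm (u t x - w x) * (norm (u t x) ^ e))
            \<le> (sqrt (2 * (T * C1)) * \<delta>\<^sup>2) * (R * \<delta> ^ e)" .
        have "torus_integral (\<lambda>x. norm (u t x - w x) * (norm (w x) ^ e))
          \<le> sqrt (torus_integral (\<lambda>x. (norm (u t x - w x))\<^sup>2)) * sqrt (torus_integral (\<lambda>x. (norm (w x) ^ e)\<^sup>2))"
          by (intro torus_integral_Cauchy_Schwarz continuous_intros u.cont_slices cw t)
        also have "torus_integral (\<lambda>x. (norm (w x) ^ e)\<^sup>2) = (\<delta> ^ e)\<^sup>2 * v.power_integral (2 * e) t"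
          using \<delta> by (simp add: v.power_integral_def w_def norm_mult power_mult_distrib mult.commute flip: power_mult)
        also have "sqrt ((\<delta> ^ e)\<^sup>2 * v.power_integral (2 * e) t) = sqrt (v.power_integral (2 * e) t) * \<delta> ^ e"
          using \<delta> by (simp add: real_sqrt_mult)
        also have "sqrt (torus_integral (\<lambda>x. (norm (u t x - w x))\<^sup>2)) * (sqrt (v.power_integral (2 * e) t) * \<delta> ^ e)
            \<le> (sqrt (2 * (T * C1)) * \<delta>\<^sup>2) * (Q * \<delta> ^ e)"
          using v.nonneg[OF t] C1 T close[OF t] \<delta> Q unfolding w_def
          by (intro mult_mono Lv t) auto
        finally show "torus_integral (\<lambda>x. norm (u t x - w x) * (norm (w x) ^ e))
            \<le> (sqrt (2 * (T * C1)) * \<delta>\<^sup>2) * (Q * \<delta> ^ e)" .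
      qed auto
      also have "\<dots> = C2 * \<delta> ^ (e + 2)"
        by (simp add: C2_def algebra_simps power_add power2_eq_square)
      finally show ?thesis .
    qed
    define I where "I = integral {0..T} G"
    have "(G has_integral I) {0..T}"
      unfolding I_def G_def[abs_def] using v.continuous_power_integral
      by (intro integrable_integral integrable_continuous_real)
    then have "((\<lambda>t. of_real (G t) * (\<i> * of_real (\<mu> * \<delta> ^ (e + 1)))) has_integral
        of_real I * (\<i> * of_real (\<mu> * \<delta> ^ (e + 1)))) {0..T}"
      by (intro has_integral_mult_left has_integral_of_real)
    then have "((\<lambda>t. D t + of_real (G t) * (\<i> * of_real (\<mu> * \<delta> ^ (e + 1)))) has_integral
        (P T - P 0 + of_real I * (\<i> * of_real (\<mu> * \<delta> ^ (e + 1))))) {0..T}"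
      using T by (intro has_integral_add P_int) auto
    then have "norm (P T - P 0 + of_real I * (\<i> * of_real (\<mu> * \<delta> ^ (e + 1))))
        \<le> C2 * \<delta> ^ (e + 2) * measure lborel {0..T}"
      by (rule has_integral_bound_real[where S = "{}", rotated 2]) (use C2 \<delta> D_close in auto)
    then have "\<bar>Im (P T - P 0 + of_real I * (\<i> * of_real (\<mu> * \<delta> ^ (e + 1))))\<bar> \<le> T * C2 * \<delta> ^ (e + 2)"
      using T abs_Im_le_cmod[of "P T - P 0 + of_real I * (\<i> * of_real (\<mu> * \<delta> ^ (e + 1)))"]
      by (simp add: mult_ac)
    moreover have "Im (P T - P 0 + of_real I * (\<i> * of_real (\<mu> * \<delta> ^ (e + 1))))
        = Im (P T) + \<mu> * \<delta> ^ (e + 1) * I"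
      unfolding P0 by simp
    ultimately show "\<bar>Im (torus_integral (\<lambda>x. u T x * cnj (v T x)))
        + \<mu> * \<delta> ^ (e + 1) * integral {0..T} (\<lambda>t. torus_integral (\<lambda>x. norm (v t x) ^ (e + 2)))\<bar>
      \<le> T * C2 * \<delta> ^ (e + 2)"
      by (simp only: I_def G_def[abs_def] v.power_integral_def P_def)
  qed
qed

section \<open>Smooth solutions as flows\<close>

lemma time_derivative_of_derivative:
  fixes F :: "real \<times> (real ^ 'd) \<Rightarrow> complex"
  assumes F: "(F has_derivative F') (at (t, x) within {0..T} \<times> UNIV)"
  shows "((\<lambda>s. F (s, x)) has_vector_derivative F' (1, 0)) (at t within {0..T})"
proof -
  have 1: "((\<lambda>s. (s, x)) has_derivative (\<lambda>h. (h, 0))) (at t within {0..T})"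
    by (auto intro!: derivative_eq_intros)
  have "(F has_derivative F') (at (t, x) within (\<lambda>s. (s, x)) ` {0..T})"
    by (rule has_derivative_subset[OF F]) auto
  from diff_chain_within[OF 1 this]
  have "((\<lambda>s. F (s, x)) has_derivative (\<lambda>h. F' (h, 0))) (at t within {0..T})"
    by (simp add: o_def)
  moreover have "(\<lambda>h. F' (h, 0)) = (\<lambda>h. h *\<^sub>R F' (1, 0))"
  proof
    fix h :: real
    have "F' (h *\<^sub>R (1, 0)) = h *\<^sub>R F' (1, 0)"
      by (rule linear_scale[OF has_derivative_linear[OF F]])
    then show "F' (h, 0) = h *\<^sub>R F' (1, 0)" by (simp add: scaleR_Pair)
  qed
  ultimately show ?thesis unfolding has_vector_derivative_def by argo
qed

lemma partial_of_derivative: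
  fixes F :: "real \<times> (real ^ 'd) \<Rightarrow> complex"
  assumes F: "\<And>x. (F has_derivative F' (t, x)) (at (t, x) within {0..T} \<times> UNIV)" and t: "t \<in> {0..T}"
  shows "has_partial j (\<lambda>x. F (t, x)) (\<lambda>x. F' (t, x) (0, axis j 1))"
  unfolding has_partial_def
proof
  fix x :: "real ^ 'd"
  let ?p = "\<lambda>s. (t, x + s *\<^sub>R (axis j 1 :: real ^ 'd))"
  have 1: "(?p has_derivative (\<lambda>h. (0, h *\<^sub>R axis j 1))) (at 0)"
    by (auto intro!: derivative_eq_intros)
  have "(F has_derivative F' (?p 0)) (at (?p 0) within ?p ` UNIV)"
    using F by (rule has_derivative_subset) (use t in auto)
  from diff_chain_within[OF 1 this]
  have "((\<lambda>s. F (?p s)) has_derivative (\<lambda>h. F' (t, x) (0, h *\<^sub>R axis j 1))) (at 0)"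
    by (simp add: o_def)
  moreover have "(\<lambda>h. F' (t, x) (0, h *\<^sub>R axis j 1)) = (\<lambda>h. h *\<^sub>R F' (t, x) (0, axis j 1))"
  proof
    fix h :: real
    have "F' (t, x) (h *\<^sub>R (0, axis j 1)) = h *\<^sub>R F' (t, x) (0, axis j 1)"
      by (rule linear_scale[OF has_derivative_linear[OF F]])
    then show "F' (t, x) (0, h *\<^sub>R axis j 1) = h *\<^sub>R F' (t, x) (0, axis j 1)"
      by (simp add: scaleR_Pair)
  qed
  ultimately show "((\<lambda>s. F (?p s)) has_vector_derivative F' (t, x) (0, axis j 1)) (at 0)"
    unfolding has_vector_derivative_def by argo
qed

lemma has_derivative_imp_continuous_on:
  assumes "\<forall>p\<in>A. (F has_derivative F' p) (at p within A)"
  shows "continuous_on A F"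
  using assms by (auto simp: continuous_on_eq_continuous_within intro: has_derivative_continuous)

lemma partial_deriv_eq: "has_partial j f f' \<Longrightarrow> partial_deriv j f = f'"
  by (auto simp: has_partial_def partial_deriv_def fun_eq_iff intro!: vector_derivative_at)

text \<open>
  Unfold two levels of \<open>Ck_on\<close>; the partial derivatives are components of the total derivatives, and
  they agree with the vector derivatives in the equation by uniqueness.
\<close>

lemma smooth_solution_is_flow:
  fixes u :: "real \<Rightarrow> real ^ 'd \<Rightarrow> complex"
  assumes u: "smooth_nls_solution \<mu> T u" and T: "0 < T" and d: "CARD('d) \<in> {1, 2}"
  obtains ut ux uxx utx where "nls_flow T u ut ux uxx utx \<mu> (4 div CARD('d))"
proof -
  let ?A = "{0..T} \<times> (UNIV :: (real ^ 'd) set)"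
  let ?U = "\<lambda>(t, x). u t x"
  have "Ck_on ?A (Suc (Suc 0)) ?U" using u unfolding smooth_nls_solution_def smooth_on_def by blast
  then obtain U' where U': "\<forall>p\<in>?A. (?U has_derivative U' p) (at p within ?A)"
    and C1: "\<forall>w. Ck_on ?A (Suc 0) (\<lambda>p. U' p w)"
    unfolding Ck_on.simps(2)[of ?A "Suc 0"] by blast
  from C1 have "\<forall>w. \<exists>V'. (\<forall>p\<in>?A. ((\<lambda>p. U' p w) has_derivative V' p) (at p within ?A))
      \<and> (\<forall>z. continuous_on ?A (\<lambda>p. V' p z))"
    unfolding Ck_on.simps by blast
  then obtain U'' where U'': "\<And>w. \<forall>p\<in>?A. ((\<lambda>p. U' p w) has_derivative U'' w p) (at p within ?A)"
    and c2: "\<And>w z. continuous_on ?A (\<lambda>p. U'' w p z)"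
    by metis
  have c0: "continuous_on ?A ?U" by (rule has_derivative_imp_continuous_on[OF U'])
  have c1: "continuous_on ?A (\<lambda>p. U' p w)" for w by (rule has_derivative_imp_continuous_on[OF U''])
  let ?e = "\<lambda>j. (0, axis j 1) :: real \<times> (real ^ 'd)"
  define ut where "ut t x = U' (t, x) (1, 0)" for t x
  define ux where "ux j t x = U' (t, x) (?e j)" for j t x
  define uxx where "uxx j t x = U'' (?e j) (t, x) (?e j)" for j t x
  define utx where "utx j t x = U'' (?e j) (t, x) (1, 0)" for j t x
  have flow: "C2_flow T u ut ux uxx utx"
  proof
    show "0 < T" by fact
    show "torus_periodic (u t)" if "t \<in> {0..T}" for t
      using u that unfolding smooth_nls_solution_def by blast
    show "continuous_on ?A (\<lambda>p. u (fst p) (snd p))" using c0 by (simp add: split_def)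
    show "continuous_on ?A (\<lambda>p. ut (fst p) (snd p))" "continuous_on ?A (\<lambda>p. ux j (fst p) (snd p))"
      "continuous_on ?A (\<lambda>p. uxx j (fst p) (snd p))" "continuous_on ?A (\<lambda>p. utx j (fst p) (snd p))" for j
      unfolding ut_def ux_def uxx_def utx_def using c1 c2 by simp_all
    fix t j assume t: "t \<in> {0..T}"
    show "((\<lambda>s. u s x) has_vector_derivative ut t x) (at t within {0..T})" for x
      using time_derivative_of_derivative[of ?U "U' (t, x)" t x T] U' t by (simp add: ut_def)
    show "((\<lambda>s. ux j s x) has_vector_derivative utx j t x) (at t within {0..T})" for x
      unfolding ux_def utx_def
      using time_derivative_of_derivative[of "\<lambda>p. U' p (?e j)" "U'' (?e j) (t, x)" t x T] U'' t by simp
    show "has_partial j (u t) (ux j t)"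
      using partial_of_derivative[of ?U U' t T j] U' t by (simp add: ux_def[abs_def])
    show "has_partial j (ux j t) (uxx j t)"
      unfolding ux_def[abs_def] uxx_def[abs_def]
      using partial_of_derivative[of "\<lambda>p. U' p (?e j)" "U'' (?e j)" t T j] U'' t by simp
  qed
  interpret C2_flow T u ut ux uxx utx by (rule flow)
  have "nls_flow T u ut ux uxx utx \<mu> (4 div CARD('d))"
  proof
    show "even (4 div CARD('d))" using d by auto
    fix t x assume t: "t \<in> {0..T}"
    have "partial_deriv j (u t) = ux j t" "partial_deriv j (ux j t) = uxx j t" for j
      by (rule partial_deriv_eq[OF der_x[OF t]] partial_deriv_eq[OF der_xx[OF t]])+
    then have "laplacian (u t) x = lap t x" by (simp add: laplacian_def lap_def)
    moreover have "vector_derivative (\<lambda>s. u s x) (at t within {0..T}) = ut t x"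
      by (rule vector_derivative_within_closed_interval[OF _ _ der_t[OF t]]) (use T t in auto)
    moreover have "norm (u t x) powr (4 / real CARD('d)) = norm (u t x) ^ (4 div CARD('d))"
      using d by auto
    ultimately show "\<i> * ut t x + lap t x = of_real \<mu> * of_real (norm (u t x) ^ (4 div CARD('d))) * u t x"
      using u t unfolding smooth_nls_solution_def by metis
  qed
  then show thesis by (rule that)
qed

section \<open>Trigonometric polynomials\<close>

definition lattice_point :: "real ^ 'd \<Rightarrow> bool" where
  "lattice_point n \<longleftrightarrow> (\<forall>i. n $ i \<in> \<int>)"

text \<open>
  The free evolution of the Dirichlet-type kernel $\sum_{n \in E} e^{i n \cdot x}$.
\<close>

definition wave :: "(real ^ 'd) set \<Rightarrow> real \<Rightarrow> real ^ 'd \<Rightarrow> complex" where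
  "wave E t x = (\<Sum>n\<in>E. cis (n \<bullet> x - (n \<bullet> n) * t))"

lemma cis_periodic: "k \<in> \<int> \<Longrightarrow> cis (y + k * (2 * pi)) = cis y"
  using cis_multiple_2pi[of k] by (simp add: mult.commute flip: cis_mult)

lemma torus_periodic_wave:
  assumes "\<And>n. n \<in> E \<Longrightarrow> lattice_point n"
  shows "torus_periodic (wave E t)"
proof -
  have "cis (n \<bullet> (x + (2 * pi) *\<^sub>R axis i 1) - (n \<bullet> n) * t) = cis (n \<bullet> x - (n \<bullet> n) * t)"
    if "n \<in> E" for n x i
    using cis_periodic[of "n $ i" "n \<bullet> x - (n \<bullet> n) * t"] assms[OF that]
    by (simp add: lattice_point_def inner_add_right inner_axis algebra_simps)
  then show ?thesis unfolding torus_periodic_def wave_def by (intro allI sum.cong) auto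
qed

lemma has_vector_derivative_cis:
  assumes "(f has_real_derivative f') (at s within A)"
  shows "((\<lambda>s. c * cis (f s)) has_vector_derivative (c * (\<i> * of_real f')) * cis (f s)) (at s within A)"
proof -
  have "(cis has_vector_derivative \<i> * cis (f s)) (at (f s) within f ` A)"
    unfolding cis_conv_exp
    by (rule has_vector_derivative_eq_rhs[OF has_vector_derivative_real_field])
      (auto intro!: derivative_eq_intros)
  from vector_diff_chain_within[OF assms[unfolded has_real_derivative_iff_has_vector_derivative] this]
  have "((\<lambda>s. cis (f s)) has_vector_derivative f' *\<^sub>R (\<i> * cis (f s))) (at s within A)"
    by (simp add: o_def)
  from has_vector_derivative_mult_right[OF this, of c]
  show ?thesis by (simp add: scaleR_conv_of_real mult_ac)
qed

text \<open>
  The time shift $\tau$ allows the estimate on $[0,T]$ to be moved along the time axis.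
\<close>

lemma wave_is_free_flow:
  fixes E :: "(real ^ 'd) set"
  assumes T: "0 < T" and E: "finite E" "\<And>n. n \<in> E \<Longrightarrow> lattice_point n"
  obtains vt vx vxx vtx where "free_flow T (\<lambda>t. wave E (\<tau> + t)) vt vx vxx vtx (real (card E))"
proof -
  define ph where "ph n t x = n \<bullet> x - (n \<bullet> n) * (\<tau> + t)" for n x :: "real ^ 'd" and t
  define vt where "vt t x = (\<Sum>n\<in>E. (1 * (\<i> * of_real (- (n \<bullet> n)))) * cis (ph n t x))" for t x
  define vx where "vx j t x = (\<Sum>n\<in>E. (1 * (\<i> * of_real (n $ j))) * cis (ph n t x))" for j t x
  define vxx where "vxx j t x = (\<Sum>n\<in>E. ((1 * (\<i> * of_real (n $ j))) * (\<i> * of_real (n $ j))) * cis (ph n t x))"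
    for j t x
  define vtx where "vtx j t x = (\<Sum>n\<in>E. ((1 * (\<i> * of_real (n $ j))) * (\<i> * of_real (- (n \<bullet> n)))) * cis (ph n t x))"
    for j t x
  let ?v = "\<lambda>t. wave E (\<tau> + t)"
  have v: "?v t x = (\<Sum>n\<in>E. 1 * cis (ph n t x))" for t x by (simp add: wave_def ph_def)
  have cont: "continuous_on A (\<lambda>p. \<Sum>n\<in>E. c n * cis (ph n (fst p) (snd p)))" for c A
    unfolding ph_def by (intro continuous_intros)
  have dt: "((\<lambda>s. \<Sum>n\<in>E. c n * cis (ph n s x)) has_vector_derivative
      (\<Sum>n\<in>E. (c n * (\<i> * of_real (- (n \<bullet> n)))) * cis (ph n t x))) (at t within A)" for c x t A
    unfolding ph_def
    by (intro has_vector_derivative_sum has_vector_derivative_cis) (auto intro!: derivative_eq_intros)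
  have dx: "has_partial j (\<lambda>x. \<Sum>n\<in>E. c n * cis (ph n t x))
      (\<lambda>x. \<Sum>n\<in>E. (c n * (\<i> * of_real (n $ j))) * cis (ph n t x))" for c t j
    unfolding has_partial_def
  proof
    fix x
    have "((\<lambda>s. \<Sum>n\<in>E. c n * cis (ph n t (x + s *\<^sub>R axis j 1))) has_vector_derivative
        (\<Sum>n\<in>E. (c n * (\<i> * of_real (n $ j))) * cis (ph n t (x + 0 *\<^sub>R axis j 1)))) (at 0)"
      unfolding ph_def
      by (intro has_vector_derivative_sum has_vector_derivative_cis)
        (auto intro!: derivative_eq_intros simp: inner_add_right inner_axis)
    then show "((\<lambda>s. \<Sum>n\<in>E. c n * cis (ph n t (x + s *\<^sub>R axis j 1))) has_vector_derivative
        (\<Sum>n\<in>E. (c n * (\<i> * of_real (n $ j))) * cis (ph n t x))) (at 0)"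
      by simp
  qed
  have flow: "C2_flow T ?v vt vx vxx vtx"
  proof
    show "0 < T" by fact
    show "torus_periodic (?v t)" for t by (rule torus_periodic_wave[OF E(2)])
    show "continuous_on ({0..T} \<times> UNIV) (\<lambda>p. ?v (fst p) (snd p))"
      "continuous_on ({0..T} \<times> UNIV) (\<lambda>p. vt (fst p) (snd p))"
      "continuous_on ({0..T} \<times> UNIV) (\<lambda>p. vx j (fst p) (snd p))"
      "continuous_on ({0..T} \<times> UNIV) (\<lambda>p. vxx j (fst p) (snd p))"
      "continuous_on ({0..T} \<times> UNIV) (\<lambda>p. vtx j (fst p) (snd p))" for j
      unfolding v vt_def vx_def vxx_def vtx_def by (rule cont)+
    fix t j
    show "((\<lambda>s. ?v s x) has_vector_derivative vt t x) (at t within {0..T})" for x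
      unfolding v vt_def by (rule dt)
    show "has_partial j (?v t) (vx j t)" unfolding v[abs_def] vx_def[abs_def] by (rule dx)
    show "has_partial j (vx j t) (vxx j t)" unfolding vx_def[abs_def] vxx_def[abs_def] by (rule dx)
    show "((\<lambda>s. vx j s x) has_vector_derivative vtx j t x) (at t within {0..T})" for x
      unfolding vx_def vtx_def by (rule dt)
  qed
  interpret C2_flow T ?v vt vx vxx vtx by (rule flow)
  have "free_flow T ?v vt vx vxx vtx (real (card E))"
  proof
    fix t x
    have "lap t x = (\<Sum>n\<in>E. \<Sum>j\<in>UNIV. ((1 * (\<i> * of_real (n $ j))) * (\<i> * of_real (n $ j))) * cis (ph n t x))"
      unfolding lap_def vxx_def by (rule sum.swap)
    also have "\<dots> = (\<Sum>n\<in>E. of_real (- (n \<bullet> n)) * cis (ph n t x))"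
    proof (rule sum.cong[OF refl])
      fix n :: "real ^ 'd"
      have "(\<Sum>j\<in>UNIV. (1 * (\<i> * of_real (n $ j))) * (\<i> * of_real (n $ j))) = of_real (- (n \<bullet> n))"
        by (simp add: inner_vec_def sum_negf mult_ac)
      then show "(\<Sum>j\<in>UNIV. ((1 * (\<i> * of_real (n $ j))) * (\<i> * of_real (n $ j))) * cis (ph n t x))
          = of_real (- (n \<bullet> n)) * cis (ph n t x)"
        by (simp only: sum_distrib_right[symmetric])
    qed
    finally show "residual t x = 0"
      by (simp add: residual_def vt_def sum_distrib_left mult.assoc)
    have "norm (?v t x) \<le> (\<Sum>n\<in>E. norm (cis (n \<bullet> x - (n \<bullet> n) * (\<tau> + t))))"
      unfolding wave_def by (rule norm_sum)
    then show "norm (?v t x) \<le> real (card E)" by simp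
  qed
  then show thesis by (rule that)
qed

text \<open>
  A derivative is again a trigonometric sum, with other coefficients.
\<close>

lemma Ck_on_trig_sum:
  fixes E :: "(real ^ 'd) set"
  assumes "finite E"
  shows "Ck_on UNIV k (\<lambda>x. \<Sum>n\<in>E. c n * cis (n \<bullet> x))"
proof (induction k arbitrary: c)
  case 0
  show ?case by (auto intro!: continuous_intros)
next
  case (Suc k)
  let ?f' = "\<lambda>x w. \<Sum>n\<in>E. c n * (\<i> * of_real (n \<bullet> w)) * cis (n \<bullet> x)"
  have "((\<lambda>x. \<Sum>n\<in>E. c n * cis (n \<bullet> x)) has_derivative ?f' x) (at x)" for x
  proof (rule has_derivative_sum)
    fix n
    have "((\<lambda>s. c n * cis s) has_derivative (\<lambda>h. h *\<^sub>R ((c n * \<i>) * cis (n \<bullet> x)))) (at (n \<bullet> x))"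
      using has_vector_derivative_cis[of "\<lambda>s. s" 1 "n \<bullet> x" UNIV "c n"]
      by (simp add: has_vector_derivative_def)
    from has_derivative_compose[OF bounded_linear_imp_has_derivative[OF bounded_linear_inner_right] this]
    show "((\<lambda>x. c n * cis (n \<bullet> x)) has_derivative (\<lambda>w. c n * (\<i> * of_real (n \<bullet> w)) * cis (n \<bullet> x))) (at x)"
      by (simp add: scaleR_conv_of_real mult_ac)
  qed
  moreover have "Ck_on UNIV k (\<lambda>x. ?f' x w)" for w
    using Suc[of "\<lambda>n. c n * (\<i> * of_real (n \<bullet> w))"] .
  ultimately show ?case unfolding Ck_on.simps by (intro exI[of _ ?f']) auto
qed

lemma torus_smooth_wave:
  fixes E :: "(real ^ 'd) set"
  assumes "finite E" "\<And>n. n \<in> E \<Longrightarrow> lattice_point n"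
  shows "torus_smooth (\<lambda>x. of_real \<delta> * wave E t x)"
proof -
  have "torus_periodic (\<lambda>x. of_real \<delta> * wave E t x)"
    by (rule torus_periodic_compose[OF torus_periodic_wave[OF assms(2)]])
  moreover have "(\<lambda>x. of_real \<delta> * wave E t x)
      = (\<lambda>x. \<Sum>n\<in>E. (of_real \<delta> * cis (- (n \<bullet> n) * t)) * cis (n \<bullet> x))"
    by (simp add: wave_def sum_distrib_left mult.assoc cis_mult fun_eq_iff add.commute)
  ultimately show ?thesis
    using Ck_on_trig_sum[OF assms(1)] by (simp add: torus_smooth_def smooth_on_def)
qed

section \<open>Taylor estimates for differentiable maps\<close>

text \<open>
  The consequence of $C^k$ regularity that survives without iterated spaces of linear operators: along
  every ray, every scalar function $\delta \mapsto L(f(\delta\varphi))$ has $k$ derivatives near the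
  origin, and the last one is bounded like a $k$-linear form in $\varphi$, uniformly in the functional
  $L$ (of norm at most $N$) and the direction $\varphi$.
\<close>

definition ray_derivatives_bounded :: "nat \<Rightarrow> ('a::real_normed_vector \<Rightarrow> 'b::real_normed_vector) \<Rightarrow> bool" where
  "ray_derivatives_bounded k f \<longleftrightarrow> (\<exists>\<rho>>0. \<exists>M\<ge>0. \<forall>L N \<phi>.
     linear L \<and> 0 \<le> N \<and> (\<forall>y. \<bar>L y\<bar> \<le> N * norm y) \<longrightarrow>
     (\<exists>diff :: nat \<Rightarrow> real \<Rightarrow> real. diff 0 = (\<lambda>\<delta>. L (f (\<delta> *\<^sub>R \<phi>))) \<and>
        (\<forall>\<delta>. \<bar>\<delta>\<bar> * norm \<phi> < \<rho> \<longrightarrow>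
          (\<forall>m<k. (diff m has_real_derivative diff (Suc m) \<delta>) (at \<delta>)) \<and>
          \<bar>diff k \<delta>\<bar> \<le> N * M * norm \<phi> ^ k)))"

lemma ray_derivatives_bounded_0:
  assumes "open U" "0 \<in> U" "continuous_on U f"
  shows "ray_derivatives_bounded 0 f"
proof -
  have "isCont f 0" using assms by (simp add: continuous_on_eq_continuous_at)
  then obtain \<rho> where \<rho>: "\<rho> > 0" "\<And>x. dist x 0 < \<rho> \<Longrightarrow> dist (f x) (f 0) < 1"
    unfolding continuous_at_eps_delta by (metis zero_less_one)
  have M: "norm (f x) \<le> norm (f 0) + 1" if "norm x < \<rho>" for x
    using \<rho>(2)[of x] that norm_triangle_ineq2[of "f x" "f 0"] by (simp add: dist_norm)
  have "\<bar>L (f (\<delta> *\<^sub>R \<phi>))\<bar> \<le> N * (norm (f 0) + 1) * norm \<phi> ^ 0"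
    if "0 \<le> N" "\<forall>y. \<bar>L y\<bar> \<le> N * norm y" "\<bar>\<delta>\<bar> * norm \<phi> < \<rho>" for L :: "'b \<Rightarrow> real" and N \<delta> \<phi>
  proof -
    have "\<bar>L (f (\<delta> *\<^sub>R \<phi>))\<bar> \<le> N * norm (f (\<delta> *\<^sub>R \<phi>))" using that by simp
    also have "\<dots> \<le> N * (norm (f 0) + 1)" using that by (intro mult_left_mono M) auto
    finally show ?thesis by simp
  qed
  then show ?thesis
    unfolding ray_derivatives_bounded_def
    by (intro exI[of _ \<rho>] exI[of _ "norm (f 0) + 1"] conjI allI impI \<rho>(1))
      (auto intro!: exI[of _ "\<lambda>m \<delta>. _ (f (\<delta> *\<^sub>R _))"])
qed

text \<open>
  The derivative of $L(f(\delta\varphi))$ is $L(f'(\delta\varphi)\varphi)$, which is the functional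
  $A \mapsto L(A\varphi)$ of norm at most $N \|\varphi\|$ applied to $f'(\delta\varphi)$.
\<close>

lemma ray_derivatives_bounded_Suc:
  fixes f :: "'a::real_normed_vector \<Rightarrow> 'b::real_normed_vector"
  assumes U: "open U" "0 \<in> U"
    and der: "\<And>x. x \<in> U \<Longrightarrow> (f has_derivative blinfun_apply (f' x)) (at x)"
    and f': "ray_derivatives_bounded k f'"
  shows "ray_derivatives_bounded (Suc k) f"
proof -
  obtain \<rho>' M where \<rho>': "\<rho>' > 0" and M: "M \<ge> 0"
    and D: "\<And>L N \<phi>. linear L \<Longrightarrow> 0 \<le> N \<Longrightarrow> (\<And>y. \<bar>L y\<bar> \<le> N * norm y) \<Longrightarrow>
     \<exists>diff :: nat \<Rightarrow> real \<Rightarrow> real. diff 0 = (\<lambda>\<delta>. L (f' (\<delta> *\<^sub>R \<phi>))) \<and>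
        (\<forall>\<delta>. \<bar>\<delta>\<bar> * norm \<phi> < \<rho>' \<longrightarrow>
          (\<forall>m<k. (diff m has_real_derivative diff (Suc m) \<delta>) (at \<delta>)) \<and>
          \<bar>diff k \<delta>\<bar> \<le> N * M * norm \<phi> ^ k)"
    using f' unfolding ray_derivatives_bounded_def by blast
  obtain \<rho>'' where \<rho>'': "\<rho>'' > 0" "ball 0 \<rho>'' \<subseteq> U" using U open_contains_ball by blast
  define \<rho> where "\<rho> = min \<rho>' \<rho>''"
  have \<rho>: "\<rho> > 0" using \<rho>' \<rho>'' by (simp add: \<rho>_def)
  have "\<exists>diff :: nat \<Rightarrow> real \<Rightarrow> real. diff 0 = (\<lambda>\<delta>. L (f (\<delta> *\<^sub>R \<phi>))) \<and>
        (\<forall>\<delta>. \<bar>\<delta>\<bar> * norm \<phi> < \<rho> \<longrightarrow>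
          (\<forall>m<Suc k. (diff m has_real_derivative diff (Suc m) \<delta>) (at \<delta>)) \<and>
          \<bar>diff (Suc k) \<delta>\<bar> \<le> N * M * norm \<phi> ^ Suc k)"
    if L: "linear L" "0 \<le> N" "\<And>y. \<bar>L y\<bar> \<le> N * norm y" for L :: "'b \<Rightarrow> real" and N \<phi>
  proof -
    define L' where "L' A = L (blinfun_apply A \<phi>)" for A :: "'a \<Rightarrow>\<^sub>L 'b"
    have "linear L'"
      unfolding L'_def
      by (intro linearI) (simp_all add: blinfun.add_left blinfun.scaleR_left linear_add[OF L(1)] linear_scale[OF L(1)])
    moreover have "\<bar>L' A\<bar> \<le> (N * norm \<phi>) * norm A" for A
    proof -
      have "\<bar>L' A\<bar> \<le> N * norm (blinfun_apply A \<phi>)" unfolding L'_def by (rule L(3))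
      also have "\<dots> \<le> N * (norm A * norm \<phi>)" by (intro mult_left_mono norm_blinfun L)
      finally show ?thesis by (simp add: mult_ac)
    qed
    ultimately obtain diff :: "nat \<Rightarrow> real \<Rightarrow> real" where
      diff0: "diff 0 = (\<lambda>\<delta>. L' (f' (\<delta> *\<^sub>R \<phi>)))"
      and diff: "\<And>\<delta>. \<bar>\<delta>\<bar> * norm \<phi> < \<rho>' \<Longrightarrow>
          (\<forall>m<k. (diff m has_real_derivative diff (Suc m) \<delta>) (at \<delta>)) \<and>
          \<bar>diff k \<delta>\<bar> \<le> (N * norm \<phi>) * M * norm \<phi> ^ k"
      using D[of L' "N * norm \<phi>" \<phi>] L(2) by auto
    define diff' where "diff' m = (case m of 0 \<Rightarrow> (\<lambda>\<delta>. L (f (\<delta> *\<^sub>R \<phi>))) | Suc n \<Rightarrow> diff n)" for m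
    have L_bl: "bounded_linear L"
      using L by (intro linear_conv_bounded_linear[THEN iffD1] bounded_linear_intro[of _ N])
        (auto simp: linear_add linear_scale mult.commute)
    have first: "((\<lambda>\<delta>. L (f (\<delta> *\<^sub>R \<phi>))) has_real_derivative diff 0 \<delta>) (at \<delta>)"
      if "\<bar>\<delta>\<bar> * norm \<phi> < \<rho>" for \<delta>
    proof -
      have "\<delta> *\<^sub>R \<phi> \<in> U" using that \<rho>'' by (auto simp: \<rho>_def)
      have 1: "((\<lambda>\<delta>. \<delta> *\<^sub>R \<phi>) has_derivative (\<lambda>h. h *\<^sub>R \<phi>)) (at \<delta>)"
        by (auto intro!: derivative_eq_intros)
      from has_derivative_compose[OF 1 der[OF \<open>\<delta> *\<^sub>R \<phi> \<in> U\<close>]]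
      have "((\<lambda>\<delta>. f (\<delta> *\<^sub>R \<phi>)) has_derivative (\<lambda>h. f' (\<delta> *\<^sub>R \<phi>) (h *\<^sub>R \<phi>))) (at \<delta>)" .
      from bounded_linear.has_derivative[OF L_bl this]
      have "((\<lambda>\<delta>. L (f (\<delta> *\<^sub>R \<phi>))) has_derivative (\<lambda>h. h * L (f' (\<delta> *\<^sub>R \<phi>) \<phi>))) (at \<delta>)"
        by (simp add: blinfun.scaleR_right linear_scale[OF L(1)])
      moreover have "(\<lambda>h. h * c) = (*) c" for c :: real by (simp add: fun_eq_iff)
      ultimately show ?thesis
        by (simp only: has_field_derivative_def diff0 L'_def)
    qed
    show ?thesis
    proof (intro exI[of _ diff'] conjI allI impI)
      show "diff' 0 = (\<lambda>\<delta>. L (f (\<delta> *\<^sub>R \<phi>)))" by (simp add: diff'_def)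
      fix \<delta> assume \<delta>: "\<bar>\<delta>\<bar> * norm \<phi> < \<rho>"
      then have \<delta>': "\<bar>\<delta>\<bar> * norm \<phi> < \<rho>'" by (simp add: \<rho>_def)
      show "(diff' m has_real_derivative diff' (Suc m) \<delta>) (at \<delta>)" if "m < Suc k" for m
        using that first[OF \<delta>] diff[OF \<delta>'] by (cases m) (simp_all add: diff'_def)
      show "\<bar>diff' (Suc k) \<delta>\<bar> \<le> N * M * norm \<phi> ^ Suc k"
        using diff[OF \<delta>'] by (simp add: diff'_def mult_ac)
    qed
  qed
  then show ?thesis
    unfolding ray_derivatives_bounded_def using \<rho> M by blast
qed

lemma C1_with_ray_derivatives_bounded:
  assumes "C1_with P U f" "open U" "0 \<in> U" "\<And>f'. P f' \<Longrightarrow> ray_derivatives_bounded k f'"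
  shows "ray_derivatives_bounded (Suc k) f"
  using assms(1) unfolding C1_with_def
  by (auto intro!: ray_derivatives_bounded_Suc[OF assms(2,3)] assms(4))

lemma C3_at_ray_derivatives_bounded:
  assumes "C3_at 0 f"
  shows "ray_derivatives_bounded 3 f"
proof -
  have "(3::nat) = Suc (Suc (Suc 0))" by simp
  with assms show ?thesis
    unfolding C3_at_def C3_on_def
    by (elim exE conjE)
      (simp only:, (assumption | erule C1_with_ray_derivatives_bounded | rule ray_derivatives_bounded_0)+)
qed

lemma C5_at_ray_derivatives_bounded:
  assumes "C5_at 0 f"
  shows "ray_derivatives_bounded 5 f"
proof -
  have "(5::nat) = Suc (Suc (Suc (Suc (Suc 0))))" by simp
  with assms show ?thesis
    unfolding C5_at_def C5_on_def
    by (elim exE conjE)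
      (simp only:, (assumption | erule C1_with_ray_derivatives_bounded | rule ray_derivatives_bounded_0)+)
qed

text \<open>
  A polynomial of degree less than $n$ that is $O(h^n)$ at zero vanishes.
\<close>

lemma vanishing_coefficients:
  fixes c :: "nat \<Rightarrow> real"
  assumes "h\<^sub>0 > 0" "\<And>h. 0 < h \<Longrightarrow> h < h\<^sub>0 \<Longrightarrow> \<bar>\<Sum>m<n. c m * h ^ m\<bar> \<le> C * h ^ n" "m < n"
  shows "c m = 0"
  using assms(2,3)
proof (induction n arbitrary: c m)
  case (Suc n)
  have ev: "\<forall>\<^sub>F h in at_right 0. 0 < h \<and> h < h\<^sub>0"
    using assms(1) by (auto simp: eventually_at_right_field)
  have lim: "((\<lambda>h. \<Sum>m<Suc n. c m * h ^ m) \<longlongrightarrow> (\<Sum>m<Suc n. c m * 0 ^ m)) (at_right 0)"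
    by (intro tendsto_intros)
  have lim0: "((\<lambda>h. C * h ^ Suc n) \<longlongrightarrow> C * 0 ^ Suc n) (at_right 0)"
    by (intro tendsto_intros)
  have "((\<lambda>h. \<Sum>m<Suc n. c m * h ^ m) \<longlongrightarrow> 0) (at_right 0)"
    by (rule Lim_null_comparison[OF _ lim0[simplified]])
      (use ev in \<open>eventually_elim, use Suc.prems(1) in auto\<close>)
  then have "(\<Sum>m<Suc n. c m * 0 ^ m) = 0"
    using lim by (intro tendsto_unique[OF _ lim]) auto
  then have c0: "c 0 = 0" by (simp add: sum.lessThan_Suc_shift del: sum.lessThan_Suc)
  have "\<bar>\<Sum>m<n. c (Suc m) * h ^ m\<bar> \<le> C * h ^ n" if h: "0 < h" "h < h\<^sub>0" for h
  proof -
    have "(\<Sum>m<Suc n. c m * h ^ m) = h * (\<Sum>m<n. c (Suc m) * h ^ m)"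
      by (simp add: sum.lessThan_Suc_shift c0 sum_distrib_left mult_ac del: sum.lessThan_Suc)
    then have "h * \<bar>\<Sum>m<n. c (Suc m) * h ^ m\<bar> \<le> h * (C * h ^ n)"
      using Suc.prems(1)[OF h] h by (simp add: abs_mult mult_ac del: sum.lessThan_Suc)
    then show ?thesis using h by simp
  qed
  then have "c (Suc m) = 0" if "m < n" for m using Suc.IH[of "\<lambda>m. c (Suc m)" m] that by blast
  then show ?case using c0 Suc.prems(2) by (cases m) auto
qed simp

text \<open>
  If $L(f(\delta\varphi)) = a \delta^k + O(\delta^{k+1})$, then the Taylor polynomial of degree less than
  $k$ vanishes, and the remainder bounds $a$.
\<close>

lemma taylor_leading_coefficient_bound:
  fixes f :: "'a::real_normed_vector \<Rightarrow> 'b::real_normed_vector"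
  assumes "ray_derivatives_bounded k f" "0 < k"
  obtains M where "0 \<le> M"
    and "\<And>L N \<phi> a C \<delta>\<^sub>0. linear L \<Longrightarrow> 0 \<le> N \<Longrightarrow> (\<And>y. \<bar>L y\<bar> \<le> N * norm y) \<Longrightarrow> 0 < \<delta>\<^sub>0 \<Longrightarrow>
      (\<And>\<delta>. 0 < \<delta> \<Longrightarrow> \<delta> < \<delta>\<^sub>0 \<Longrightarrow> \<bar>L (f (\<delta> *\<^sub>R \<phi>)) - a * \<delta> ^ k\<bar> \<le> C * \<delta> ^ Suc k) \<Longrightarrow>
      \<bar>a\<bar> \<le> N * M * norm \<phi> ^ k"
proof -
  obtain \<rho> M where \<rho>: "\<rho> > 0" and M: "M \<ge> 0"
    and D: "\<And>L N \<phi>. linear L \<Longrightarrow> 0 \<le> N \<Longrightarrow> (\<And>y. \<bar>L y\<bar> \<le> N * norm y) \<Longrightarrow>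
     \<exists>diff :: nat \<Rightarrow> real \<Rightarrow> real. diff 0 = (\<lambda>\<delta>. L (f (\<delta> *\<^sub>R \<phi>))) \<and>
        (\<forall>\<delta>. \<bar>\<delta>\<bar> * norm \<phi> < \<rho> \<longrightarrow>
          (\<forall>m<k. (diff m has_real_derivative diff (Suc m) \<delta>) (at \<delta>)) \<and>
          \<bar>diff k \<delta>\<bar> \<le> N * M * norm \<phi> ^ k)"
    using assms(1) unfolding ray_derivatives_bounded_def by blast
  show thesis
  proof (rule that[OF M])
    fix L :: "'b \<Rightarrow> real" and N \<phi> a C \<delta>\<^sub>0
    assume L: "linear L" "0 \<le> N" "\<And>y. \<bar>L y\<bar> \<le> N * norm y" and \<delta>\<^sub>0: "0 < \<delta>\<^sub>0"
      and exp: "\<And>\<delta>. 0 < \<delta> \<Longrightarrow> \<delta> < \<delta>\<^sub>0 \<Longrightarrow> \<bar>L (f (\<delta> *\<^sub>R \<phi>)) - a * \<delta> ^ k\<bar> \<le> C * \<delta> ^ Suc k"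
    define B where "B = N * M * norm \<phi> ^ k"
    have B: "0 \<le> B" using L M by (simp add: B_def)
    obtain diff :: "nat \<Rightarrow> real \<Rightarrow> real" where diff0: "diff 0 = (\<lambda>\<delta>. L (f (\<delta> *\<^sub>R \<phi>)))"
      and diff: "\<And>\<delta>. \<bar>\<delta>\<bar> * norm \<phi> < \<rho> \<Longrightarrow>
          (\<forall>m<k. (diff m has_real_derivative diff (Suc m) \<delta>) (at \<delta>)) \<and> \<bar>diff k \<delta>\<bar> \<le> B"
      using D[OF L, of \<phi>] by (auto simp: B_def)
    \<comment> \<open>Keeps $h\varphi$ within the radius $\rho$, also for $\varphi = 0$.\<close>
    define h\<^sub>0 where "h\<^sub>0 = min 1 (min \<delta>\<^sub>0 (\<rho> / (norm \<phi> + 1)))"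
    have h\<^sub>0: "0 < h\<^sub>0" using \<delta>\<^sub>0 \<rho> by (auto simp: h\<^sub>0_def add_nonneg_pos)
    have near: "\<bar>t\<bar> * norm \<phi> < \<rho>" if "0 \<le> t" "t < h\<^sub>0" for t
    proof -
      have "t * (norm \<phi> + 1) < \<rho>" using that by (simp add: h\<^sub>0_def pos_less_divide_eq add_nonneg_pos)
      then show ?thesis using that by (simp add: algebra_simps)
    qed
    have mac: "\<exists>t. 0 < t \<and> t < h \<and> L (f (h *\<^sub>R \<phi>))
        = (\<Sum>m<k. (diff m 0 / fact m) * h ^ m) + (diff k t / fact k) * h ^ k"
      if h: "0 < h" "h < h\<^sub>0" for h
    proof (rule Maclaurin[OF h(1) assms(2)])
      show "diff 0 = (\<lambda>h. L (f (h *\<^sub>R \<phi>)))" by (rule diff0)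
      show "\<forall>m t. m < k \<and> 0 \<le> t \<and> t \<le> h \<longrightarrow> DERIV (diff m) t :> diff (Suc m) t"
        using diff near h by force
    qed
    have rem: "\<bar>(diff k t / fact k) * h ^ k\<bar> \<le> B * h ^ k" if "0 < t" "t < h" "h < h\<^sub>0" for t h
    proof -
      have "\<bar>diff k t\<bar> \<le> B" using diff[OF near[of t]] that by auto
      moreover have "\<bar>diff k t / fact k\<bar> \<le> \<bar>diff k t\<bar>"
        using fact_ge_1[of k, where ?'a = real] by (simp add: divide_le_eq mult_left_le_one_le mult_le_cancel_left1)
      ultimately have "\<bar>diff k t / fact k\<bar> * h ^ k \<le> B * h ^ k"
        using that by (intro mult_right_mono) auto
      then show ?thesis using that by (simp add: abs_mult)
    qed
    have coeff: "diff m 0 / fact m = 0" if "m < k" for m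
    proof (rule vanishing_coefficients[OF h\<^sub>0 _ that])
      fix h assume h: "0 < h" "h < h\<^sub>0"
      then obtain t where t: "0 < t" "t < h" and eq: "L (f (h *\<^sub>R \<phi>))
        = (\<Sum>m<k. (diff m 0 / fact m) * h ^ m) + (diff k t / fact k) * h ^ k"
        using mac by blast
      have "\<bar>L (f (h *\<^sub>R \<phi>)) - a * h ^ k\<bar> \<le> C * h ^ Suc k" using h by (intro exp) (auto simp: h\<^sub>0_def)
      also have "\<dots> \<le> \<bar>C\<bar> * h ^ k"
        using h by (intro mult_mono power_decreasing) (auto simp: h\<^sub>0_def)
      finally have "\<bar>L (f (h *\<^sub>R \<phi>))\<bar> \<le> \<bar>C\<bar> * h ^ k + \<bar>a\<bar> * h ^ k"
        using abs_triangle_ineq2[of "L (f (h *\<^sub>R \<phi>))" "a * h ^ k"] h by (simp add: abs_mult)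
      then show "\<bar>\<Sum>m<k. (diff m 0 / fact m) * h ^ m\<bar> \<le> (\<bar>C\<bar> + \<bar>a\<bar> + B) * h ^ k"
        using eq rem[OF t h(2)] unfolding distrib_right by linarith
    qed
    have bound: "\<bar>a\<bar> \<le> B + \<bar>C\<bar> * h" if h: "0 < h" "h < h\<^sub>0" for h
    proof -
      obtain t where t: "0 < t" "t < h" and eq: "L (f (h *\<^sub>R \<phi>))
        = (\<Sum>m<k. (diff m 0 / fact m) * h ^ m) + (diff k t / fact k) * h ^ k"
        using mac[OF h] by blast
      have "(\<Sum>m<k. (diff m 0 / fact m) * h ^ m) = 0" using coeff by (intro sum.neutral) auto
      then have "\<bar>L (f (h *\<^sub>R \<phi>))\<bar> \<le> B * h ^ k" using eq rem[OF t h(2)] by simp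
      moreover have "\<bar>L (f (h *\<^sub>R \<phi>)) - a * h ^ k\<bar> \<le> C * h ^ Suc k"
        using h by (intro exp) (auto simp: h\<^sub>0_def)
      moreover have "C * h ^ Suc k \<le> \<bar>C\<bar> * h ^ Suc k" using h by (intro mult_right_mono) auto
      ultimately have "\<bar>a * h ^ k\<bar> \<le> B * h ^ k + \<bar>C\<bar> * h ^ Suc k" by linarith
      then have "\<bar>a\<bar> * h ^ k \<le> (B + \<bar>C\<bar> * h) * h ^ k" using h by (simp add: abs_mult algebra_simps)
      then show ?thesis using h by simp
    qed
    have ev: "\<forall>\<^sub>F h in at_right 0. 0 < h \<and> h < h\<^sub>0"
      using h\<^sub>0 by (auto simp: eventually_at_right_field)
    have "((\<lambda>h. B + \<bar>C\<bar> * h) \<longlongrightarrow> B + \<bar>C\<bar> * 0) (at_right 0)"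
      by (intro tendsto_intros)
    then have "\<bar>a\<bar> \<le> B + \<bar>C\<bar> * 0"
      by (rule tendsto_lowerbound) (use ev in \<open>eventually_elim, use bound in auto\<close>)
    then show "\<bar>a\<bar> \<le> N * M * norm \<phi> ^ k" by (simp add: B_def)
  qed
qed

section \<open>Continuous functions in $L^2$\<close>

lemma torus_measure_integral:
  fixes f :: "real ^ 'd \<Rightarrow> real"
  assumes "continuous_on UNIV f"
  shows "(LINT x|torus_measure. f x) = torus_integral f"
proof -
  have "set_integrable lborel (cbox 0 (\<chi> i. 2 * pi)) f"
    unfolding set_integrable_def
    by (rule borel_integrable_compact[OF compact_cbox continuous_on_subset[OF assms]]) auto
  from set_borel_integral_eq_integral(2)[OF this] show ?thesis
    unfolding torus_measure_def set_lebesgue_integral_def by (subst integral_restrict_space) auto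
qed

lemma norm_abs_torus_L2_continuous:
  assumes "torus_periodic f" "continuous_on UNIV f"
  shows "norm (abs_torus_L2 f) = sqrt (torus_integral (\<lambda>x. (norm (f x))\<^sup>2))"
  by (subst norm_abs_torus_L2[OF continuous_imp_torus_square_integrable[OF assms]])
    (simp add: torus_measure_integral continuous_on_power continuous_on_norm assms)

lemma inner_abs_torus_L2_continuous:
  assumes "torus_periodic f" "continuous_on UNIV f" "torus_periodic g" "continuous_on UNIV g"
  shows "abs_torus_L2 f \<bullet> abs_torus_L2 g = torus_integral (\<lambda>x. f x \<bullet> g x)"
proof -
  have "torus_ae_eq f f" "torus_ae_eq g g"
    using assms by (simp_all add: torus_ae_eq_def continuous_imp_torus_square_integrable)
  then show ?thesis
    by (simp add: inner_torus_L2.abs_eq torus_measure_integral continuous_on_inner assms)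
qed

lemma scaleR_abs_torus_L2:
  assumes "torus_square_integrable f"
  shows "c *\<^sub>R abs_torus_L2 f = abs_torus_L2 (\<lambda>x. of_real c * f x)"
  using assms by (subst scaleR_torus_L2.abs_eq) (simp_all add: torus_ae_eq_def scaleR_conv_of_real)

section \<open>Counting solutions of $xy = zw$\<close>

lemma sum_inverse_squares_le: "(\<Sum>k=1..M. 1 / (real k)\<^sup>2) \<le> 2"
proof (cases "M = 0")
  case False
  have "(\<Sum>k=1..Suc n. 1 / (real k)\<^sup>2) \<le> 2 - 1 / real (Suc n)" for n
  proof (induction n)
    case (Suc n)
    have "1 / (real (Suc (Suc n)))\<^sup>2 \<le> 1 / (real (Suc n) * real (Suc (Suc n)))"
      unfolding power2_eq_square by (intro divide_left_mono mult_mono) auto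
    also have "\<dots> = 1 / real (Suc n) - 1 / real (Suc (Suc n))"
      by (simp add: field_simps)
    finally show ?case using Suc by simp
  qed simp
  from this[of "M - 1"] False have "(\<Sum>k=1..M. 1 / (real k)\<^sup>2) \<le> 2 - 1 / real M" by simp
  also have "\<dots> \<le> 2" by simp
  finally show ?thesis .
qed simp

text \<open>
  Multiply the right-hand side by $\sum_k k^{-2} \le 2$ and collect the terms with $mk = n$: since
  $\sum_{m \mid n} \varphi(m) = n$, they add up to at least $n / n^2$.
\<close>

lemma harm_le_totient_sum: "harm M / 2 \<le> (\<Sum>m=1..M. real (totient m) / (real m)\<^sup>2)"
proof -
  let ?g = "\<lambda>(m, k). (real (totient m) / (real m)\<^sup>2) * (1 / (real k)\<^sup>2)"
  have "harm M = (\<Sum>n=1..M. \<Sum>m | m dvd n. real (totient m) / (real n)\<^sup>2)"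
  proof -
    have "(\<Sum>m | m dvd n. real (totient m) / (real n)\<^sup>2) = inverse (real n)" if "n \<in> {1..M}" for n
    proof -
      have "(\<Sum>m | m dvd n. real (totient m) / (real n)\<^sup>2) = real (\<Sum>m | m dvd n. totient m) / (real n)\<^sup>2"
        by (simp add: sum_divide_distrib)
      then show ?thesis using that by (simp add: totient_divisor_sum power2_eq_square field_simps)
    qed
    then show ?thesis by (simp add: harm_def)
  qed
  also have "\<dots> = (\<Sum>(n, m)\<in>Sigma {1..M} (\<lambda>n. {m. m dvd n}). real (totient m) / (real n)\<^sup>2)"
    by (rule sum.Sigma) auto
  also have "\<dots> = (\<Sum>(n, m)\<in>Sigma {1..M} (\<lambda>n. {m. m dvd n}). ?g (m, n div m))"
  proof (rule sum.cong[OF refl], clarify)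
    fix n m :: nat assume "n \<in> {1..M}" "m dvd n"
    then obtain k where "n = m * k" "m > 0" "k > 0" by (auto elim!: dvdE)
    then show "real (totient m) / (real n)\<^sup>2 = real (totient m) / (real m)\<^sup>2 * (1 / (real (n div m))\<^sup>2)"
      by (simp add: power_mult_distrib)
  qed
  also have "\<dots> = sum ?g ((\<lambda>(n, m). (m, n div m)) ` Sigma {1..M} (\<lambda>n. {m. m dvd n}))"
  proof (subst sum.reindex)
    show "inj_on (\<lambda>(n, m). (m, n div m)) (Sigma {1..M} (\<lambda>n. {m. m dvd n}))"
      by (auto simp: inj_on_def dvd_div_eq_iff)
  qed (auto simp: o_def intro!: sum.cong)
  also have "\<dots> \<le> sum ?g ({1..M} \<times> {1..M})"
  proof (rule sum_mono2)
    show "(\<lambda>(n, m). (m, n div m)) ` Sigma {1..M} (\<lambda>n. {m. m dvd n}) \<subseteq> {1..M} \<times> {1..M}"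
    proof clarify
      fix n m :: nat assume "n \<in> {1..M}" "m dvd n"
      then obtain k where k: "n = m * k" "m > 0" "k > 0" by (auto elim!: dvdE)
      then have "m \<le> n" "k \<le> n" by auto
      then have "m \<le> M" "k \<le> M" using \<open>n \<in> {1..M}\<close> by auto
      then show "m \<in> {1..M} \<and> n div m \<in> {1..M}" using k by auto
    qed
  qed auto
  also have "\<dots> = (\<Sum>m=1..M. real (totient m) / (real m)\<^sup>2) * (\<Sum>k=1..M. 1 / (real k)\<^sup>2)"
    by (simp add: sum_product sum.cartesian_product split_def)
  also have "\<dots> \<le> (\<Sum>m=1..M. real (totient m) / (real m)\<^sup>2) * 2"
    by (intro mult_left_mono sum_inverse_squares_le sum_nonneg) auto
  finally show ?thesis by simp
qed

definition equal_products :: "nat \<Rightarrow> (nat \<times> nat \<times> nat \<times> nat) set" where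
  "equal_products M = {(x, y, z, w). {x, y, z, w} \<subseteq> {1..M} \<and> x * y = z * w}"

lemma finite_equal_products: "finite (equal_products M)"
  by (rule finite_subset[of _ "{1..M} \<times> {1..M} \<times> {1..M} \<times> {1..M}"]) (auto simp: equal_products_def)

text \<open>
  Solutions are $(gm, hp, gp, hm)$ with $p \le m$ coprime to $m$ and $g, h \le M/m$; the fraction
  $x/z = m/p$ in lowest terms recovers the parameters.  Each $m$ contributes
  $\varphi(m) \lfloor M/m \rfloor^2 \ge \varphi(m) (M/2m)^2$.
\<close>

lemma card_equal_products_ge: "(real M)\<^sup>2 * harm M / 8 \<le> real (card (equal_products M))"
proof -
  let ?A = "Sigma {1..M} (\<lambda>m. totatives m \<times> ({1..M div m} \<times> {1..M div m}))"
  let ?f = "\<lambda>(m::nat, p::nat, g::nat, h::nat). (g * m, h * p, g * p, h * m)"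
  have inj: "inj_on ?f ?A"
  proof (rule inj_onI)
    fix a b assume *: "a \<in> ?A" "b \<in> ?A" "?f a = ?f b"
    obtain m p g h where a: "a = (m, p, g, h)" by (cases a)
    obtain m' p' g' h' where b: "b = (m', p', g', h')" by (cases b)
    have eq: "g * m = g' * m'" "g * p = g' * p'" "h * m = h' * m'" and pos: "0 < g" "0 < m"
      and cop: "coprime m p" "coprime m' p'"
      using * by (auto simp: a b totatives_def coprime_commute)
    have "g = gcd (g * m) (g * p)" "g' = gcd (g' * m') (g' * p')"
      using cop by (simp_all add: gcd_mult_distrib_nat[symmetric])
    then have "g = g'" using eq by simp
    then show "a = b" using eq pos by (auto simp: a b)
  qed
  have "?f ` ?A \<subseteq> equal_products M"
  proof clarify
    fix m p g h :: nat
    assume *: "m \<in> {1..M}" "p \<in> totatives m" "g \<in> {1..M div m}" "h \<in> {1..M div m}"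
    have p: "0 < p" "p \<le> m" using *(2) by (auto simp: totatives_def)
    have le: "k * q \<le> M" if "k \<le> M div m" "q \<le> m" for k q
    proof -
      have "k * q \<le> (M div m) * m" using that by (intro mult_le_mono) auto
      also have "\<dots> \<le> M" by simp
      finally show ?thesis .
    qed
    show "(g * m, h * p, g * p, h * m) \<in> equal_products M"
      using * p le[of g m] le[of h p] le[of g p] le[of h m] by (auto simp: equal_products_def)
  qed
  then have "real (card ?A) \<le> real (card (equal_products M))"
    unfolding of_nat_le_iff using card_inj_on_le[OF inj _ finite_equal_products] by blast
  moreover have "real (card ?A) = (\<Sum>m=1..M. real (totient m) * (real (M div m))\<^sup>2)"
    by (subst card_SigmaI) (auto simp: totient_def card_cartesian_product power2_eq_square)
  moreover have "(\<Sum>m=1..M. real (totient m) * (real (M div m))\<^sup>2)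
      \<ge> (\<Sum>m=1..M. real (totient m) * (real M / (2 * real m))\<^sup>2)"
  proof (intro sum_mono mult_left_mono power_mono)
    fix m assume m: "m \<in> {1..M}"
    then have "1 \<le> M div m" by (simp add: Suc_le_eq div_greater_zero_iff)
    moreover have "M < m * (M div m) + m" using m by (metis add.commute atLeastAtMost_iff dividend_less_div_times mult.commute less_le_trans zero_less_one)
    ultimately have "M \<le> 2 * (m * (M div m))"
      using mult_le_mono2[of 1 "M div m" m] by linarith
    then have "real M \<le> 2 * (real m * real (M div m))" by (metis of_nat_le_iff of_nat_mult of_nat_numeral)
    then show "real M / (2 * real m) \<le> real (M div m)" using m by (simp add: field_simps)
  qed auto
  moreover have "(\<Sum>m=1..M. real (totient m) * (real M / (2 * real m))\<^sup>2)
      = (real M)\<^sup>2 / 4 * (\<Sum>m=1..M. real (totient m) / (real m)\<^sup>2)"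
    by (simp add: sum_distrib_left power_divide power_mult_distrib mult.commute)
  moreover have "(real M)\<^sup>2 / 4 * (harm M / 2) \<le> (real M)\<^sup>2 / 4 * (\<Sum>m=1..M. real (totient m) / (real m)\<^sup>2)"
    by (intro mult_left_mono harm_le_totient_sum) auto
  ultimately show ?thesis by linarith
qed

section \<open>Orthogonality\<close>

lemma lattice_point_diff: "lattice_point m \<Longrightarrow> lattice_point n \<Longrightarrow> lattice_point (m - n)"
  by (simp add: lattice_point_def)

lemma lattice_point_add: "lattice_point m \<Longrightarrow> lattice_point n \<Longrightarrow> lattice_point (m + n)"
  by (simp add: lattice_point_def)

lemma lattice_point_inner: "lattice_point m \<Longrightarrow> lattice_point n \<Longrightarrow> m \<bullet> n \<in> \<int>"
  by (auto simp: lattice_point_def inner_vec_def)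

text \<open>
  For $n_j \neq 0$ the character is a partial derivative in direction $e_j$ up to a factor.
\<close>

lemma torus_integral_cis:
  fixes n :: "real ^ 'd"
  assumes "lattice_point n"
  shows "torus_integral (\<lambda>x. cis (n \<bullet> x)) = (if n = 0 then (2 * pi) ^ CARD('d) else 0)"
proof (cases "n = 0")
  case True
  then show ?thesis by (simp add: content_torus_cell scaleR_conv_of_real)
next
  case False
  then obtain j where j: "n $ j \<noteq> 0" by (auto simp: vec_eq_iff)
  have "torus_integral (\<lambda>x. (\<i> * of_real (n $ j)) * cis (n \<bullet> x)) = 0"
  proof (rule torus_integral_partial_eq_0)
    show "torus_periodic (\<lambda>x. cis (n \<bullet> x))"
      using cis_periodic assms by (simp add: torus_periodic_def lattice_point_def inner_add_right inner_axis mult.commute)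
    show "has_partial j (\<lambda>x. cis (n \<bullet> x)) (\<lambda>x. (\<i> * of_real (n $ j)) * cis (n \<bullet> x))"
      unfolding has_partial_def
    proof
      fix x
      have "((\<lambda>s. n \<bullet> (x + s *\<^sub>R axis j 1)) has_real_derivative n $ j) (at 0)"
        by (auto intro!: derivative_eq_intros simp: inner_add_right inner_axis)
      from has_vector_derivative_cis[OF this, of 1]
      show "((\<lambda>s. cis (n \<bullet> (x + s *\<^sub>R axis j 1))) has_vector_derivative
          (\<i> * of_real (n $ j)) * cis (n \<bullet> x)) (at 0)"
        by simp
    qed
  qed (intro continuous_intros)+
  then show ?thesis using j False by simp
qed

lemma integral_cis:
  assumes "k \<in> \<int>"
  shows "integral {0..2 * pi} (\<lambda>t. cis (k * t)) = (if k = 0 then 2 * pi else 0)"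
proof (cases "k = 0")
  case True
  then show ?thesis by (simp add: scaleR_conv_of_real)
next
  case False
  have "((\<lambda>t. (1 / (\<i> * of_real k) * (\<i> * of_real k)) * cis (k * t)) has_integral
      (1 / (\<i> * of_real k)) * cis (k * (2 * pi)) - (1 / (\<i> * of_real k)) * cis (k * 0)) {0..2 * pi}"
    by (intro fundamental_theorem_of_calculus has_vector_derivative_cis)
      (auto intro!: derivative_eq_intros)
  then show ?thesis
    using False cis_periodic[OF assms, of 0] by (simp add: integral_unique)
qed

lemma integral_norm_sq_cis_sum:
  fixes \<xi> :: "'k \<Rightarrow> real ^ 'd" and \<tau> :: "'k \<Rightarrow> real"
  assumes A: "finite A" and \<xi>: "\<And>a. a \<in> A \<Longrightarrow> lattice_point (\<xi> a)"
  shows "torus_integral (\<lambda>x. (norm (\<Sum>a\<in>A. cis (\<xi> a \<bullet> x - \<tau> a * t)))\<^sup>2)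
    = (2 * pi) ^ CARD('d) * Re (\<Sum>(a, b)\<in>{(a, b)\<in>A \<times> A. \<xi> a = \<xi> b}. cis ((\<tau> b - \<tau> a) * t))"
proof -
  have "of_real ((norm (\<Sum>a\<in>A. cis (\<xi> a \<bullet> x - \<tau> a * t)))\<^sup>2)
      = (\<Sum>(a, b)\<in>A \<times> A. cis ((\<tau> b - \<tau> a) * t) * cis ((\<xi> a - \<xi> b) \<bullet> x))" for x
    unfolding complex_norm_square cnj_sum sum_product sum.cartesian_product split_def cis_cnj cis_mult
    by (intro sum.cong refl arg_cong[where f = cis]) (simp add: algebra_simps inner_diff_left)
  then have "of_real (torus_integral (\<lambda>x. (norm (\<Sum>a\<in>A. cis (\<xi> a \<bullet> x - \<tau> a * t)))\<^sup>2))
      = torus_integral (\<lambda>x. \<Sum>(a, b)\<in>A \<times> A. cis ((\<tau> b - \<tau> a) * t) * cis ((\<xi> a - \<xi> b) \<bullet> x))"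
    by (subst torus_integral_of_real[symmetric]) (intro continuous_intros, simp only:)
  also have "\<dots> = (\<Sum>(a, b)\<in>A \<times> A. cis ((\<tau> b - \<tau> a) * t) * torus_integral (\<lambda>x. cis ((\<xi> a - \<xi> b) \<bullet> x)))"
    unfolding split_def
    by (subst integral_sum) (auto intro!: A integrable_torus_cell continuous_intros)
  also have "\<dots> = (\<Sum>(a, b)\<in>A \<times> A. if \<xi> a = \<xi> b then (2 * pi) ^ CARD('d) * cis ((\<tau> b - \<tau> a) * t) else 0)"
    by (intro sum.cong refl) (auto simp: torus_integral_cis lattice_point_diff \<xi>)
  also have "\<dots> = (\<Sum>(a, b)\<in>{(a, b)\<in>A \<times> A. \<xi> a = \<xi> b}. (2 * pi) ^ CARD('d) * cis ((\<tau> b - \<tau> a) * t))"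
    by (rule sum.mono_neutral_cong_right) (use A in \<open>auto split: if_splits\<close>)
  also have "\<dots> = of_real ((2 * pi) ^ CARD('d)) * (\<Sum>(a, b)\<in>{(a, b)\<in>A \<times> A. \<xi> a = \<xi> b}. cis ((\<tau> b - \<tau> a) * t))"
    by (simp add: sum_distrib_left split_def)
  finally have "Re (of_real (torus_integral (\<lambda>x. (norm (\<Sum>a\<in>A. cis (\<xi> a \<bullet> x - \<tau> a * t)))\<^sup>2)))
      = Re (of_real ((2 * pi) ^ CARD('d)) * (\<Sum>(a, b)\<in>{(a, b)\<in>A \<times> A. \<xi> a = \<xi> b}. cis ((\<tau> b - \<tau> a) * t)))"
    by (rule arg_cong)
  then show ?thesis by (simp only: Re_complex_of_real Re_complex_of_real times_complex.sel Im_complex_of_real mult_zero_left diff_zero)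
qed

text \<open>
  Parseval in space-time: expanding the square, only the pairs with equal space and time frequencies survive.
\<close>

lemma integral_norm_sq_cis_sum_spacetime:
  fixes \<xi> :: "'k \<Rightarrow> real ^ 'd" and \<tau> :: "'k \<Rightarrow> real"
  assumes A: "finite A" and \<xi>: "\<And>a. a \<in> A \<Longrightarrow> lattice_point (\<xi> a)" and \<tau>: "\<And>a. a \<in> A \<Longrightarrow> \<tau> a \<in> \<int>"
  shows "integral {0..2 * pi} (\<lambda>t. torus_integral (\<lambda>x. (norm (\<Sum>a\<in>A. cis (\<xi> a \<bullet> x - \<tau> a * t)))\<^sup>2))
    = (2 * pi) ^ (CARD('d) + 1) * real (card {(a, b)\<in>A \<times> A. \<xi> a = \<xi> b \<and> \<tau> a = \<tau> b})"
proof -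
  let ?B = "{(a, b)\<in>A \<times> A. \<xi> a = \<xi> b}"
  have B: "finite ?B" by (rule finite_subset[of _ "A \<times> A"]) (use A in auto)
  have "(\<lambda>t. \<Sum>(a, b)\<in>?B. cis ((\<tau> b - \<tau> a) * t)) integrable_on {0..2 * pi}"
    unfolding split_def by (intro integrable_continuous_real continuous_intros)
  from integral_linear[OF this bounded_linear_Re]
  have "integral {0..2 * pi} (\<lambda>t. Re (\<Sum>(a, b)\<in>?B. cis ((\<tau> b - \<tau> a) * t)))
      = Re (integral {0..2 * pi} (\<lambda>t. \<Sum>(a, b)\<in>?B. cis ((\<tau> b - \<tau> a) * t)))"
    by (simp only: o_def)
  also have "integral {0..2 * pi} (\<lambda>t. \<Sum>(a, b)\<in>?B. cis ((\<tau> b - \<tau> a) * t))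
      = (\<Sum>(a, b)\<in>?B. integral {0..2 * pi} (\<lambda>t. cis ((\<tau> b - \<tau> a) * t)))"
    unfolding split_def
    by (rule integral_sum) (auto intro!: finite_subset[OF _ finite_cartesian_product[OF A A]]
        integrable_continuous_real continuous_intros)
  also have "\<dots> = (\<Sum>(a, b)\<in>?B. if \<tau> a = \<tau> b then complex_of_real (2 * pi) else 0)"
    by (intro sum.cong refl) (auto simp: integral_cis \<tau>)
  also have "\<dots> = (\<Sum>(a, b)\<in>{(a, b)\<in>A \<times> A. \<xi> a = \<xi> b \<and> \<tau> a = \<tau> b}. complex_of_real (2 * pi))"
    by (rule sum.mono_neutral_cong_right[OF B]) (auto split: if_splits)
  finally show ?thesis
    by (simp add: integral_norm_sq_cis_sum[OF A \<xi>])
qed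

lemma wave_mass:
  fixes E :: "(real ^ 'd) set"
  assumes E: "finite E" "\<And>n. n \<in> E \<Longrightarrow> lattice_point n"
  shows "torus_integral (\<lambda>x. (norm (wave E t x))\<^sup>2) = (2 * pi) ^ CARD('d) * real (card E)"
proof -
  have "{(a, b)\<in>E \<times> E. a = b} = (\<lambda>a. (a, a)) ` E" by auto
  then have "(\<Sum>(a, b)\<in>{(a, b)\<in>E \<times> E. a = b}. cis ((b \<bullet> b - a \<bullet> a) * t)) = of_nat (card E)"
    by (simp add: sum.reindex inj_on_def)
  then show ?thesis
    unfolding wave_def using integral_norm_sq_cis_sum[of E "\<lambda>n. n" "\<lambda>n. n \<bullet> n" t] E by simp
qed

section \<open>Failure of the scale-invariant Strichartz estimate\<close>

text \<open>
  The fourth power of the modulus is the squared modulus of $v^2$, a trigonometric sum over $E \times E$.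
\<close>

lemma wave_fourth_power_integral:
  fixes E :: "(real ^ 'd) set"
  assumes E: "finite E" "\<And>n. n \<in> E \<Longrightarrow> lattice_point n"
  shows "integral {0..2 * pi} (\<lambda>t. torus_integral (\<lambda>x. norm (wave E t x) ^ 4))
    = (2 * pi) ^ (CARD('d) + 1) * real (card {((a, b), (a', b')) \<in> (E \<times> E) \<times> (E \<times> E).
        a + b = a' + b' \<and> a \<bullet> a + b \<bullet> b = a' \<bullet> a' + b' \<bullet> b'})"
proof -
  let ?xi = "\<lambda>(a, b). a + b :: real ^ 'd" and ?tau = "\<lambda>(a, b). a \<bullet> a + b \<bullet> b :: real"
  have sq: "(wave E t x)\<^sup>2 = (\<Sum>p\<in>E \<times> E. cis (?xi p \<bullet> x - ?tau p * t))" for t x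
    unfolding wave_def power2_eq_square sum_product sum.cartesian_product cis_mult
    by (intro sum.cong refl) (auto simp: algebra_simps inner_add_left)
  have "norm (wave E t x) ^ 4 = (norm (\<Sum>p\<in>E \<times> E. cis (?xi p \<bullet> x - ?tau p * t)))\<^sup>2" for t x
    unfolding sq[symmetric] norm_power by (simp flip: power_mult)
  moreover have "integral {0..2 * pi} (\<lambda>t. torus_integral (\<lambda>x.
        (norm (\<Sum>p\<in>E \<times> E. cis (?xi p \<bullet> x - ?tau p * t)))\<^sup>2))
    = (2 * pi) ^ (CARD('d) + 1) * real (card {(p, p') \<in> (E \<times> E) \<times> (E \<times> E). ?xi p = ?xi p' \<and> ?tau p = ?tau p'})"
    by (rule integral_norm_sq_cis_sum_spacetime)
      (use E in \<open>auto intro!: lattice_point_add Ints_add lattice_point_inner\<close>)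
  ultimately show ?thesis by (simp add: split_def mem_Times_iff)
qed

lemma wave_sixth_power_integral:
  fixes E :: "(real ^ 'd) set"
  assumes E: "finite E" "\<And>n. n \<in> E \<Longrightarrow> lattice_point n"
  shows "integral {0..2 * pi} (\<lambda>t. torus_integral (\<lambda>x. norm (wave E t x) ^ 6))
    = (2 * pi) ^ (CARD('d) + 1) * real (card {((a, b, c), (a', b', c')) \<in> (E \<times> E \<times> E) \<times> (E \<times> E \<times> E).
        a + b + c = a' + b' + c' \<and> a \<bullet> a + b \<bullet> b + c \<bullet> c = a' \<bullet> a' + b' \<bullet> b' + c' \<bullet> c'})"
proof -
  let ?xi = "\<lambda>(a, b, c). a + b + c :: real ^ 'd" and ?tau = "\<lambda>(a, b, c). a \<bullet> a + b \<bullet> b + c \<bullet> c :: real"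
  have sq: "wave E t x * wave E t x
      = (\<Sum>(b, c)\<in>E \<times> E. cis ((b + c) \<bullet> x - (b \<bullet> b + c \<bullet> c) * t))" for t x
    unfolding wave_def sum_product sum.cartesian_product cis_mult
    by (intro sum.cong refl) (auto simp: algebra_simps inner_add_left)
  have cube: "(wave E t x) ^ 3 = (\<Sum>p\<in>E \<times> E \<times> E. cis (?xi p \<bullet> x - ?tau p * t))" for t x
  proof -
    have "wave E t x ^ 3 = wave E t x * (wave E t x * wave E t x)" by (simp add: power3_eq_cube)
    also have "\<dots> = (\<Sum>p\<in>E \<times> E \<times> E. cis (?xi p \<bullet> x - ?tau p * t))"
      unfolding sq unfolding wave_def sum_product sum.cartesian_product split_def cis_mult
      by (intro sum.cong refl) (auto simp: algebra_simps inner_add_left)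
    finally show ?thesis .
  qed
  have "norm (wave E t x) ^ 6 = (norm (\<Sum>p\<in>E \<times> E \<times> E. cis (?xi p \<bullet> x - ?tau p * t)))\<^sup>2" for t x
    unfolding cube[symmetric] norm_power by (simp flip: power_mult)
  moreover have "integral {0..2 * pi} (\<lambda>t. torus_integral (\<lambda>x.
        (norm (\<Sum>p\<in>E \<times> E \<times> E. cis (?xi p \<bullet> x - ?tau p * t)))\<^sup>2))
    = (2 * pi) ^ (CARD('d) + 1) * real (card {(p, p') \<in> (E \<times> E \<times> E) \<times> (E \<times> E \<times> E).
        ?xi p = ?xi p' \<and> ?tau p = ?tau p'})"
    by (rule integral_norm_sq_cis_sum_spacetime)
      (use E in \<open>auto intro!: lattice_point_add Ints_add lattice_point_inner\<close>)
  ultimately show ?thesis by (simp add: split_def mem_Times_iff)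
qed

text \<open>
  For integers with $xy = zw$ and any $c$, the triples $(c + x, c + y, c + x + y - z - w)$ and
  $(c, c + x + y - z, c + x + y - w)$ have the same sum and the same sum of squares.
\<close>

lemma wave_lower_bound_dim1:
  assumes d: "CARD('d) = 1" and M: "1 \<le> M"
  obtains E :: "(real ^ 'd) set" where "finite E" "\<And>n. n \<in> E \<Longrightarrow> lattice_point n" "card E \<le> 9 * M"
    "(2 * pi)\<^sup>2 * (real M ^ 3 * harm M / 8)
      \<le> integral {0..2 * pi} (\<lambda>t. torus_integral (\<lambda>x. norm (wave E t x) ^ 6))"
proof -
  obtain j :: 'd where j: "(UNIV :: 'd set) = {j}" using d by (auto simp: card_1_singleton_iff)
  define V :: "int \<Rightarrow> real ^ 'd" where "V k = axis j (of_int k)" for k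
  have V_add: "V a + V b = V (a + b)" for a b by (simp add: V_def vec_eq_iff axis_def)
  have V_inner: "V a \<bullet> V b = of_int (a * b)" for a b by (simp add: V_def inner_axis_axis)
  have V_eq: "V a = V b \<longleftrightarrow> a = b" for a b by (auto simp: V_def axis_eq_axis)
  \<comment> \<open>Large enough to contain all coordinates that occur, which lie between $-2M$ and $3M$.\<close>
  define R where "R = {- 4 * int M..4 * int M}"
  define E where "E = V ` R"
  have E: "finite E" "\<And>n. n \<in> E \<Longrightarrow> lattice_point n"
    by (auto simp: E_def R_def V_def lattice_point_def axis_def)
  have "card E = card R" unfolding E_def by (rule card_image) (simp add: inj_on_def V_eq)
  then have card: "card E \<le> 9 * M" using M by (simp add: R_def)
  let ?Q = "{((a, b, c), (a', b', c')) \<in> (E \<times> E \<times> E) \<times> (E \<times> E \<times> E).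
        a + b + c = a' + b' + c' \<and> a \<bullet> a + b \<bullet> b + c \<bullet> c = a' \<bullet> a' + b' \<bullet> b' + c' \<bullet> c'}"
  define f where "f = (\<lambda>(c::nat, x::nat, y::nat, z::nat, w::nat).
    ((V (int c + int x), V (int c + int y), V (int c + int x + int y - int z - int w)),
     (V (int c), V (int c + int x + int y - int z), V (int c + int x + int y - int w))))"
  have fin: "finite ?Q"
    by (rule finite_subset[of _ "(E \<times> E \<times> E) \<times> (E \<times> E \<times> E)"]) (use E in auto)
  have inj: "inj_on f ({1..M} \<times> equal_products M)"
    by (auto simp: inj_on_def f_def V_eq)
  have sub: "f ` ({1..M} \<times> equal_products M) \<subseteq> ?Q"
  proof (rule image_subsetI)
    fix p assume "p \<in> {1..M} \<times> equal_products M"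
    then obtain c x y z w where p: "p = (c, x, y, z, w)" and c: "c \<in> {1..M}"
      and "(x, y, z, w) \<in> equal_products M"
      by auto
    then have xyzw: "{x, y, z, w} \<subseteq> {1..M}" and "x * y = z * w" by (auto simp: equal_products_def)
    then have "int x * int y = int z * int w" by (metis of_nat_mult)
    then have "(int c + int x) * (int c + int x) + (int c + int y) * (int c + int y)
        + (int c + int x + int y - int z - int w) * (int c + int x + int y - int z - int w)
      = int c * int c + (int c + int x + int y - int z) * (int c + int x + int y - int z)
        + (int c + int x + int y - int w) * (int c + int x + int y - int w)"
      by algebra
    then show "f p \<in> ?Q"
      using c xyzw unfolding p f_def E_def R_def
      by (simp only: split mem_Collect_eq V_add V_inner of_int_add[symmetric] V_eq of_int_eq_iff) auto
  qed
  have "real M * ((real M)\<^sup>2 * harm M / 8) \<le> real M * real (card (equal_products M))"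
    by (intro mult_left_mono card_equal_products_ge) auto
  also have "\<dots> = real (card ({1..M} \<times> equal_products M))" by (simp add: card_cartesian_product)
  also have "\<dots> \<le> real (card ?Q)"
    unfolding of_nat_le_iff by (rule card_inj_on_le[OF inj sub fin])
  finally have "(2 * pi)\<^sup>2 * (real M ^ 3 * harm M / 8) \<le> (2 * pi)\<^sup>2 * real (card ?Q)"
    by (intro mult_left_mono) (simp_all add: power2_eq_square power3_eq_cube mult.assoc)
  also have "\<dots> = integral {0..2 * pi} (\<lambda>t. torus_integral (\<lambda>x. norm (wave E t x) ^ 6))"
    by (subst wave_sixth_power_integral[OF E]) (simp_all only: d one_add_one)
  finally show thesis by (intro that[OF E card])
qed

text \<open>
  The coincidences are rectangles: for $a = (x, z)$ and $b = (y, -w)$ one has $a \cdot b = xy - zw = 0$, so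
  that $\{n + a + b, n\}$ and $\{n + b, n + a\}$ are the diagonals of a rectangle.
\<close>

lemma wave_lower_bound_dim2:
  assumes d: "CARD('d) = 2" and M: "1 \<le> M"
  obtains E :: "(real ^ 'd) set" where "finite E" "\<And>n. n \<in> E \<Longrightarrow> lattice_point n" "card E \<le> (9 * M)\<^sup>2"
    "(2 * pi) ^ 3 * (real M ^ 4 * harm M / 8)
      \<le> integral {0..2 * pi} (\<lambda>t. torus_integral (\<lambda>x. norm (wave E t x) ^ 4))"
proof -
  obtain i j :: 'd where ij: "(UNIV :: 'd set) = {i, j}" "i \<noteq> j" using d by (auto simp: card_2_iff)
  define V :: "int \<Rightarrow> int \<Rightarrow> real ^ 'd" where "V a b = axis i (of_int a) + axis j (of_int b)" for a b
  have V_add: "V a b + V a' b' = V (a + a') (b + b')" for a b a' b'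
    by (simp add: V_def vec_eq_iff axis_def)
  have V_inner: "V a b \<bullet> V a' b' = of_int (a * a' + b * b')" for a b a' b'
    using ij by (simp add: V_def inner_add_left inner_add_right inner_axis_axis)
  have V_eq: "V a b = V a' b' \<longleftrightarrow> a = a' \<and> b = b'" for a b a' b'
  proof
    assume eq: "V a b = V a' b'"
    have "V a b $ i = of_int a" "V a b $ j = of_int b" "V a' b' $ i = of_int a'" "V a' b' $ j = of_int b'"
      using ij(2) by (auto simp: V_def axis_def)
    then show "a = a' \<and> b = b'" using eq by simp
  qed simp
  \<comment> \<open>Large enough to contain all coordinates that occur, which lie between $-2M$ and $3M$.\<close>
  define R where "R = {- 4 * int M..4 * int M}"
  define E where "E = (\<lambda>(a, b). V a b) ` (R \<times> R)"
  have E: "finite E" "\<And>n. n \<in> E \<Longrightarrow> lattice_point n"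
    by (auto simp: E_def R_def V_def lattice_point_def axis_def)
  have "card E = card (R \<times> R)" unfolding E_def by (rule card_image) (auto simp: inj_on_def V_eq)
  also have "\<dots> = card R * card R" by (rule card_cartesian_product)
  also have "\<dots> \<le> (9 * M) * (9 * M)" using M by (intro mult_mono) (auto simp: R_def)
  finally have card: "card E \<le> (9 * M)\<^sup>2" by (simp add: power2_eq_square)
  have V_E: "V a b \<in> E \<longleftrightarrow> a \<in> R \<and> b \<in> R" for a b by (auto simp: E_def V_eq)
  let ?Q = "{((a, b), (a', b')) \<in> (E \<times> E) \<times> (E \<times> E).
        a + b = a' + b' \<and> a \<bullet> a + b \<bullet> b = a' \<bullet> a' + b' \<bullet> b'}"
  define f where "f = (\<lambda>((m::nat, n::nat), x::nat, y::nat, z::nat, w::nat).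
    ((V (int m + int x + int y) (int n + int z - int w), V (int m) (int n)),
     (V (int m + int y) (int n - int w), V (int m + int x) (int n + int z))))"
  have fin: "finite ?Q"
    by (rule finite_subset[of _ "(E \<times> E) \<times> (E \<times> E)"]) (use E in auto)
  have inj: "inj_on f (({1..M} \<times> {1..M}) \<times> equal_products M)"
    by (auto simp: inj_on_def f_def V_eq)
  have sub: "f ` (({1..M} \<times> {1..M}) \<times> equal_products M) \<subseteq> ?Q"
  proof (rule image_subsetI)
    fix p assume "p \<in> ({1..M} \<times> {1..M}) \<times> equal_products M"
    then obtain m n x y z w where p: "p = ((m, n), x, y, z, w)" and mn: "m \<in> {1..M}" "n \<in> {1..M}"
      and "(x, y, z, w) \<in> equal_products M"
      by auto
    then have xyzw: "{x, y, z, w} \<subseteq> {1..M}" and "x * y = z * w" by (auto simp: equal_products_def)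
    then have "int x * int y = int z * int w" by (metis of_nat_mult)
    then have "(int m + int x + int y) * (int m + int x + int y)
        + (int n + int z - int w) * (int n + int z - int w) + (int m * int m + int n * int n)
      = (int m + int y) * (int m + int y) + (int n - int w) * (int n - int w)
        + ((int m + int x) * (int m + int x) + (int n + int z) * (int n + int z))"
      by algebra
    then show "f p \<in> ?Q"
      using mn xyzw unfolding p f_def
      by (simp only: split mem_Collect_eq V_add V_inner of_int_add[symmetric] V_eq of_int_eq_iff mem_Times_iff
          fst_conv snd_conv V_E R_def) auto
  qed
  have "(real M * real M) * ((real M)\<^sup>2 * harm M / 8) \<le> (real M * real M) * real (card (equal_products M))"
    by (intro mult_left_mono card_equal_products_ge) auto
  also have "\<dots> = real (card (({1..M} \<times> {1..M}) \<times> equal_products M))" by (simp add: card_cartesian_product)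
  also have "\<dots> \<le> real (card ?Q)"
    unfolding of_nat_le_iff by (rule card_inj_on_le[OF inj sub fin])
  finally have "(2 * pi) ^ 3 * (real M ^ 4 * harm M / 8) \<le> (2 * pi) ^ 3 * real (card ?Q)"
    by (intro mult_left_mono) (simp_all add: power2_eq_square power4_eq_xxxx mult.assoc)
  also have "\<dots> = integral {0..2 * pi} (\<lambda>t. torus_integral (\<lambda>x. norm (wave E t x) ^ 4))"
    by (subst wave_fourth_power_integral[OF E]) (simp_all add: d)
  finally show thesis by (intro that[OF E card])
qed

text \<open>
  With $|E| \le (9M)^d$ both sides have the order $M^{d+2}$ in both dimensions, except for the harmonic
  sum on the right.
\<close>

lemma no_periodic_strichartz_estimate:
  assumes d: "CARD('d) \<in> {1, 2}" and e: "e = 4 div CARD('d)"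
  obtains E :: "(real ^ 'd) set" where "finite E" "\<And>n. n \<in> E \<Longrightarrow> lattice_point n"
    "C * ((2 * pi) ^ CARD('d) * real (card E)) ^ (e div 2 + 1)
      < integral {0..2 * pi} (\<lambda>t. torus_integral (\<lambda>x. norm (wave E t x) ^ (e + 2)))"
proof -
  \<comment> \<open>The factor 18 combines $2\pi$ from the volume of the torus with $|E| \le (9M)^d$.\<close>
  define B where "B = 8 * \<bar>C\<bar> * (18 * pi) ^ (CARD('d) + 2)"
  have "eventually (\<lambda>M. B < harm M \<and> 1 \<le> M) sequentially"
    using harm_at_top by (auto simp: filterlim_at_top_dense intro!: eventually_conj eventually_ge_at_top)
  then obtain M where M: "B < harm M" "1 \<le> M"
    using eventually_happens'[OF sequentially_bot] by blast
  have q: "CARD('d) * (e div 2 + 1) = CARD('d) + 2" using d e by auto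
  obtain E :: "(real ^ 'd) set" where E: "finite E" "\<And>n. n \<in> E \<Longrightarrow> lattice_point n"
    and card: "card E \<le> (9 * M) ^ CARD('d)"
    and low: "(2 * pi) ^ (CARD('d) + 1) * (real M ^ (CARD('d) + 2) * harm M / 8)
      \<le> integral {0..2 * pi} (\<lambda>t. torus_integral (\<lambda>x. norm (wave E t x) ^ (e + 2)))"
  proof -
    consider (1) "CARD('d) = 1" | (2) "CARD('d) = 2" using d by auto
    then show thesis
    proof cases
      case 1
      from wave_lower_bound_dim1[OF 1 M(2)] obtain E :: "(real ^ 'd) set" where
        "finite E" "\<And>n. n \<in> E \<Longrightarrow> lattice_point n" "card E \<le> 9 * M"
        "(2 * pi)\<^sup>2 * (real M ^ 3 * harm M / 8)
          \<le> integral {0..2 * pi} (\<lambda>t. torus_integral (\<lambda>x. norm (wave E t x) ^ 6))"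
        by blast
      moreover have "e = 4" using e 1 by simp
      ultimately show thesis by (intro that[of E]) (simp_all add: 1 power2_eq_square power3_eq_cube mult_ac)
    next
      case 2
      from wave_lower_bound_dim2[OF 2 M(2)] obtain E :: "(real ^ 'd) set" where
        "finite E" "\<And>n. n \<in> E \<Longrightarrow> lattice_point n" "card E \<le> (9 * M)\<^sup>2"
        "(2 * pi) ^ 3 * (real M ^ 4 * harm M / 8)
          \<le> integral {0..2 * pi} (\<lambda>t. torus_integral (\<lambda>x. norm (wave E t x) ^ 4))"
        by blast
      moreover have "e = 2" using e 2 by simp
      ultimately show thesis by (intro that[of E]) (simp_all add: 2)
    qed
  qed
  have "C * ((2 * pi) ^ CARD('d) * real (card E)) ^ (e div 2 + 1)
      \<le> \<bar>C\<bar> * ((2 * pi) ^ CARD('d) * (9 * real M) ^ CARD('d)) ^ (e div 2 + 1)"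
  proof (intro mult_mono power_mono mult_left_mono)
    show "real (card E) \<le> (9 * real M) ^ CARD('d)" using card by (metis of_nat_le_iff of_nat_mult of_nat_numeral of_nat_power)
  qed auto
  also have "((2 * pi) ^ CARD('d) * (9 * real M) ^ CARD('d)) ^ (e div 2 + 1) = (18 * pi * real M) ^ (CARD('d) + 2)"
    unfolding power_mult_distrib[symmetric] power_mult[symmetric] q by (simp add: mult_ac)
  also have "\<bar>C\<bar> * (18 * pi * real M) ^ (CARD('d) + 2) = B / 8 * real M ^ (CARD('d) + 2)"
    by (simp only: B_def power_mult_distrib) simp
  also have "\<dots> < harm M / 8 * real M ^ (CARD('d) + 2)"
    using M by (intro mult_strict_right_mono) auto
  also have "\<dots> = 1 * (real M ^ (CARD('d) + 2) * harm M / 8)" by simp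
  also have "\<dots> \<le> (2 * pi) ^ (CARD('d) + 1) * (real M ^ (CARD('d) + 2) * harm M / 8)"
    using pi_gt3 by (intro mult_right_mono one_le_power) (auto simp: harm_nonneg)
  also note low
  finally show thesis by (intro that[OF E])
qed

section \<open>The Strichartz estimate implied by differentiability\<close>

text \<open>
  The functional in the Taylor bound is $L(y) = \mathrm{Re} \langle y(T), i v(T) \rangle =
  \mathrm{Im} \langle y(T), v(T) \rangle$, whose norm is that of $v(T)$, that is $\|\varphi\|$; this
  supplies the last of the $e + 2$ factors $\|\varphi\|$.
\<close>

lemma strichartz_of_differentiability:
  fixes S :: "(real ^ 'd \<Rightarrow> complex) \<Rightarrow> real \<Rightarrow> real ^ 'd \<Rightarrow> complex"
  assumes d: "CARD('d) \<in> {1, 2}" and e: "e = 4 div CARD('d)" and mu: "\<bar>\<mu>\<bar> = 1" and T: "T > 0" and r: "r > 0"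
    and S: "data_to_solution_map \<mu> T r S" and F: "continuous_L2_extension T r S F"
    and diff: "ray_derivatives_bounded (e + 1) F"
  obtains K where "\<And>(E :: (real ^ 'd) set) \<tau>. finite E \<Longrightarrow> (\<And>n. n \<in> E \<Longrightarrow> lattice_point n) \<Longrightarrow>
      integral {0..T} (\<lambda>t. torus_integral (\<lambda>x. norm (wave E (\<tau> + t) x) ^ (e + 2)))
        \<le> K * ((2 * pi) ^ CARD('d) * real (card E)) ^ (e div 2 + 1)"
proof -
  obtain K where K: "0 \<le> K"
    and taylor: "\<And>L N \<phi> a C \<delta>\<^sub>0. linear L \<Longrightarrow> 0 \<le> N \<Longrightarrow> (\<And>y. \<bar>L y\<bar> \<le> N * norm y) \<Longrightarrow> 0 < \<delta>\<^sub>0 \<Longrightarrow>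
      (\<And>\<delta>. 0 < \<delta> \<Longrightarrow> \<delta> < \<delta>\<^sub>0 \<Longrightarrow> \<bar>L (F (\<delta> *\<^sub>R \<phi>)) - a * \<delta> ^ (e + 1)\<bar> \<le> C * \<delta> ^ Suc (e + 1)) \<Longrightarrow>
      \<bar>a\<bar> \<le> N * K * norm \<phi> ^ (e + 1)"
    using taylor_leading_coefficient_bound[OF diff] by auto
  have bound: "integral {0..T} (\<lambda>t. torus_integral (\<lambda>x. norm (wave E (\<tau> + t) x) ^ (e + 2)))
        \<le> K * ((2 * pi) ^ CARD('d) * real (card E)) ^ (e div 2 + 1)"
    if E: "finite E" "\<And>n. n \<in> E \<Longrightarrow> lattice_point n" for E :: "(real ^ 'd) set" and \<tau>
  proof -
    obtain vt vx vxx vtx where v: "free_flow T (\<lambda>t. wave E (\<tau> + t)) vt vx vxx vtx (real (card E))"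
      using wave_is_free_flow[OF T E] by metis
    interpret v: free_flow T "\<lambda>t. wave E (\<tau> + t)" vt vx vxx vtx "real (card E)" by (rule v)
    have tT: "T \<in> {0..T}" using T by auto
    define m where "m = (2 * pi) ^ CARD('d) * real (card E)"
    have m: "0 \<le> m" by (simp add: m_def)
    define I where "I = integral {0..T} (\<lambda>t. torus_integral (\<lambda>x. norm (wave E (\<tau> + t) x) ^ (e + 2)))"
    have I: "0 \<le> I"
      unfolding I_def using v.continuous_power_integral[of "e + 2"] v.nonneg(3)[of _ "e + 2"]
      by (intro integral_nonneg[OF integrable_continuous_real]) (simp_all only: v.power_integral_def[abs_def])
    obtain C \<delta>\<^sub>0 where \<delta>\<^sub>0: "0 < \<delta>\<^sub>0"
      and "\<And>\<delta> u ut ux uxx utx. 0 < \<delta> \<Longrightarrow> \<delta> < \<delta>\<^sub>0 \<Longrightarrow> nls_flow T u ut ux uxx utx \<mu> e \<Longrightarrow>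
        (\<And>x. u 0 x = of_real \<delta> * wave E (\<tau> + 0) x) \<Longrightarrow>
        \<bar>Im (torus_integral (\<lambda>x. u T x * cnj (wave E (\<tau> + T) x)))
          + \<mu> * \<delta> ^ (e + 1) * integral {0..T} (\<lambda>t. torus_integral (\<lambda>x. norm (wave E (\<tau> + t) x) ^ (e + 2)))\<bar>
        \<le> C * \<delta> ^ (e + 2)"
    proof (rule small_data_expansion[OF d e mu v], goal_cases)
      case (1 C \<delta>\<^sub>0)
      show ?case by (rule 1(1)[OF 1(2)]) (rule 1(3))
    qed
    note expansion = this(2)[folded I_def]
    have wave_cont: "continuous_on UNIV (wave E t)" for t
      unfolding wave_def by (intro continuous_intros)
    note wave_per = torus_periodic_wave[OF E(2)]
    define \<phi> where "\<phi> = abs_torus_L2 (wave E \<tau>)"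
    define z where "z = abs_torus_L2 (\<lambda>x. \<i> * wave E (\<tau> + T) x)"
    have iwave: "torus_periodic (\<lambda>x. \<i> * wave E t x)" "continuous_on UNIV (\<lambda>x. \<i> * wave E t x)" for t
      by (rule torus_periodic_compose[OF wave_per], assumption) (intro continuous_intros wave_cont)
    have norm_\<phi>: "norm \<phi> = sqrt m"
      unfolding \<phi>_def by (subst norm_abs_torus_L2_continuous[OF wave_per wave_cont])
        (simp_all add: wave_mass[OF E] m_def)
    have norm_z: "norm z = sqrt m"
      unfolding z_def by (subst norm_abs_torus_L2_continuous[OF iwave])
        (simp_all add: norm_mult wave_mass[OF E] m_def)
    define L where "L y = apply_bcontfun y T \<bullet> z" for y :: "real \<Rightarrow>\<^sub>C 'd torus_L2"
    define \<delta>\<^sub>1 where "\<delta>\<^sub>1 = min \<delta>\<^sub>0 (r / (sqrt m + 1))"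
    have \<delta>\<^sub>1: "0 < \<delta>\<^sub>1" using \<delta>\<^sub>0 r m by (simp add: \<delta>\<^sub>1_def add_nonneg_pos)
    have "\<bar>- \<mu> * I\<bar> \<le> norm z * K * norm \<phi> ^ (e + 1)"
    proof (rule taylor[of L _ \<delta>\<^sub>1 _ _ C])
      show "linear L"
        by (intro linearI) (simp_all add: L_def plus_bcontfun.rep_eq scaleR_bcontfun.rep_eq inner_add_left)
      show "\<bar>L y\<bar> \<le> norm z * norm y" for y
      proof -
        have "\<bar>L y\<bar> \<le> norm (apply_bcontfun y T) * norm z" unfolding L_def by (rule Cauchy_Schwarz_ineq2)
        also have "\<dots> \<le> norm y * norm z" by (intro mult_right_mono norm_bounded) auto
        finally show ?thesis by (simp add: mult.commute)
      qed
      show "0 \<le> norm z" by simp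
      show "0 < \<delta>\<^sub>1" by fact
      fix \<delta> assume \<delta>: "0 < \<delta>" "\<delta> < \<delta>\<^sub>1"
      define u0 where "u0 = (\<lambda>x. of_real \<delta> * wave E \<tau> x)"
      have u0: "torus_smooth u0" unfolding u0_def by (rule torus_smooth_wave[OF E])
      have \<delta>\<phi>: "\<delta> *\<^sub>R \<phi> = abs_torus_L2 u0"
        unfolding \<phi>_def u0_def
        by (rule scaleR_abs_torus_L2[OF continuous_imp_torus_square_integrable[OF wave_per wave_cont]])
      have "norm (abs_torus_L2 u0) = \<delta> * sqrt m" using \<delta> by (simp flip: \<delta>\<phi> add: norm_\<phi>)
      also have "\<dots> \<le> \<delta> * (sqrt m + 1)" using \<delta> by (intro mult_left_mono) auto
      also have "\<dots> \<le> r" using \<delta> m by (simp add: \<delta>\<^sub>1_def pos_less_divide_eq add_nonneg_pos less_imp_le)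
      finally have ball: "u0 \<in> smooth_data_ball r" using u0 by (simp add: smooth_data_ball_def)
      define u where "u = S u0"
      have u: "smooth_nls_solution \<mu> T u" "u 0 = u0"
        using S ball by (auto simp: data_to_solution_map_def u_def)
      obtain ut ux uxx utx where flow: "nls_flow T u ut ux uxx utx \<mu> e"
        using smooth_solution_is_flow[OF u(1) T d] unfolding e by metis
      interpret u: nls_flow T u ut ux uxx utx \<mu> e by (rule flow)
      have "L (F (\<delta> *\<^sub>R \<phi>)) = abs_torus_L2 (u T) \<bullet> z"
        using F ball tT unfolding L_def \<delta>\<phi> u_def continuous_L2_extension_def by simp
      also have "\<dots> = torus_integral (\<lambda>x. u T x \<bullet> (\<i> * wave E (\<tau> + T) x))"
        unfolding z_def by (rule inner_abs_torus_L2_continuous[OF u.per[OF tT] u.cont_slices(1)[OF tT] iwave])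
      also have "\<dots> = torus_integral (\<lambda>x. Im (u T x * cnj (wave E (\<tau> + T) x)))"
        by (simp add: inner_complex_def algebra_simps)
      also have "\<dots> = Im (torus_integral (\<lambda>x. u T x * cnj (wave E (\<tau> + T) x)))"
        by (intro torus_integral_Im continuous_intros u.cont_slices(1) tT wave_cont)
      finally have "L (F (\<delta> *\<^sub>R \<phi>)) - - \<mu> * I * \<delta> ^ (e + 1)
          = Im (torus_integral (\<lambda>x. u T x * cnj (wave E (\<tau> + T) x))) + \<mu> * \<delta> ^ (e + 1) * I"
        by simp
      then show "\<bar>L (F (\<delta> *\<^sub>R \<phi>)) - - \<mu> * I * \<delta> ^ (e + 1)\<bar> \<le> C * \<delta> ^ Suc (e + 1)"
        using expansion[OF \<delta>(1) _ flow] \<delta>(2) by (simp add: \<delta>\<^sub>1_def u(2) u0_def mult_ac)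
    qed
    also have "norm z * K * norm \<phi> ^ (e + 1) = K * (sqrt m) ^ (2 * (e div 2 + 1))"
    proof -
      have "2 * (e div 2 + 1) = Suc (e + 1)" using d e by auto
      then show ?thesis unfolding norm_z norm_\<phi> by (simp only: power_Suc mult_ac)
    qed
    also have "\<dots> = K * m ^ (e div 2 + 1)" using m by (simp only: power_mult) simp
    finally show ?thesis
      using I mu by (simp add: I_def m_def abs_mult)
  qed
  then show thesis by (rule that)
qed

text \<open>
  Cut the interval into pieces of length $T$; the bound does not depend on the starting time $\tau$.
\<close>

lemma strichartz_on_long_time_interval:
  fixes E :: "(real ^ 'd) set"
  assumes T: "T > 0"
    and short: "\<And>\<tau>. integral {0..T} (\<lambda>t. torus_integral (\<lambda>x. norm (wave E (\<tau> + t) x) ^ p)) \<le> B"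
  shows "integral {0..real n * T} (\<lambda>t. torus_integral (\<lambda>x. norm (wave E t x) ^ p)) \<le> real n * B"
proof (induction n)
  case (Suc n)
  define g where "g t = torus_integral (\<lambda>x. norm (wave E t x) ^ p)" for t
  have g: "continuous_on A g" for A
    unfolding g_def[abs_def] by (rule integral_continuous_on_param)
      (auto simp: wave_def split_def intro!: continuous_intros)
  have "integral {0..real (Suc n) * T} g = integral {0..real n * T} g + integral {real n * T..real (Suc n) * T} g"
    using T by (intro Henstock_Kurzweil_Integration.integral_combine[symmetric] integrable_continuous_real g)
      (auto simp: algebra_simps)
  also have "integral {real n * T..real (Suc n) * T} g = integral {0..T} (\<lambda>t. g (real n * T + t))"
    using integral_shift_cbox[of "real n * T" "real n * T" "real (Suc n) * T" g]
    by (simp add: algebra_simps)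
  also have "\<dots> \<le> B" unfolding g_def by (rule short)
  finally show ?case using Suc by (simp add: g_def[abs_def] algebra_simps)
qed simp

theorem corollary1p3:
  fixes \<mu> T r :: real
    and S :: "(real ^ 'd \<Rightarrow> complex) \<Rightarrow> real \<Rightarrow> real ^ 'd \<Rightarrow> complex"
    and F :: "'d torus_L2 \<Rightarrow> (real \<Rightarrow>\<^sub>C 'd torus_L2)"
  assumes "CARD('d) \<in> {1, 2}" and "\<mu> \<in> {1, -1}" and "T > 0" and "r > 0"
    and "data_to_solution_map \<mu> T r S"
    and "continuous_L2_extension T r S F"
  shows "(CARD('d) = 1 \<longrightarrow> \<not> C5_at 0 F) \<and> (CARD('d) = 2 \<longrightarrow> \<not> C3_at 0 F)"
proof -
  define e where "e = 4 div CARD('d)"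
  have mu: "\<bar>\<mu>\<bar> = 1" using assms(2) by auto
  have contra: False if diff: "ray_derivatives_bounded (e + 1) F"
  proof -
    obtain K where K: "\<And>(E :: (real ^ 'd) set) \<tau>. finite E \<Longrightarrow> (\<And>n. n \<in> E \<Longrightarrow> lattice_point n) \<Longrightarrow>
      integral {0..T} (\<lambda>t. torus_integral (\<lambda>x. norm (wave E (\<tau> + t) x) ^ (e + 2)))
        \<le> K * ((2 * pi) ^ CARD('d) * real (card E)) ^ (e div 2 + 1)"
      using strichartz_of_differentiability[OF assms(1) e_def mu assms(3-6) diff] by metis
    define n where "n = nat \<lceil>2 * pi / T\<rceil>"
    have "2 * pi / T \<le> real n" unfolding n_def by (rule real_nat_ceiling_ge)
    then have n: "2 * pi \<le> real n * T" using assms(3) by (simp add: field_simps)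
    obtain E :: "(real ^ 'd) set" where E: "finite E" "\<And>n. n \<in> E \<Longrightarrow> lattice_point n"
      and large: "(real n * K) * ((2 * pi) ^ CARD('d) * real (card E)) ^ (e div 2 + 1)
        < integral {0..2 * pi} (\<lambda>t. torus_integral (\<lambda>x. norm (wave E t x) ^ (e + 2)))"
      using no_periodic_strichartz_estimate[OF assms(1) e_def, of "real n * K"] by metis
    define g where "g t = torus_integral (\<lambda>x. norm (wave E t x) ^ (e + 2))" for t
    have g: "continuous_on A g" for A
      unfolding g_def[abs_def] by (rule integral_continuous_on_param)
        (auto simp: wave_def split_def intro!: continuous_intros)
    have "integral {0..2 * pi} g \<le> integral {0..real n * T} g"
      using n by (intro integral_subset_le integrable_continuous_real g)
        (auto simp: g_def wave_def intro!: torus_integral_nonneg continuous_intros)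
    also have "\<dots> \<le> real n * (K * ((2 * pi) ^ CARD('d) * real (card E)) ^ (e div 2 + 1))"
      unfolding g_def by (intro strichartz_on_long_time_interval[OF assms(3)] K E)
    finally show False using large by (simp add: g_def[abs_def] mult.assoc)
  qed
  show ?thesis
    using contra C3_at_ray_derivatives_bounded[of F] C5_at_ray_derivatives_bounded[of F]
    by (auto simp: e_def)
qed

end
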